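(* Let $(\beta^*,p^*,x^* )$ be the limit first-price pacing equilibrium $\mathrm{FPPE}(b,v,s)$ and, for each $t$, consider the observed equilibrium $\widehat{\mathrm{FPPE}}(b,v,t^{-1},\gamma)$, where $\gamma=(\theta^1,\dots,\theta^t)$ consists of i.i.d. draws from $s$. Assume (SMO) and (SCS). Then, as $t\to\infty$, $\sqrt t(u^\gamma-u^* )$, $\sqrt t(\delta^\gamma-\delta^* )$ and $\sqrt t(\mathrm{NSW}^\gamma-\mathrm{NSW}^* )$ are asymptotically normal (converge in distribution to possibly degenerate normals) with means zero and (co)variances, respectively, $$\Sigma_u=\mathrm{diag}\big(b_i/(\beta_i^* )^2\big)\,\Sigma_\beta\,\mathrm{diag}\big(b_i/(\beta_i^* )^2\big),$$ $$\Sigma_\delta=\big(I_n-\mathcal H(\mathcal H_B)^\dagger\big)\,\Omega\,\big(I_n-\mathcal H(\mathcal H_B)^\dagger\big)^\top,$$ $$\sigma^2_{\mathrm{NSW}}=w^\top\Sigma_\beta w,\qquad w=(b_1/\beta_1^*,\dots,b_n/\beta_n^* )^\top,$$ where $\Omega=\mathrm{Var}(\mu^* )$ and $\Sigma_\beta=(\mathcal H_B)^\dagger\,\mathrm{Var}(\mu^* )\,(\mathcal H_B)^\dagger$.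
   Context: Market. There are $n$ buyers with budgets $b=(b_1,\dots,b_n)$, $b_i>0$, and an item space $\Theta$ with integrating measure $d\theta$. $L^p$ (resp. $L^p_+$) denotes (nonnegative) $L^p$ functions on $\Theta$; functions agreeing outside a measure-zero set are identified; $\langle f,g\rangle=\int_\Theta fg\,d\theta$. Buyer $i$ has valuation $v_i\in L^1_+$, $v=(v_1,\dots,v_n)$, with $\bar v=\max_i\sup_\theta v_i(\theta)<\infty$. The supply is $s\in L^\infty_+$ with $\int_\Theta s\,d\theta=1$. Write $\mathbb E[g]=\int g(\theta)s(\theta)\,d\theta$, and $\mathrm{Var}(g)$ for the variance (covariance matrix if $g$ is vector-valued) under the density $s$. Limit FPPE. $\mathrm{FPPE}(b,v,s)$ is a tuple $(\beta,p,x_1,\dots,x_n)\in[0,1]^n\times L^1_+\times(L^\infty_+)^n$ such that: (i) for all $\theta$, $p(\theta)=\max_i\beta_iv_i(\theta)$, and $x_i(\theta)>0$ implies $\beta_iv_i(\theta)=\max_k\beta_kv_k(\theta)$; (ii) for all $i$, $\int x_i p s\,d\theta\le b_i$, and for all $\theta$, $\sum_i x_i(\theta)\le1$; (iii) for all $i$, $\int x_ips\,d\theta<b_i$ implies $\beta_i=1$, and for all $\theta$, $p(\theta)>0$ implies $\sum_ix_i(\theta)=1$. It is known that it exists and $\beta^*,p^*$ are unique; limit quantities carry a superscript $*$. Define leftover budgets $\delta_i^*=b_i-\langle p^*,sx_i^*\rangle$, item utilities $\bar\mu_i^*=\langle v_i,sx_i^*\rangle$, total utilities $u_i^*=\bar\mu_i^*+\delta_i^*$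 (it is known that $u_i^*=b_i/\beta_i^*$), $\mathrm{NSW}^*=\sum_ib_i\log u_i^*$, and $\mu^*(\theta)=(x_1^*(\theta)v_1(\theta),\dots,x_n^*(\theta)v_n(\theta))$. (Under (SMO) below, $\mu^*$, $\bar\mu^*$, $\delta^*$ are uniquely determined.) Observed FPPE. For items $\gamma=(\theta^1,\dots,\theta^t)$ and per-item supply $\sigma>0$, $\widehat{\mathrm{FPPE}}(b,v,\sigma,\gamma)$ consists of $\beta\in[0,1]^n$, $p\in\mathbb R_+^t$, $x_i\in[0,1]^t$ satisfying: $p(\theta^\tau)=\max_i\beta_iv_i(\theta^\tau)$ and $x_i(\theta^\tau)>0$ implies $\beta_iv_i(\theta^\tau)=\max_k\beta_kv_k(\theta^\tau)$; $\sigma\sum_\tau x_i(\theta^\tau)p(\theta^\tau)\le b_i$ and $\sum_ix_i(\theta^\tau)\le1$; $\sigma\sum_\tau x_i(\theta^\tau)p(\theta^\tau)<b_i$ implies $\beta_i=1$, and $p(\theta^\tau)>0$ implies $\sum_ix_i(\theta^\tau)=1$. With $\sigma=1/t$, quantities of an observed FPPE carry a superscript $\gamma$: $\delta_i^\gamma=b_i-\frac1t\sum_\tau p^\gamma(\theta^\tau)x_i^\gamma(\theta^\tau)$, $\bar\mu_i^\gamma=\frac1t\sum_\tau v_i(\theta^\tau)x_i^\gamma(\theta^\tau)$, $u_i^\gamma=\delta_i^\gamma+\bar\mu_i^\gamma$ (it is known that $u_i^\gamma=b_i/\beta_i^\gamma$), $\mathrm{NSW}^\gamma=\sum_ib_i\log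 u_i^\gamma$. Dual program. $H(\beta)=\mathbb E[\max_i\beta_iv_i(\theta)]-\sum_ib_i\log\beta_i$; it is known that $\beta^*$ is its unique minimizer over $B=(0,1]^n$. (SMO): the map $\beta\mapsto\mathbb E[\max_i\beta_iv_i(\theta)]$ is $C^2$ in a neighborhood of $\beta^*$. (SCS): $\beta_i^*=1$ implies $\delta_i^*>0$, for every $i$. Let $\mathcal H=\nabla^2H(\beta^* )$, $\mathcal P=\mathrm{diag}(\mathbf 1(\beta_i^*<1))$, $\mathcal H_B=\mathcal P\mathcal H\mathcal P$; $\dagger$ is the Moore–Penrose pseudo-inverse and $I_n$ the identity matrix. *)

theory Defs
  imports "HOL-Probability.Probability"
begin

definition diag :: "('n \<Rightarrow> real) \<Rightarrow> real^'n^'n" where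
  "diag d = (\<chi> i j. if i = j then d i else 0)"

definition is_pinv :: "real^'n^'m \<Rightarrow> real^'m^'n \<Rightarrow> bool" where
  "is_pinv A X \<longleftrightarrow>
     A ** X ** A = A \<and> X ** A ** X = X \<and>
     transpose (A ** X) = A ** X \<and> transpose (X ** A) = X ** A"

text \<open>The Moore-Penrose pseudo-inverse, the unique solution of the four Penrose equations.\<close>

definition pinv :: "real^'n^'m \<Rightarrow> real^'m^'n" where
  "pinv A = (THE X. is_pinv A X)"

lemma is_pinv_unique:
  assumes "is_pinv A X" "is_pinv A Y"
  shows "X = Y"
proof -
  have AX: "A ** X = A ** Y"
  proof -
    have "A ** X = transpose (A ** X)" using assms(1) by (simp add: is_pinv_def)
    also have "\<dots> = transpose ((A ** Y) ** (A ** X))"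
      using assms(2) by (simp add: is_pinv_def matrix_mul_assoc)
    also have "\<dots> = (A ** X) ** (A ** Y)"
      using assms by (simp add: is_pinv_def matrix_transpose_mul[of "A ** Y" "A ** X"])
    also have "\<dots> = A ** Y" using assms(1) by (simp add: is_pinv_def matrix_mul_assoc)
    finally show ?thesis .
  qed
  have XA: "X ** A = Y ** A"
  proof -
    have "X ** A = transpose (X ** A)" using assms(1) by (simp add: is_pinv_def)
    also have "\<dots> = transpose ((X ** A) ** (Y ** A))"
      using assms(2) by (simp add: is_pinv_def flip: matrix_mul_assoc)
    also have "\<dots> = (Y ** A) ** (X ** A)"
      using assms by (simp add: is_pinv_def matrix_transpose_mul[of "X ** A" "Y ** A"])
    also have "\<dots> = Y ** A" using assms(1) by (simp add: is_pinv_def flip: matrix_mul_assoc)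
    finally show ?thesis .
  qed
  have "X = X ** (A ** X)" using assms(1) by (simp add: is_pinv_def matrix_mul_assoc)
  also have "\<dots> = Y ** A ** Y" by (simp add: AX XA matrix_mul_assoc)
  also have "\<dots> = Y" using assms(2) by (simp add: is_pinv_def)
  finally show ?thesis .
qed

definition gradient :: "(real^'n \<Rightarrow> real) \<Rightarrow> real^'n \<Rightarrow> real^'n" where
  "gradient f x = (\<chi> i. frechet_derivative f (at x) (axis i 1))"

definition hessian :: "(real^'n \<Rightarrow> real) \<Rightarrow> real^'n \<Rightarrow> real^'n^'n" where
  "hessian f x = jacobian (gradient f) (at x)"

definition C2_near :: "(real^'n \<Rightarrow> real) \<Rightarrow> real^'n \<Rightarrow> bool" where
  "C2_near f x \<longleftrightarrow>
     (\<exists>U. open U \<and> x \<in> U \<and> f differentiable_on U \<and> gradient f differentiable_on U \<and>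
          continuous_on U (hessian f))"

text \<open>Normal law with given mean and variance, as the image of the standard normal law;
  variance zero gives a point mass.\<close>

definition normal_law :: "real \<Rightarrow> real \<Rightarrow> real measure" where
  "normal_law m var = distr std_normal_distribution borel (\<lambda>z. m + sqrt var * z)"

text \<open>Possibly degenerate multivariate normal laws: all one-dimensional projections are normal.\<close>

definition multivariate_normal :: "(real^'n) measure \<Rightarrow> real^'n \<Rightarrow> real^'n^'n \<Rightarrow> bool" where
  "multivariate_normal N m S \<longleftrightarrow>
     sets N = sets borel \<and> prob_space N \<and>
     (\<forall>a. \<exists>\<mu> var. 0 \<le> var \<and> distr N borel (\<lambda>x. a \<bullet> x) = normal_law \<mu> var) \<and>
     (\<forall>i. (\<integral>x. x $ i \<partial>N) = m $ i) \<and>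
     (\<forall>i j. (\<integral>x. (x $ i - m $ i) * (x $ j - m $ j) \<partial>N) = S $ i $ j)"

definition converges_in_distribution ::
  "'w measure \<Rightarrow> (nat \<Rightarrow> 'w \<Rightarrow> real^'n) \<Rightarrow> (real^'n) measure \<Rightarrow> bool" where
  "converges_in_distribution P Z N \<longleftrightarrow>
     (\<forall>t. Z t \<in> borel_measurable P) \<and>
     (\<forall>f :: real^'n \<Rightarrow> real. continuous_on UNIV f \<longrightarrow> bounded (range f) \<longrightarrow>
        (\<lambda>t. \<integral>w. f (Z t w) \<partial>P) \<longlonglongrightarrow> (\<integral>x. f x \<partial>N))"

definition asymp_normal :: "'w measure \<Rightarrow> (nat \<Rightarrow> 'w \<Rightarrow> real^'n) \<Rightarrow> real^'n^'n \<Rightarrow> bool" where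
  "asymp_normal P Z S \<longleftrightarrow>
     (\<exists>N. multivariate_normal N 0 S \<and> converges_in_distribution P Z N)"

definition asymp_normal_real :: "'w measure \<Rightarrow> (nat \<Rightarrow> 'w \<Rightarrow> real) \<Rightarrow> real \<Rightarrow> bool" where
  "asymp_normal_real P Z var \<longleftrightarrow>
     0 \<le> var \<and> (\<forall>t. Z t \<in> borel_measurable P) \<and>
     weak_conv_m (\<lambda>t. distr P borel (Z t)) (normal_law 0 var)"

text \<open>The item space is \<open>space M\<close> and \<open>d\<theta>\<close> is the measure \<open>M\<close>. Since functions agreeing almost
  everywhere are identified, pointwise conditions on them hold almost everywhere.\<close>

definition L1_plus :: "'a measure \<Rightarrow> ('a \<Rightarrow> real) \<Rightarrow> bool" where
  "L1_plus M f \<longleftrightarrow> integrable M f \<and> (AE \<theta> in M. 0 \<le> f \<theta>)"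

definition Linf_plus :: "'a measure \<Rightarrow> ('a \<Rightarrow> real) \<Rightarrow> bool" where
  "Linf_plus M f \<longleftrightarrow>
     f \<in> borel_measurable M \<and> (AE \<theta> in M. 0 \<le> f \<theta>) \<and> (\<exists>C. AE \<theta> in M. f \<theta> \<le> C)"

definition market ::
  "'a measure \<Rightarrow> real^'n \<Rightarrow> ('n::finite \<Rightarrow> 'a \<Rightarrow> real) \<Rightarrow> ('a \<Rightarrow> real) \<Rightarrow> bool" where
  "market M b v s \<longleftrightarrow>
     (\<forall>i. 0 < b $ i) \<and>
     (\<forall>i. L1_plus M (v i)) \<and> (\<exists>vbar. \<forall>i. AE \<theta> in M. v i \<theta> \<le> vbar) \<and>
     Linf_plus M s \<and> (\<integral>\<theta>. s \<theta> \<partial>M) = 1"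

definition max_bid :: "('n::finite \<Rightarrow> 'a \<Rightarrow> real) \<Rightarrow> real^'n \<Rightarrow> 'a \<Rightarrow> real" where
  "max_bid v \<beta> \<theta> = (MAX i. \<beta> $ i * v i \<theta>)"

definition expec :: "'a measure \<Rightarrow> ('a \<Rightarrow> real) \<Rightarrow> ('a \<Rightarrow> real) \<Rightarrow> real" where
  "expec M s g = (\<integral>\<theta>. g \<theta> * s \<theta> \<partial>M)"

definition covar :: "'a measure \<Rightarrow> ('a \<Rightarrow> real) \<Rightarrow> ('a \<Rightarrow> real^'n) \<Rightarrow> real^'n^'n" where
  "covar M s g = (\<chi> i j. expec M s (\<lambda>\<theta>.
     (g \<theta> $ i - expec M s (\<lambda>\<theta>. g \<theta> $ i)) * (g \<theta> $ j - expec M s (\<lambda>\<theta>. g \<theta> $ j))))"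

definition is_FPPE ::
  "'a measure \<Rightarrow> real^'n \<Rightarrow> ('n::finite \<Rightarrow> 'a \<Rightarrow> real) \<Rightarrow> ('a \<Rightarrow> real) \<Rightarrow>
   real^'n \<Rightarrow> ('a \<Rightarrow> real) \<Rightarrow> ('n \<Rightarrow> 'a \<Rightarrow> real) \<Rightarrow> bool" where
  "is_FPPE M b v s \<beta> p x \<longleftrightarrow>
     (\<forall>i. 0 \<le> \<beta> $ i \<and> \<beta> $ i \<le> 1) \<and> L1_plus M p \<and> (\<forall>i. Linf_plus M (x i)) \<and>
     (AE \<theta> in M. p \<theta> = max_bid v \<beta> \<theta>) \<and>
     (\<forall>i. AE \<theta> in M. 0 < x i \<theta> \<longrightarrow> \<beta> $ i * v i \<theta> = max_bid v \<beta> \<theta>) \<and>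
     (\<forall>i. (\<integral>\<theta>. x i \<theta> * p \<theta> * s \<theta> \<partial>M) \<le> b $ i) \<and>
     (AE \<theta> in M. (\<Sum>i\<in>UNIV. x i \<theta>) \<le> 1) \<and>
     (\<forall>i. (\<integral>\<theta>. x i \<theta> * p \<theta> * s \<theta> \<partial>M) < b $ i \<longrightarrow> \<beta> $ i = 1) \<and>
     (AE \<theta> in M. 0 < p \<theta> \<longrightarrow> (\<Sum>i\<in>UNIV. x i \<theta>) = 1)"

text \<open>The \<open>t\<close> sampled items are \<open>\<gamma> 0, \<dots>, \<gamma> (t - 1)\<close>; prices and allocations are indexed by the
  position in the sample.\<close>

definition is_observed_FPPE ::
  "real^'n \<Rightarrow> ('n::finite \<Rightarrow> 'a \<Rightarrow> real) \<Rightarrow> real \<Rightarrow> nat \<Rightarrow> (nat \<Rightarrow> 'a) \<Rightarrow>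
   real^'n \<Rightarrow> (nat \<Rightarrow> real) \<Rightarrow> ('n \<Rightarrow> nat \<Rightarrow> real) \<Rightarrow> bool" where
  "is_observed_FPPE b v \<sigma> t \<gamma> \<beta> p x \<longleftrightarrow>
     (\<forall>i. 0 \<le> \<beta> $ i \<and> \<beta> $ i \<le> 1) \<and> (\<forall>\<tau><t. 0 \<le> p \<tau>) \<and>
     (\<forall>i. \<forall>\<tau><t. 0 \<le> x i \<tau> \<and> x i \<tau> \<le> 1) \<and>
     (\<forall>\<tau><t. p \<tau> = max_bid v \<beta> (\<gamma> \<tau>)) \<and>
     (\<forall>i. \<forall>\<tau><t. 0 < x i \<tau> \<longrightarrow> \<beta> $ i * v i (\<gamma> \<tau>) = max_bid v \<beta> (\<gamma> \<tau>)) \<and>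
     (\<forall>i. \<sigma> * (\<Sum>\<tau><t. x i \<tau> * p \<tau>) \<le> b $ i) \<and>
     (\<forall>\<tau><t. (\<Sum>i\<in>UNIV. x i \<tau>) \<le> 1) \<and>
     (\<forall>i. \<sigma> * (\<Sum>\<tau><t. x i \<tau> * p \<tau>) < b $ i \<longrightarrow> \<beta> $ i = 1) \<and>
     (\<forall>\<tau><t. 0 < p \<tau> \<longrightarrow> (\<Sum>i\<in>UNIV. x i \<tau>) = 1)"

definition leftover ::
  "'a measure \<Rightarrow> real^'n \<Rightarrow> ('a \<Rightarrow> real) \<Rightarrow> ('a \<Rightarrow> real) \<Rightarrow> ('n \<Rightarrow> 'a \<Rightarrow> real) \<Rightarrow> real^'n" where
  "leftover M b s p x = (\<chi> i. b $ i - (\<integral>\<theta>. p \<theta> * (s \<theta> * x i \<theta>) \<partial>M))"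

definition item_utility ::
  "'a measure \<Rightarrow> ('n \<Rightarrow> 'a \<Rightarrow> real) \<Rightarrow> ('a \<Rightarrow> real) \<Rightarrow> ('n \<Rightarrow> 'a \<Rightarrow> real) \<Rightarrow> real^'n" where
  "item_utility M v s x = (\<chi> i. \<integral>\<theta>. v i \<theta> * (s \<theta> * x i \<theta>) \<partial>M)"

definition utility ::
  "'a measure \<Rightarrow> real^'n \<Rightarrow> ('n \<Rightarrow> 'a \<Rightarrow> real) \<Rightarrow> ('a \<Rightarrow> real) \<Rightarrow> ('a \<Rightarrow> real) \<Rightarrow>
   ('n \<Rightarrow> 'a \<Rightarrow> real) \<Rightarrow> real^'n" where
  "utility M b v s p x = item_utility M v s x + leftover M b s p x"

definition observed_leftover ::
  "real^'n \<Rightarrow> nat \<Rightarrow> (nat \<Rightarrow> real) \<Rightarrow> ('n \<Rightarrow> nat \<Rightarrow> real) \<Rightarrow> real^'n" where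
  "observed_leftover b t p x = (\<chi> i. b $ i - 1 / real t * (\<Sum>\<tau><t. p \<tau> * x i \<tau>))"

definition observed_item_utility ::
  "('n \<Rightarrow> 'a \<Rightarrow> real) \<Rightarrow> nat \<Rightarrow> (nat \<Rightarrow> 'a) \<Rightarrow> ('n \<Rightarrow> nat \<Rightarrow> real) \<Rightarrow> real^'n" where
  "observed_item_utility v t \<gamma> x = (\<chi> i. 1 / real t * (\<Sum>\<tau><t. v i (\<gamma> \<tau>) * x i \<tau>))"

definition observed_utility ::
  "real^'n \<Rightarrow> ('n \<Rightarrow> 'a \<Rightarrow> real) \<Rightarrow> nat \<Rightarrow> (nat \<Rightarrow> 'a) \<Rightarrow> (nat \<Rightarrow> real) \<Rightarrow>
   ('n \<Rightarrow> nat \<Rightarrow> real) \<Rightarrow> real^'n" where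
  "observed_utility b v t \<gamma> p x = observed_leftover b t p x + observed_item_utility v t \<gamma> x"

definition NSW :: "real^'n \<Rightarrow> real^'n \<Rightarrow> real" where
  "NSW b u = (\<Sum>i\<in>UNIV. b $ i * ln (u $ i))"

definition item_values :: "('n \<Rightarrow> 'a \<Rightarrow> real) \<Rightarrow> ('n \<Rightarrow> 'a \<Rightarrow> real) \<Rightarrow> 'a \<Rightarrow> real^'n" where
  "item_values v x \<theta> = (\<chi> i. x i \<theta> * v i \<theta>)"

definition dual_obj ::
  "'a measure \<Rightarrow> real^'n \<Rightarrow> ('n::finite \<Rightarrow> 'a \<Rightarrow> real) \<Rightarrow> ('a \<Rightarrow> real) \<Rightarrow> real^'n \<Rightarrow> real" where
  "dual_obj M b v s \<beta> = expec M s (max_bid v \<beta>) - (\<Sum>i\<in>UNIV. b $ i * ln (\<beta> $ i))"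

definition SMO ::
  "'a measure \<Rightarrow> ('n::finite \<Rightarrow> 'a \<Rightarrow> real) \<Rightarrow> ('a \<Rightarrow> real) \<Rightarrow> real^'n \<Rightarrow> bool" where
  "SMO M v s \<beta> \<longleftrightarrow> C2_near (\<lambda>\<beta>. expec M s (max_bid v \<beta>)) \<beta>"

definition SCS ::
  "'a measure \<Rightarrow> real^'n \<Rightarrow> ('a \<Rightarrow> real) \<Rightarrow> real^'n \<Rightarrow> ('a \<Rightarrow> real) \<Rightarrow>
   ('n \<Rightarrow> 'a \<Rightarrow> real) \<Rightarrow> bool" where
  "SCS M b s \<beta> p x \<longleftrightarrow> (\<forall>i. \<beta> $ i = 1 \<longrightarrow> 0 < leftover M b s p x $ i)"

end

theory Submission
  imports Defs
begin

text \<open>An equilibrium is the first-order condition of a convex program. With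
\<open>\<mu>\<^sub>i\<close> the item utility of buyer \<open>i\<close>, the vector \<open>\<mu>\<close> is a subgradient at the pacing vector of the
(expected or sample average of the) maximal bid, and the leftover budget
\<open>\<delta>\<^sub>i = b\<^sub>i - \<beta>\<^sub>i \<mu>\<^sub>i\<close> is the multiplier of the constraint \<open>\<beta>\<^sub>i \<le> 1\<close> in the minimisation of that
function minus \<open>\<Sum>\<^sub>i b\<^sub>i ln \<beta>\<^sub>i\<close>. So the observed equilibrium is a constrained convex M-estimator of the limit
one. Complementary slackness gives \<open>u\<^sub>i = b\<^sub>i / \<beta>\<^sub>i\<close> for both, which makes utilities and Nash social
welfare smooth functions of the pacing vector.

Let \<open>W\<close> be the normalised sum of the centred item values of the limit allocation over the sample, and let
\<open>h\<close> be \<open>sqrt t\<close> times the deviation of the observed pacing vector (\<open>dev\<close> below). The proof shows that everything is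
linear in \<open>W\<close> up to a term that vanishes in probability.

\<^item> Rate. Subgradients of the sample average are monotone, and the logarithmic barrier is strongly monotone on
\<open>(0,1]\<close>. Comparing the two equilibria therefore bounds \<open>h\<close> by a multiple of \<open>W\<close>
(\<open>regular_dev_bound\<close>); consistency is a by-product.

\<^item> Local expansion. Subtract from the sampled maximal bids, in the local coordinate \<open>h\<close>, their linear part at
the limit. The remaining sum is convex in \<open>h\<close>, its mean tends to a quadratic form given by the Hessian \<open>A\<close>
of the expected maximal bid, and its variance tends to zero because each nonnegative summand is
\<open>O(1 / sqrt t)\<close> while the sum of the means stays bounded. Convexity turns this pointwise convergence into
convergence of subgradients at the random point \<open>h\<close>
(\<open>vanishing_subgradient_of_convex_process\<close>): the error of the item utilities, scaled by \<open>sqrt t\<close>, is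
\<open>W + A h + o\<^sub>P(1)\<close>.

\<^item> Leftover budgets. Expanding \<open>b\<^sub>i / \<beta>\<^sub>i\<close> to first order adds the Hessian of the barrier, so the scaled error
of the leftover budgets is \<open>- (H h + W) + o\<^sub>P(1)\<close> (\<open>leftover_expansion\<close>).

\<^item> Active set. Strict complementary slackness makes the observed active constraints agree with those of the
limit with probability tending to one (\<open>active_set_identified\<close>). On the inactive coordinates the left-hand
side above is then zero, and on the active ones \<open>h\<close> is zero. As \<open>H\<close> is positive definite, the
pseudo-inverse of its compression inverts the equation on the inactive block, so that \<open>h\<close> is
\<open>- pinv HB *v W + o\<^sub>P(1)\<close> (\<open>dev_linear\<close>). The other linearisations follow from it.

\<^item> Limit law. The one-dimensional central limit theorem applies to every projection of \<open>W\<close>, and a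
Cramer-Wold argument based on trigonometric approximation (\<open>Cramer_Wold\<close>) assembles the projections.\<close>

section \<open>Covariance factors and the pseudo-inverse of a compressed matrix\<close>

text \<open>This is a Cholesky factorisation, used to realise a prescribed covariance as a linear image of independent standard
normals. It subtracts one rank-one term per pivot; a zero pivot of a semidefinite matrix has a zero row, so each
step confines the nonzero rows to a smaller index set.\<close>

lemma psd_sum_rank_one:
  fixes S :: "real^'n::finite^'n"
  assumes sym: "\<And>i j. S $ i $ j = S $ j $ i"
    and psd: "\<And>a. 0 \<le> a \<bullet> (S *v a)"
  shows "\<exists>l :: 'n \<Rightarrow> real^'n. \<forall>i j. S $ i $ j = (\<Sum>k\<in>UNIV. l k $ i * l k $ j)"
proof -
  have quad: "a \<bullet> (S *v a) = (\<Sum>i\<in>UNIV. \<Sum>j\<in>UNIV. a $ i * S $ i $ j * a $ j)"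
    for a and S :: "real^'n^'n"
    by (simp add: inner_vec_def matrix_vector_mult_def sum_distrib_left mult.assoc)
  have "\<exists>l :: 'n \<Rightarrow> real^'n. (\<forall>k. k \<notin> K \<longrightarrow> l k = 0) \<and>
          (\<forall>i j. S $ i $ j = (\<Sum>k\<in>UNIV. l k $ i * l k $ j))"
    if "finite K" and "\<And>i j. S $ i $ j = S $ j $ i" and "\<And>a. 0 \<le> a \<bullet> (S *v a)"
      and "\<And>i j. i \<notin> K \<Longrightarrow> S $ i $ j = 0"
    for K and S :: "real^'n^'n"
    using that
  proof (induction K arbitrary: S rule: finite_induct)
    case empty
    then show ?case by (intro exI[of _ "\<lambda>_. 0"]) auto
  next
    case (insert k K)
    note sym = insert.prems(1) and psd = insert.prems(2) and supp = insert.prems(3)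
    have two: "a \<bullet> (S *v a) = x\<^sup>2 * S $ i $ i + 2 * x * y * S $ i $ j + y\<^sup>2 * S $ j $ j"
      if "i \<noteq> j" "a = axis i x + axis j y" for a i j x y
    proof -
      have m: "S *v axis l z = (\<chi> m. S $ m $ l * z)" for l z
        by (simp add: matrix_vector_mult_def axis_def vec_eq_iff if_distrib if_distribR sum.delta cong: if_cong)
      show ?thesis using that sym[of j i]
        by (simp add: matrix_vector_right_distrib inner_add_left inner_add_right inner_axis' m
              power2_eq_square algebra_simps)
    qed
    have diag0: "0 \<le> S $ k $ k"
      using psd[of "axis k 1"] by (simp add: matrix_vector_mult_basis inner_axis' column_def)
    show ?case
    proof (cases "S $ k $ k = 0")
      case True
      have "S $ k $ j = 0" for j
      proof (rule ccontr)
        assume nz: "S $ k $ j \<noteq> 0"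
        then have kj: "k \<noteq> j" using True by auto
        \<comment> \<open>this makes the quadratic form at \<open>axis k y + axis j 1\<close> equal to \<open>- 1\<close>\<close>
        define y where "y = - (S $ j $ j + 1) / (2 * S $ k $ j)"
        have "0 \<le> y\<^sup>2 * S $ k $ k + 2 * y * 1 * S $ k $ j + 1\<^sup>2 * S $ j $ j"
          using psd[of "axis k y + axis j 1"] two[OF kj refl] by metis
        then have "0 \<le> 2 * y * S $ k $ j + S $ j $ j" using True by simp
        also have "2 * y * S $ k $ j = - (S $ j $ j + 1)" using nz by (simp add: y_def)
        finally show False by simp
      qed
      then have supp0: "S $ i $ j = 0" if "i \<notin> K" for i j
        using supp[of i j] that by (cases "i = k") auto
      obtain l :: "'n \<Rightarrow> real^'n" where "\<forall>m. m \<notin> K \<longrightarrow> l m = 0"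
          "\<forall>i j. S $ i $ j = (\<Sum>k\<in>UNIV. l k $ i * l k $ j)"
        using insert.IH[OF sym psd supp0] by blast
      then show ?thesis by (intro exI[of _ l]) auto
    next
      case False
      then have pos: "0 < S $ k $ k" using diag0 by simp
      define c where "c = (\<chi> i. S $ i $ k / sqrt (S $ k $ k))"
      define S' :: "real^'n^'n" where "S' = (\<chi> i j. S $ i $ j - c $ i * c $ j)"
      have cc: "c $ i * c $ j = S $ i $ k * S $ j $ k / S $ k $ k" for i j
        using pos by (simp add: c_def)
      have sym': "S' $ i $ j = S' $ j $ i" for i j by (simp add: S'_def sym[of i j])
      have supp': "S' $ i $ j = 0" if "i \<notin> K" for i j
      proof (cases "i = k")
        case True
        then show ?thesis using pos by (simp add: S'_def cc sym[of k j])
      next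
        case False
        then show ?thesis using supp[of i] that by (simp add: S'_def cc)
      qed
      have psd': "0 \<le> a \<bullet> (S' *v a)" for a
      proof -
        define r where "r = (\<Sum>i\<in>UNIV. a $ i * S $ i $ k)"
        have q': "a \<bullet> (S' *v a) = a \<bullet> (S *v a) - r\<^sup>2 / S $ k $ k"
        proof -
          have "a \<bullet> (S' *v a) = a \<bullet> (S *v a) - (\<Sum>i\<in>UNIV. \<Sum>j\<in>UNIV. (a $ i * S $ i $ k) * (a $ j * S $ j $ k) / S $ k $ k)"
            unfolding quad by (simp add: S'_def cc sum_subtractf[symmetric] algebra_simps)
          also have "(\<Sum>i\<in>UNIV. \<Sum>j\<in>UNIV. (a $ i * S $ i $ k) * (a $ j * S $ j $ k) / S $ k $ k) = r\<^sup>2 / S $ k $ k"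
            by (simp add: r_def power2_eq_square sum_product sum_divide_distrib)
          finally show ?thesis .
        qed
        \<comment> \<open>the minimiser of the quadratic form along \<open>a + axis k z\<close>; its minimum is the Schur complement\<close>
        define z where "z = - r / S $ k $ k"
        have "0 \<le> (a + axis k z) \<bullet> (S *v (a + axis k z))" by (rule psd)
        also have "\<dots> = a \<bullet> (S *v a) + 2 * z * r + z\<^sup>2 * S $ k $ k"
        proof -
          have m: "S *v axis k z = (\<chi> m. S $ m $ k * z)"
            by (simp add: matrix_vector_mult_def axis_def vec_eq_iff if_distrib if_distribR sum.delta cong: if_cong)
          have 1: "a \<bullet> (S *v axis k z) = z * r"
            by (simp add: m inner_vec_def r_def sum_distrib_left mult_ac)
          have 2: "axis k z \<bullet> (S *v a) = z * r"
            by (simp add: inner_axis' matrix_vector_mult_def r_def sym[of k] mult_ac)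
          show ?thesis
            by (simp add: matrix_vector_right_distrib inner_add_left inner_add_right 1 2)
               (simp add: m inner_axis' power2_eq_square)
        qed
        also have "\<dots> = a \<bullet> (S' *v a)" using pos
          by (simp add: q' z_def power2_eq_square field_simps)
        finally show ?thesis .
      qed
      obtain l :: "'n \<Rightarrow> real^'n" where l: "\<forall>m. m \<notin> K \<longrightarrow> l m = 0"
          "\<forall>i j. S' $ i $ j = (\<Sum>k\<in>UNIV. l k $ i * l k $ j)"
        using insert.IH[OF sym' psd' supp'] by blast
      have lk: "l k = 0" using l(1) insert.hyps by blast
      have "S $ i $ j = (\<Sum>m\<in>UNIV. (l(k := c)) m $ i * (l(k := c)) m $ j)" for i j
      proof -
        have "(\<Sum>m\<in>UNIV. (l(k := c)) m $ i * (l(k := c)) m $ j)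
            = c $ i * c $ j + (\<Sum>m\<in>UNIV - {k}. l m $ i * l m $ j)"
          by (subst sum.remove[of _ k]) auto
        also have "(\<Sum>m\<in>UNIV - {k}. l m $ i * l m $ j) = (\<Sum>m\<in>UNIV. l m $ i * l m $ j)"
          by (subst (2) sum.remove[of _ k]) (auto simp: lk)
        also have "\<dots> = S' $ i $ j" using l(2) by simp
        finally show ?thesis by (simp add: S'_def)
      qed
      then show ?thesis using l(1) by (intro exI[of _ "l(k := c)"]) auto
    qed
  qed
  from this[of UNIV S] show ?thesis using sym psd by auto
qed

lemma diag_symmetric: "transpose (diag d) = diag d"
  by (auto simp: diag_def transpose_def vec_eq_iff)

lemma diag_mult: "(diag d ** A) $ i $ j = d i * A $ i $ j" for A :: "real^'n::finite^'n"
proof -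
  have "(diag d ** A) $ i $ j = (\<Sum>k\<in>UNIV. if k = i then d i * A $ k $ j else 0)"
    unfolding matrix_matrix_mult_def diag_def vec_lambda_beta by (intro sum.cong) auto
  then show ?thesis by simp
qed

lemma diag_vec: "(diag d *v a) $ i = d i * a $ i" for a :: "real^'n::finite"
proof -
  have "(diag d *v a) $ i = (\<Sum>k\<in>UNIV. if k = i then d i * a $ k else 0)"
    unfolding matrix_vector_mult_def diag_def vec_lambda_beta by (intro sum.cong) auto
  then show ?thesis by simp
qed

text \<open>The matrix \<open>B + (mat 1 - Pr)\<close> is block diagonal and positive definite, hence invertible, and it commutes with the
projection \<open>Pr\<close>. Its inverse times \<open>Pr\<close> satisfies the Penrose equations, so the pseudo-inverse of the compression
inverts the block selected by \<open>Pr\<close> and is zero elsewhere.\<close>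

lemma pinv_compressed_positive_definite:
  fixes H Pr :: "real^'n::finite^'n" and I :: "'n set"
  assumes sym: "transpose H = H"
    and pd: "\<And>a. a \<noteq> 0 \<Longrightarrow> 0 < a \<bullet> (H *v a)"
    and Pr: "Pr = diag (\<lambda>i. if i \<in> I then 1 else 0)"
    and B: "B = Pr ** H ** Pr"
  shows "pinv B ** B = Pr" "pinv B ** Pr = pinv B" "transpose (pinv B) = pinv B"
proof -
  have PP: "Pr ** Pr = Pr"
  proof -
    have "(Pr ** Pr) $ i $ j = (if i \<in> I then 1 else 0) * Pr $ i $ j" for i j
      by (subst Pr) (rule diag_mult)
    then show ?thesis by (auto simp: vec_eq_iff) (auto simp: Pr diag_def)
  qed
  have PT: "transpose Pr = Pr" unfolding Pr by (rule diag_symmetric)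
  have BT: "transpose B = B"
    by (simp add: B matrix_transpose_mul PT sym matrix_mul_assoc)
  have PB: "Pr ** B = B" by (simp add: B PP matrix_mul_assoc)
  have BP: "B ** Pr = B" by (simp add: B PP matrix_mul_assoc[symmetric])
  define Q where "Q = B + (mat 1 - Pr)"
  have Pv: "(Pr *v a) \<bullet> c = a \<bullet> (Pr *v c)" for a c
    using PT by (metis dot_lmul_matrix transpose_matrix_vector)
  have "a = 0" if "Q *v a = 0" for a
  proof -
    have "0 = a \<bullet> (Q *v a)" using that by simp
    also have "\<dots> = a \<bullet> (Pr *v (H *v (Pr *v a))) + (a \<bullet> a - a \<bullet> (Pr *v a))"
      by (simp add: Q_def B matrix_vector_mult_add_rdistrib matrix_vector_mult_diff_rdistrib
            inner_add_right inner_diff_right matrix_vector_mul_assoc matrix_mul_assoc)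
    also have "\<dots> = (Pr *v a) \<bullet> (H *v (Pr *v a)) + (a - Pr *v a) \<bullet> (a - Pr *v a)"
    proof -
      have "(Pr *v a) \<bullet> (Pr *v a) = a \<bullet> (Pr *v a)"
        by (simp add: Pv matrix_vector_mul_assoc PP)
      then show ?thesis by (simp add: Pv inner_diff_left inner_diff_right inner_commute)
    qed
    finally have z: "(Pr *v a) \<bullet> (H *v (Pr *v a)) + (a - Pr *v a) \<bullet> (a - Pr *v a) = 0" by simp
    then have "Pr *v a = 0"
      using pd[of "Pr *v a"] inner_ge_zero[of "a - Pr *v a"] by fastforce
    then show "a = 0" using z by simp
  qed
  then obtain Qi where Qi: "Qi ** Q = mat 1"
    using matrix_left_invertible_ker[of Q] by metis
  then have Qi': "Q ** Qi = mat 1" using matrix_left_right_inverse by blast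
  have mmd: "Z ** (X - Y) = Z ** X - Z ** Y" "(X - Y) ** Z = X ** Z - Y ** Z"
     for X Y Z :: "real^'n^'n"
    by (simp_all add: matrix_matrix_mult_def vec_eq_iff sum_subtractf algebra_simps)
  have mad: "(X + Y) ** Z = X ** Z + Y ** Z" for X Y Z :: "real^'n^'n"
    by (simp add: matrix_matrix_mult_def vec_eq_iff sum.distrib algebra_simps)
  have PQ: "Pr ** Q = B" "Q ** Pr = B"
    by (simp_all add: Q_def matrix_add_ldistrib mad mmd PP PB BP)
  have com: "Qi ** Pr = Pr ** Qi"
  proof -
    have "Qi ** Pr = Qi ** (Pr ** Q) ** Qi"
      by (simp add: Qi' matrix_mul_assoc[symmetric])
    also have "\<dots> = Qi ** (Q ** Pr) ** Qi" by (simp add: PQ)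
    also have "\<dots> = Pr ** Qi" by (simp add: Qi matrix_mul_assoc)
    finally show ?thesis .
  qed
  define X where "X = Qi ** Pr"
  have XB: "X ** B = Pr"
    by (metis PP PQ(2) Qi X_def com matrix_mul_assoc matrix_mul_lid PB)
  have BX: "B ** X = Pr"
    by (metis PP PQ(1) Qi' X_def BP com matrix_mul_assoc matrix_mul_rid)
  have XP: "X ** Pr = X" by (simp add: X_def PP matrix_mul_assoc[symmetric])
  have PX: "Pr ** X = X" by (simp add: X_def com PP matrix_mul_assoc)
  have pX: "is_pinv B X"
    by (simp add: is_pinv_def XB BX PB PX PT)
  then have pinvX: "pinv B = X"
    unfolding pinv_def by (intro the_equality) (auto intro: is_pinv_unique)
  have "is_pinv B (transpose X)"
    unfolding is_pinv_def using XB BX XP PX PT BT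
    by (metis PB matrix_transpose_mul transpose_transpose)
  then have "transpose X = X" using pX by (rule is_pinv_unique)
  then show "pinv B ** B = Pr" "pinv B ** Pr = pinv B" "transpose (pinv B) = pinv B"
    using XB XP by (simp_all add: pinvX)
qed

section \<open>Gaussian laws on Euclidean space\<close>

lemma std_normal_moments:
  "integrable std_normal_distribution (\<lambda>z. z)" "(\<integral>z. z \<partial>std_normal_distribution) = 0"
  "integrable std_normal_distribution (\<lambda>z. z\<^sup>2)" "(\<integral>z. z\<^sup>2 \<partial>std_normal_distribution) = 1"
proof -
  note 1 = integrable_std_normal_distribution_moment[of 1] integral_std_normal_distribution_moment_odd[of 1]
  note 2 = integrable_std_normal_distribution_moment[of 2] std_normal_distribution_even_moments(1)[of 1]
  show "integrable std_normal_distribution (\<lambda>z. z)" using 1(1) unfolding power_one_right .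
  show "(\<integral>z. z \<partial>std_normal_distribution) = 0" using 1(2)[OF odd_one] unfolding power_one_right .
  show "integrable std_normal_distribution (\<lambda>z. z\<^sup>2)" by (rule 2(1))
  have "fact (2 * 1) / (2 ^ 1 * fact 1) = (1::real)" by (simp add: fact_numeral)
  then show "(\<integral>z. z\<^sup>2 \<partial>std_normal_distribution) = 1" using 2(2) unfolding mult_1_right by simp
qed

lemma real_distribution_normal_law: "real_distribution (normal_law m v)"
  unfolding normal_law_def
  by (intro prob_space.real_distribution_distr) (auto simp: prob_space_normal_density)

lemma char_normal_law:
  assumes "0 \<le> v"
  shows "char (normal_law 0 v) t = complex_of_real (exp (- (v * t\<^sup>2 / 2)))"
proof -
  have "char (normal_law 0 v) t = (CLINT z|std_normal_distribution. iexp (t * (sqrt v * z)))"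
    unfolding char_def normal_law_def by (subst integral_distr) auto
  also have "\<dots> = char std_normal_distribution (t * sqrt v)"
    by (simp add: char_def mult.assoc)
  also have "\<dots> = complex_of_real (exp (- ((t * sqrt v)\<^sup>2 / 2)))"
    by (simp add: char_std_normal_distribution)
  also have "(t * sqrt v)\<^sup>2 = v * t\<^sup>2" using assms by (simp add: power_mult_distrib)
  finally show ?thesis .
qed

lemma normal_law_moments:
  assumes "0 \<le> v"
  shows "integrable (normal_law 0 v) (\<lambda>z. z)" "(\<integral>z. z \<partial>normal_law 0 v) = 0"
    "integrable (normal_law 0 v) (\<lambda>z. z\<^sup>2)" "(\<integral>z. z\<^sup>2 \<partial>normal_law 0 v) = v"
proof -
  define D where "D = std_normal_distribution"
  have m: "(\<lambda>z. sqrt v * z) \<in> measurable D borel" unfolding D_def by measurable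
  have L: "normal_law 0 v = distr D borel (\<lambda>z. sqrt v * z)" by (simp add: normal_law_def D_def)
  note D = std_normal_moments[folded D_def]
  have sq: "(sqrt v * z)\<^sup>2 = v * z\<^sup>2" for z
    using assms by (simp add: power_mult_distrib)
  have id: "(\<lambda>z::real. z) \<in> borel_measurable borel" and id2: "(\<lambda>z::real. z\<^sup>2) \<in> borel_measurable borel"
    by measurable
  show "integrable (normal_law 0 v) (\<lambda>z. z)"
    unfolding L integrable_distr_eq[OF m id] by (rule integrable_mult_right[OF D(1)])
  show "integrable (normal_law 0 v) (\<lambda>z. z\<^sup>2)"
    unfolding L integrable_distr_eq[OF m id2] sq by (rule integrable_mult_right[OF D(3)])
  show "(\<integral>z. z \<partial>normal_law 0 v) = 0" "(\<integral>z. z\<^sup>2 \<partial>normal_law 0 v) = v"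
    unfolding L integral_distr[OF m id] integral_distr[OF m id2] sq integral_mult_right_zero D
    by (rule mult_zero_right mult_1_right)+
qed

text \<open>The law is the image of a product of standard normals under the factor \<open>l\<close>. Its projections are identified by
characteristic functions, and the mean and covariance are read off from the projections by polarisation.\<close>

lemma multivariate_normal_exists:
  fixes S :: "real^'n::finite^'n" and l :: "'n \<Rightarrow> real^'n"
  assumes l: "\<And>i j. S $ i $ j = (\<Sum>k\<in>UNIV. l k $ i * l k $ j)"
  shows "\<exists>N. multivariate_normal N 0 S \<and>
           (\<forall>a. 0 \<le> a \<bullet> (S *v a) \<and> distr N borel (\<lambda>x. a \<bullet> x) = normal_law 0 (a \<bullet> (S *v a)))"
proof -
  define D where "D = std_normal_distribution"
  interpret D: real_distribution D unfolding D_def by (rule real_dist_normal_dist)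
  interpret G: product_prob_space "\<lambda>_::'n. D" UNIV
    by unfold_locales
  define G where "G = (\<Pi>\<^sub>M k\<in>(UNIV::'n set). D)"
  have G: "prob_space G" unfolding G_def by (rule G.P.prob_space_axioms)
  have coord [measurable]: "(\<lambda>z. z k) \<in> borel_measurable G" for k
    using measurable_component_singleton[of k UNIV "\<lambda>_. D"]
    by (simp add: G_def)
  define Z where "Z z = (\<Sum>k\<in>UNIV. z k *\<^sub>R l k)" for z :: "'n \<Rightarrow> real"
  have Z [measurable]: "Z \<in> borel_measurable G" unfolding Z_def by measurable
  define N where "N = distr G borel Z"
  interpret N: prob_space N unfolding N_def by (rule prob_space.prob_space_distr[OF G Z])
  have quad: "a \<bullet> (S *v a) = (\<Sum>k\<in>UNIV. (a \<bullet> l k)\<^sup>2)" for a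
  proof -
    have "a \<bullet> (S *v a) = (\<Sum>i\<in>UNIV. \<Sum>j\<in>UNIV. \<Sum>k\<in>UNIV. (a $ i * l k $ i) * (a $ j * l k $ j))"
      by (simp add: inner_vec_def matrix_vector_mult_def l sum_distrib_left sum_distrib_right mult_ac)
    also have "\<dots> = (\<Sum>i\<in>UNIV. \<Sum>k\<in>UNIV. \<Sum>j\<in>UNIV. (a $ i * l k $ i) * (a $ j * l k $ j))"
      by (intro sum.cong refl sum.swap)
    also have "\<dots> = (\<Sum>k\<in>UNIV. \<Sum>i\<in>UNIV. \<Sum>j\<in>UNIV. (a $ i * l k $ i) * (a $ j * l k $ j))"
      by (rule sum.swap)
    also have "\<dots> = (\<Sum>k\<in>UNIV. (a \<bullet> l k)\<^sup>2)"
      by (simp add: inner_vec_def power2_eq_square sum_product)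
    finally show ?thesis .
  qed
  then have nn: "0 \<le> a \<bullet> (S *v a)" for a by (simp add: sum_nonneg)
  have N_sets [measurable_cong, simp]: "sets N = sets borel" by (simp add: N_def)
  have law: "distr N borel (\<lambda>x. a \<bullet> x) = normal_law 0 (a \<bullet> (S *v a))" for a
  proof (rule Levy_uniqueness)
    show "real_distribution (distr N borel ((\<bullet>) a))"
      by (rule N.real_distribution_distr) measurable
    show "real_distribution (normal_law 0 (a \<bullet> (S *v a)))" by (rule real_distribution_normal_law)
    show "char (distr N borel ((\<bullet>) a)) = char (normal_law 0 (a \<bullet> (S *v a)))"
    proof
      fix t
      have "char (distr N borel ((\<bullet>) a)) t = (CLINT x|N. iexp (t * (a \<bullet> x)))"
        unfolding char_def by (subst integral_distr) auto
      also have "\<dots> = (CLINT z|G. iexp (t * (a \<bullet> Z z)))"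
        unfolding N_def by (subst integral_distr) auto
      also have "\<dots> = (CLINT z|G. \<Prod>k\<in>UNIV. iexp ((t * (a \<bullet> l k)) * z k))"
        by (simp add: Z_def inner_sum_right sum_distrib_left mult_ac exp_sum)
      also have "\<dots> = (\<Prod>k\<in>UNIV. char D (t * (a \<bullet> l k)))"
        unfolding G_def char_def
        by (rule G.product_integral_prod) (auto intro!: D.integrable_iexp)
      also have "\<dots> = complex_of_real (\<Prod>k\<in>UNIV. exp (- (t * (a \<bullet> l k))\<^sup>2 / 2))"
        by (simp add: D_def char_std_normal_distribution)
      also have "(\<Prod>k\<in>UNIV. exp (- (t * (a \<bullet> l k))\<^sup>2 / 2)) = exp (- ((a \<bullet> (S *v a)) * t\<^sup>2 / 2))"
      proof -
        have "(\<Sum>k\<in>UNIV. - (t * (a \<bullet> l k))\<^sup>2 / 2) = - (\<Sum>k\<in>UNIV. (a \<bullet> l k)\<^sup>2) * (t\<^sup>2 / 2)"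
          unfolding sum_distrib_right sum_negf[symmetric]
          by (intro sum.cong) (simp_all add: power_mult_distrib)
        then show ?thesis by (simp add: exp_sum[symmetric] quad)
      qed
      also have "\<dots> = char (normal_law 0 (a \<bullet> (S *v a))) t" by (simp add: char_normal_law nn)
      finally show "char (distr N borel ((\<bullet>) a)) t = char (normal_law 0 (a \<bullet> (S *v a))) t" .
    qed
  qed
  have m1: "(\<integral>x. a \<bullet> x \<partial>N) = 0" for a
  proof -
    have "(\<integral>x. a \<bullet> x \<partial>N) = (\<integral>z. z \<partial>distr N borel (\<lambda>x. a \<bullet> x))"
      by (subst integral_distr) auto
    then show ?thesis by (simp add: law normal_law_moments nn)
  qed
  have m2: "integrable N (\<lambda>x. (a \<bullet> x)\<^sup>2)" "(\<integral>x. (a \<bullet> x)\<^sup>2 \<partial>N) = a \<bullet> (S *v a)" for a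
  proof -
    have "integrable (distr N borel (\<lambda>x. a \<bullet> x)) (\<lambda>z. z\<^sup>2)"
      by (simp add: law normal_law_moments nn)
    then show "integrable N (\<lambda>x. (a \<bullet> x)\<^sup>2)" by (subst (asm) integrable_distr_eq) auto
    have "(\<integral>x. (a \<bullet> x)\<^sup>2 \<partial>N) = (\<integral>z. z\<^sup>2 \<partial>distr N borel (\<lambda>x. a \<bullet> x))"
      by (subst integral_distr) auto
    then show "(\<integral>x. (a \<bullet> x)\<^sup>2 \<partial>N) = a \<bullet> (S *v a)" by (simp add: law normal_law_moments nn)
  qed
  have cov: "(\<integral>x. x $ i * x $ j \<partial>N) = S $ i $ j" for i j
  proof -
    have ax: "axis i 1 \<bullet> x = x $ i" for x :: "real^'n" and i by (simp add: inner_axis')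
    have Sax: "(S *v axis i 1) $ j = S $ j $ i" for i j by (simp add: matrix_vector_mult_basis column_def)
    have Ssym: "S $ i $ j = S $ j $ i" for i j by (simp add: l mult.commute)
    have "(\<lambda>x::real^'n. x $ i * x $ j) =
        (\<lambda>x. (((axis i 1 + axis j 1) \<bullet> x)\<^sup>2 - (axis i 1 \<bullet> x)\<^sup>2 - (axis j 1 \<bullet> x)\<^sup>2) / 2)"
      by (simp add: inner_add_left ax power2_eq_square algebra_simps)
    then have "(\<integral>x. x $ i * x $ j \<partial>N) =
        ((axis i 1 + axis j 1) \<bullet> (S *v (axis i 1 + axis j 1)) - axis i 1 \<bullet> (S *v axis i 1)
          - axis j 1 \<bullet> (S *v axis j 1)) / 2"
      by (simp add: m2 del: inner_add_left)
    also have "\<dots> = S $ i $ j"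
      by (simp add: inner_add_left matrix_vector_right_distrib inner_add_right ax Sax Ssym[of j i])
    finally show ?thesis .
  qed
  have mean: "(\<integral>x. x $ i \<partial>N) = 0" for i
    using m1[of "axis i 1"] by (simp add: inner_axis')
  have "multivariate_normal N 0 S"
    unfolding multivariate_normal_def using law nn mean cov N.prob_space_axioms by auto
  then show ?thesis using law nn by blast
qed

section \<open>Convergence and boundedness in probability\<close>

text \<open>The good event is an arbitrary measurable subset of the set where the property holds, so that the property itself
may be non-measurable: the observed pacing vectors are not assumed to be measurable.\<close>

definition likely :: "'w measure \<Rightarrow> real \<Rightarrow> (nat \<Rightarrow> 'w \<Rightarrow> bool) \<Rightarrow> bool" where
  "likely P \<eta> E \<longleftrightarrow>
     (\<forall>\<^sub>F t in sequentially. \<exists>A\<in>sets P. 1 - \<eta> \<le> measure P A \<and> (\<forall>\<omega>\<in>A. E t \<omega>))"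

text \<open>This is \<open>o\<^sub>P(1)\<close>.\<close>

definition vanishing :: "'w measure \<Rightarrow> (nat \<Rightarrow> 'w \<Rightarrow> 'b::real_normed_vector) \<Rightarrow> bool" where
  "vanishing P Z \<longleftrightarrow> (\<forall>\<epsilon>>0. \<forall>\<eta>>0. likely P \<eta> (\<lambda>t \<omega>. norm (Z t \<omega>) \<le> \<epsilon>))"

text \<open>This is \<open>O\<^sub>P(1)\<close>, also known as tightness.\<close>

definition stochastically_bounded :: "'w measure \<Rightarrow> (nat \<Rightarrow> 'w \<Rightarrow> 'b::real_normed_vector) \<Rightarrow> bool" where
  "stochastically_bounded P Z \<longleftrightarrow> (\<forall>\<eta>>0. \<exists>K. likely P \<eta> (\<lambda>t \<omega>. norm (Z t \<omega>) \<le> K))"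

text \<open>With high probability: the inner probability of the property tends to one.\<close>

definition whp :: "'w measure \<Rightarrow> (nat \<Rightarrow> 'w \<Rightarrow> bool) \<Rightarrow> bool" where
  "whp P E \<longleftrightarrow> (\<forall>\<eta>>0. likely P \<eta> E)"

lemma likely_mono:
  assumes "likely P \<eta> E" and "\<forall>\<^sub>F t in sequentially. \<forall>\<omega>. E t \<omega> \<longrightarrow> F t \<omega>"
  shows "likely P \<eta> F"
  using assms unfolding likely_def by eventually_elim blast

lemma (in prob_space) likely_conj:
  assumes "likely M \<eta> E" "likely M \<theta> F" "\<eta> + \<theta> \<le> \<zeta>"
  shows "likely M \<zeta> (\<lambda>t \<omega>. E t \<omega> \<and> F t \<omega>)"
  using assms(1,2) unfolding likely_def
proof eventually_elim
  case (elim t)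
  then obtain A B where AB: "A \<in> events" "1 - \<eta> \<le> prob A" "\<forall>\<omega>\<in>A. E t \<omega>"
      "B \<in> events" "1 - \<theta> \<le> prob B" "\<forall>\<omega>\<in>B. F t \<omega>" by blast
  have "prob A + prob B = prob (A \<union> B) + prob (A \<inter> B)"
    using AB by (simp add: measure_Un3 fmeasurable_eq_sets)
  also have "prob (A \<union> B) \<le> 1" by simp
  finally show ?case using AB assms(3) by (intro bexI[of _ "A \<inter> B"]) auto
qed

lemma whp_mono:
  assumes "whp P E" and "\<And>t \<omega>. E t \<omega> \<Longrightarrow> F t \<omega>"
  shows "whp P F"
  using assms unfolding whp_def by (blast intro: likely_mono always_eventually)

lemma (in prob_space) whp_conj:
  assumes "whp M E" "whp M F"
  shows "whp M (\<lambda>t \<omega>. E t \<omega> \<and> F t \<omega>)"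
  unfolding whp_def
proof (intro allI impI)
  fix \<eta> :: real assume "0 < \<eta>"
  then show "likely M \<eta> (\<lambda>t \<omega>. E t \<omega> \<and> F t \<omega>)"
    using assms unfolding whp_def by (intro likely_conj[of "\<eta>/2" _ "\<eta>/2"]) auto
qed

lemma (in prob_space) whp_AE:
  assumes "\<And>t. 0 < t \<Longrightarrow> AE \<omega> in M. E t \<omega>"
  shows "whp M E"
  unfolding whp_def likely_def
proof (intro allI impI)
  fix \<eta> :: real assume \<eta>: "0 < \<eta>"
  show "\<forall>\<^sub>F t in sequentially. \<exists>A\<in>events. 1 - \<eta> \<le> prob A \<and> (\<forall>\<omega>\<in>A. E t \<omega>)"
    using eventually_gt_at_top[of 0]
  proof eventually_elim
    case (elim t)
    from assms[OF elim] obtain N where N: "N \<in> null_sets M" "{\<omega> \<in> space M. \<not> E t \<omega>} \<subseteq> N"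
      by (auto simp: eventually_ae_filter)
    then have "N \<in> events" "prob N = 0" by (auto simp: null_sets_def measure_def)
    then have "prob (space M - N) = 1" "space M - N \<in> events" by (auto simp: prob_compl)
    then show ?case using N \<eta> by (intro bexI[of _ "space M - N"]) auto
  qed
qed

lemma (in prob_space) whp_ball_finite:
  assumes "finite I" "\<And>i. i \<in> I \<Longrightarrow> whp M (E i)"
  shows "whp M (\<lambda>t \<omega>. \<forall>i\<in>I. E i t \<omega>)"
  using assms
proof (induction rule: finite_induct)
  case empty
  show ?case by (rule whp_AE) simp
next
  case (insert i I)
  then show ?case using whp_conj[of "E i" "\<lambda>t \<omega>. \<forall>i\<in>I. E i t \<omega>"] by simp
qed

lemma vanishing_iff_whp: "vanishing P Z \<longleftrightarrow> (\<forall>\<epsilon>>0. whp P (\<lambda>t \<omega>. norm (Z t \<omega>) \<le> \<epsilon>))"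
  by (auto simp: vanishing_def whp_def)

lemma (in prob_space) vanishing_dominated:
  assumes Z: "vanishing M Z" and le: "whp M (\<lambda>t \<omega>. norm (Y t \<omega>) \<le> C * norm (Z t \<omega>))"
  shows "vanishing M Y"
  unfolding vanishing_iff_whp
proof (intro allI impI)
  fix \<epsilon> :: real assume \<epsilon>: "0 < \<epsilon>"
  define \<delta> where "\<delta> = \<epsilon> / (\<bar>C\<bar> + 1)"
  have \<delta>: "0 < \<delta>" using \<epsilon> by (simp add: \<delta>_def)
  have C\<delta>: "\<bar>C\<bar> * \<delta> \<le> \<epsilon>" using \<epsilon> by (simp add: \<delta>_def field_simps)
  have "whp M (\<lambda>t \<omega>. norm (Y t \<omega>) \<le> C * norm (Z t \<omega>) \<and> norm (Z t \<omega>) \<le> \<delta>)"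
    using Z \<delta> le unfolding vanishing_iff_whp by (intro whp_conj) auto
  then show "whp M (\<lambda>t \<omega>. norm (Y t \<omega>) \<le> \<epsilon>)"
  proof (rule whp_mono)
    fix t \<omega> assume *: "norm (Y t \<omega>) \<le> C * norm (Z t \<omega>) \<and> norm (Z t \<omega>) \<le> \<delta>"
    have "C * norm (Z t \<omega>) \<le> \<bar>C\<bar> * norm (Z t \<omega>)" by (intro mult_right_mono) auto
    also have "\<dots> \<le> \<bar>C\<bar> * \<delta>" using * by (intro mult_left_mono) auto
    finally show "norm (Y t \<omega>) \<le> \<epsilon>" using * C\<delta> by linarith
  qed
qed

lemma (in prob_space) vanishing_cong:
  assumes "vanishing M Z" "whp M (\<lambda>t \<omega>. Y t \<omega> = Z t \<omega>)"
  shows "vanishing M Y"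
  by (rule vanishing_dominated[OF assms(1), of _ 1]) (rule whp_mono[OF assms(2)], simp)

lemma (in prob_space) vanishing_add:
  assumes "vanishing M Y" "vanishing M Z"
  shows "vanishing M (\<lambda>t \<omega>. Y t \<omega> + Z t \<omega>)"
  unfolding vanishing_iff_whp
proof (intro allI impI)
  fix \<epsilon> :: real assume \<epsilon>: "0 < \<epsilon>"
  then have "whp M (\<lambda>t \<omega>. norm (Y t \<omega>) \<le> \<epsilon> / 2 \<and> norm (Z t \<omega>) \<le> \<epsilon> / 2)"
    using assms[unfolded vanishing_iff_whp, rule_format, of "\<epsilon> / 2"] by (intro whp_conj) simp_all
  then show "whp M (\<lambda>t \<omega>. norm (Y t \<omega> + Z t \<omega>) \<le> \<epsilon>)"
    by (rule whp_mono) (auto intro!: norm_triangle_le)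
qed

lemma (in prob_space) vanishing_minus:
  assumes "vanishing M Z" shows "vanishing M (\<lambda>t \<omega>. - Z t \<omega>)"
  using assms unfolding vanishing_def by simp

lemma (in prob_space) vanishing_diff:
  assumes "vanishing M Y" "vanishing M Z"
  shows "vanishing M (\<lambda>t \<omega>. Y t \<omega> - Z t \<omega>)"
  using vanishing_add[OF assms(1) vanishing_minus[OF assms(2)]] by simp

lemma (in prob_space) vanishing_bounded_linear:
  assumes L: "bounded_linear L" and "vanishing M Z"
  shows "vanishing M (\<lambda>t \<omega>. L (Z t \<omega>))"
proof -
  obtain K where "\<And>z. norm (L z) \<le> norm z * K" using bounded_linear.bounded[OF L] by blast
  then show ?thesis
    by (intro vanishing_dominated[OF assms(2), of _ K] whp_AE) (simp add: mult.commute)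
qed

lemma (in prob_space) vanishing_componentwise:
  fixes Z :: "nat \<Rightarrow> 'a \<Rightarrow> real^'n::finite"
  assumes "\<And>i. vanishing M (\<lambda>t \<omega>. Z t \<omega> $ i)"
  shows "vanishing M Z"
  unfolding vanishing_iff_whp
proof (intro allI impI)
  fix \<epsilon> :: real assume \<epsilon>: "0 < \<epsilon>"
  have "whp M (\<lambda>t \<omega>. \<forall>i\<in>UNIV. norm (Z t \<omega> $ i) \<le> \<epsilon> / CARD('n))"
    using assms \<epsilon> unfolding vanishing_iff_whp by (intro whp_ball_finite) auto
  then show "whp M (\<lambda>t \<omega>. norm (Z t \<omega>) \<le> \<epsilon>)"
  proof (rule whp_mono)
    fix t \<omega> assume "\<forall>i\<in>UNIV. norm (Z t \<omega> $ i) \<le> \<epsilon> / CARD('n)"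
    then have "(\<Sum>i\<in>UNIV. \<bar>Z t \<omega> $ i\<bar>) \<le> (\<Sum>i\<in>(UNIV::'n set). \<epsilon> / CARD('n))"
      by (intro sum_mono) auto
    then show "norm (Z t \<omega>) \<le> \<epsilon>" using norm_le_l1_cart[of "Z t \<omega>"] by simp
  qed
qed

lemma (in prob_space) stochastically_bounded_dominated:
  assumes Z: "stochastically_bounded M Z" and le: "whp M (\<lambda>t \<omega>. norm (Y t \<omega>) \<le> C * norm (Z t \<omega>))"
  shows "stochastically_bounded M Y"
  unfolding stochastically_bounded_def
proof (intro allI impI)
  fix \<eta> :: real assume \<eta>: "0 < \<eta>"
  obtain K where K: "likely M (\<eta>/2) (\<lambda>t \<omega>. norm (Z t \<omega>) \<le> K)"
    using Z \<eta> unfolding stochastically_bounded_def by (meson half_gt_zero)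
  have "likely M \<eta> (\<lambda>t \<omega>. norm (Y t \<omega>) \<le> C * norm (Z t \<omega>) \<and> norm (Z t \<omega>) \<le> K)"
    using K le \<eta> unfolding whp_def by (intro likely_conj[of "\<eta>/2" _ "\<eta>/2"]) auto
  then have "likely M \<eta> (\<lambda>t \<omega>. norm (Y t \<omega>) \<le> \<bar>C\<bar> * K)"
  proof (rule likely_mono, intro always_eventually allI impI)
    fix t \<omega> assume *: "norm (Y t \<omega>) \<le> C * norm (Z t \<omega>) \<and> norm (Z t \<omega>) \<le> K"
    have "C * norm (Z t \<omega>) \<le> \<bar>C\<bar> * norm (Z t \<omega>)" by (intro mult_right_mono) auto
    also have "\<dots> \<le> \<bar>C\<bar> * K" using * by (intro mult_left_mono) auto
    finally show "norm (Y t \<omega>) \<le> \<bar>C\<bar> * K" using * by linarith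
  qed
  then show "\<exists>K. likely M \<eta> (\<lambda>t \<omega>. norm (Y t \<omega>) \<le> K)" by blast
qed

text \<open>Any error bounded by a null sequence times a function of a tight quantity vanishes. This disposes of all
second-order Taylor errors, which are of size \<open>(1 / sqrt t) * norm (h)\<^sup>2\<close>.\<close>

lemma (in prob_space) vanishing_of_rate:
  assumes Z: "stochastically_bounded M Z"
    and c: "c \<longlonglongrightarrow> 0" "\<And>t. 0 \<le> c t" and mono: "\<And>K. 0 \<le> g K" "mono_on {0..} g"
    and le: "whp M (\<lambda>t \<omega>. norm (Y t \<omega>) \<le> c t * g (norm (Z t \<omega>)))"
  shows "vanishing M Y"
  unfolding vanishing_def
proof (intro allI impI)
  fix \<epsilon> \<eta> :: real assume e: "0 < \<epsilon>" and \<eta>: "0 < \<eta>"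
  obtain K where K: "likely M (\<eta>/2) (\<lambda>t \<omega>. norm (Z t \<omega>) \<le> K)"
    using Z \<eta> unfolding stochastically_bounded_def by (meson half_gt_zero)
  have "(\<lambda>t. c t * g (max 0 K)) \<longlonglongrightarrow> 0" using c(1) by (auto intro: tendsto_eq_intros)
  then have ev: "\<forall>\<^sub>F t in sequentially. c t * g (max 0 K) < \<epsilon>" using e by (rule order_tendstoD)
  have "likely M \<eta> (\<lambda>t \<omega>. norm (Z t \<omega>) \<le> K \<and> norm (Y t \<omega>) \<le> c t * g (norm (Z t \<omega>)))"
    using K le \<eta> unfolding whp_def by (intro likely_conj[of "\<eta>/2" _ "\<eta>/2"]) auto
  then show "likely M \<eta> (\<lambda>t \<omega>. norm (Y t \<omega>) \<le> \<epsilon>)"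
  proof (rule likely_mono)
    show "\<forall>\<^sub>F t in sequentially. \<forall>\<omega>. norm (Z t \<omega>) \<le> K \<and> norm (Y t \<omega>) \<le> c t * g (norm (Z t \<omega>)) \<longrightarrow> norm (Y t \<omega>) \<le> \<epsilon>"
      using ev
    proof eventually_elim
      case (elim t)
      show ?case
      proof (intro allI impI)
        fix \<omega> assume *: "norm (Z t \<omega>) \<le> K \<and> norm (Y t \<omega>) \<le> c t * g (norm (Z t \<omega>))"
        have "g (norm (Z t \<omega>)) \<le> g (max 0 K)" using * by (intro mono_onD[OF mono(2)]) auto
        then have "c t * g (norm (Z t \<omega>)) \<le> c t * g (max 0 K)" using c(2) by (intro mult_left_mono)
        then show "norm (Y t \<omega>) \<le> \<epsilon>" using * elim by linarith
      qed
    qed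
  qed
qed

lemma inverse_sqrt_tendsto: "(\<lambda>t. 1 / sqrt (real t)) \<longlonglongrightarrow> 0"
  by (intro tendsto_divide_0[OF tendsto_const] filterlim_at_top_imp_at_infinity
        filterlim_compose[OF sqrt_at_top filterlim_real_sequentially])

lemma (in prob_space) stochastically_bounded_add:
  assumes "stochastically_bounded M Y" "stochastically_bounded M Z"
  shows "stochastically_bounded M (\<lambda>t \<omega>. Y t \<omega> + Z t \<omega>)"
  unfolding stochastically_bounded_def
proof (intro allI impI)
  fix \<eta> :: real assume \<eta>: "0 < \<eta>"
  obtain K L where KL: "likely M (\<eta>/2) (\<lambda>t \<omega>. norm (Y t \<omega>) \<le> K)" "likely M (\<eta>/2) (\<lambda>t \<omega>. norm (Z t \<omega>) \<le> L)"
    using assms \<eta> unfolding stochastically_bounded_def by (meson half_gt_zero)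
  have "likely M \<eta> (\<lambda>t \<omega>. norm (Y t \<omega>) \<le> K \<and> norm (Z t \<omega>) \<le> L)"
    using KL by (rule likely_conj) simp
  then have "likely M \<eta> (\<lambda>t \<omega>. norm (Y t \<omega> + Z t \<omega>) \<le> K + L)"
    by (rule likely_mono) (auto intro!: always_eventually intro: norm_triangle_le add_mono)
  then show "\<exists>K. likely M \<eta> (\<lambda>t \<omega>. norm (Y t \<omega> + Z t \<omega>) \<le> K)" by blast
qed

lemma (in prob_space) stochastically_bounded_add_vanishing:
  assumes "stochastically_bounded M Z" "vanishing M Y"
  shows "stochastically_bounded M (\<lambda>t \<omega>. Z t \<omega> + Y t \<omega>)"
proof (rule stochastically_bounded_add[OF assms(1)])
  show "stochastically_bounded M Y"
    using assms(2) zero_less_one unfolding vanishing_def stochastically_bounded_def by blast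
qed

lemma (in prob_space) stochastically_bounded_componentwise:
  fixes Z :: "nat \<Rightarrow> 'a \<Rightarrow> real^'n::finite"
  assumes "\<And>i. stochastically_bounded M (\<lambda>t \<omega>. Z t \<omega> $ i)"
  shows "stochastically_bounded M Z"
proof -
  have "stochastically_bounded M (\<lambda>t \<omega>. \<Sum>i\<in>I. axis i (Z t \<omega> $ i))" if "finite I" for I :: "'n set"
    using that
  proof (induction rule: finite_induct)
    case empty
    have "likely M \<eta> (\<lambda>t \<omega>. norm (0::real^'n) \<le> 0)" if "0 < \<eta>" for \<eta>
      using whp_AE[of "\<lambda>_ _. True"] that by (simp add: whp_def)
    then show ?case unfolding stochastically_bounded_def by (auto intro!: exI[of _ 0])
  next
    case (insert i I)
    have "stochastically_bounded M (\<lambda>t \<omega>. axis i (Z t \<omega> $ i) :: real^'n)"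
    proof (rule stochastically_bounded_dominated[OF assms[of i], of _ 1], rule whp_AE, rule AE_I2)
      fix t \<omega>
      have "axis i (Z t \<omega> $ i) = (Z t \<omega> $ i) *\<^sub>R (axis i 1 :: real^'n)"
        by (simp add: axis_def vec_eq_iff)
      then show "norm (axis i (Z t \<omega> $ i) :: real^'n) \<le> 1 * norm (Z t \<omega> $ i)"
        by (simp add: norm_axis_1)
    qed
    then show ?case using stochastically_bounded_add insert by simp
  qed
  moreover have "(\<Sum>i\<in>UNIV. axis i (z $ i)) = z" for z :: "real^'n"
    by (simp add: vec_eq_iff axis_def sum.delta)
  ultimately show ?thesis using finite[of "UNIV :: 'n set"] by fastforce
qed

section \<open>Convergence in distribution from one-dimensional projections\<close>

text \<open>These functions form an algebra by the product-to-sum formula, are linear combinations of real and imaginary parts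
of characters, and separate points. They are the test functions for the Cramer-Wold argument.\<close>

inductive_set trig_sums :: "('a::real_inner \<Rightarrow> real) set" where
  wave: "(\<lambda>x. c * cos (a \<bullet> x + d)) \<in> trig_sums"
| add: "f \<in> trig_sums \<Longrightarrow> g \<in> trig_sums \<Longrightarrow> (\<lambda>x. f x + g x) \<in> trig_sums"

lemma trig_sums_const: "(\<lambda>x. c) \<in> trig_sums"
  using trig_sums.wave[of c 0 0] by simp

lemma trig_sums_mult:
  assumes "f \<in> trig_sums" "g \<in> trig_sums"
  shows "(\<lambda>x. f x * g x) \<in> trig_sums"
  using assms(1)
proof induction
  case (wave c a d)
  from assms(2) show ?case
  proof induction
    case (wave c' a' d')
    have "(\<lambda>x. c * cos (a \<bullet> x + d) * (c' * cos (a' \<bullet> x + d'))) =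
        (\<lambda>x. c * c' / 2 * cos ((a - a') \<bullet> x + (d - d')) + c * c' / 2 * cos ((a + a') \<bullet> x + (d + d')))"
    proof
      fix x
      have "c * cos (a \<bullet> x + d) * (c' * cos (a' \<bullet> x + d')) = c * c' * (cos (a \<bullet> x + d) * cos (a' \<bullet> x + d'))"
        by simp
      also have "\<dots> = c * c' / 2 * cos ((a \<bullet> x + d) - (a' \<bullet> x + d')) + c * c' / 2 * cos ((a \<bullet> x + d) + (a' \<bullet> x + d'))"
        unfolding cos_times_cos by (simp add: field_simps)
      finally show "c * cos (a \<bullet> x + d) * (c' * cos (a' \<bullet> x + d')) =
        c * c' / 2 * cos ((a - a') \<bullet> x + (d - d')) + c * c' / 2 * cos ((a + a') \<bullet> x + (d + d'))"
        by (simp add: inner_diff_left inner_add_left algebra_simps)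
    qed
    then show ?case by (simp only: trig_sums.intros)
  next
    case (add f g)
    then show ?case using trig_sums.add by (simp add: distrib_left)
  qed
next
  case (add f g)
  then show ?case using trig_sums.add by (simp add: distrib_right)
qed

text \<open>Closure under polynomials allows a trigonometric sum to be clamped approximately.\<close>

lemma trig_sums_polynomial:
  fixes q :: "real \<Rightarrow> real"
  assumes "real_polynomial_function q" "f \<in> trig_sums"
  shows "(\<lambda>x. q (f x)) \<in> trig_sums"
  using assms(1)
proof induction
  case (linear q)
  then obtain c where "q = (\<lambda>y. y * c)" using real_bounded_linear by blast
  then show ?case using trig_sums_mult[OF assms(2) trig_sums_const] by simp
qed (auto intro: trig_sums_const trig_sums.add trig_sums_mult)

lemma trig_sums_continuous: "f \<in> trig_sums \<Longrightarrow> continuous_on S f"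
  by (induction rule: trig_sums.induct) (auto intro!: continuous_intros)

lemma trig_sums_bounded:
  assumes "f \<in> trig_sums" obtains B where "\<And>x. \<bar>f x\<bar> \<le> B"
proof -
  from assms have "\<exists>B. \<forall>x. \<bar>f x\<bar> \<le> B"
  proof induction
    case (wave c a d)
    have "\<bar>c * cos (a \<bullet> x + d)\<bar> \<le> \<bar>c\<bar>" for x
      by (simp add: abs_mult mult_left_le)
    then show ?case by blast
  next
    case (add f g)
    then obtain B C where "\<And>x. \<bar>f x\<bar> \<le> B" "\<And>x. \<bar>g x\<bar> \<le> C" by blast
    then have "\<bar>f x + g x\<bar> \<le> B + C" for x by (meson abs_triangle_ineq add_mono order_trans)
    then show ?case by blast
  qed
  then show ?thesis using that by blast
qed

text \<open>Stone-Weierstrass gives a good approximation on \<open>S\<close> but no control outside. Composing it with a polynomial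
close to the clamping function \<open>y \<mapsto> max (- B) (min B y)\<close> on the (bounded) range keeps the approximation on \<open>S\<close>
and bounds the result on the whole space, which a tightness argument needs.\<close>

lemma trig_sums_approximation:
  fixes f :: "'a::real_inner \<Rightarrow> real"
  assumes f: "continuous_on UNIV f" and B: "\<And>x. \<bar>f x\<bar> \<le> B" and S: "compact S" and e: "0 < e"
  obtains T where "T \<in> trig_sums" "\<And>x. x \<in> S \<Longrightarrow> \<bar>f x - T x\<bar> \<le> e" "\<And>x. \<bar>T x\<bar> \<le> B + e"
proof -
  interpret R: function_ring_on trig_sums S
  proof
    fix x y :: 'a assume "x \<noteq> y"
    \<comment> \<open>the wave that has phase \<open>0\<close> at \<open>y\<close> and \<open>pi\<close> at \<open>x\<close>\<close>
    define a where "a = (pi / (norm (x - y))\<^sup>2) *\<^sub>R (x - y)"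
    have "a \<bullet> (x - y) = pi" using \<open>x \<noteq> y\<close> by (simp add: a_def dot_square_norm)
    then have "a \<bullet> x + (- (a \<bullet> y)) = pi" by (simp add: inner_diff_right)
    then have "1 * cos (a \<bullet> x + (- (a \<bullet> y))) \<noteq> 1 * cos (a \<bullet> y + (- (a \<bullet> y)))" by simp
    then show "\<exists>f\<in>trig_sums. f x \<noteq> f y"
      by (intro bexI[of _ "\<lambda>x. 1 * cos (a \<bullet> x + (- (a \<bullet> y)))"])
         (assumption, rule trig_sums.wave)
  qed (use S in \<open>auto intro: trig_sums_const trig_sums.add trig_sums_mult trig_sums_continuous\<close>)
  obtain T0 where T0: "T0 \<in> trig_sums" "\<And>x. x \<in> S \<Longrightarrow> \<bar>f x - T0 x\<bar> < e / 2"
    using R.Stone_Weierstrass_basic[OF continuous_on_subset[OF f], of "e/2"] e by auto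
  obtain C where C: "\<And>x. \<bar>T0 x\<bar> \<le> C" using trig_sums_bounded[OF T0(1)] by blast
  define cl where "cl y = max (- B) (min B y)" for y :: real
  have B0: "0 \<le> B" using B[of undefined] by linarith
  have "continuous_on {- C..C} cl" unfolding cl_def by (intro continuous_intros)
  then obtain q where q: "real_polynomial_function q" "\<And>y. y \<in> {- C..C} \<Longrightarrow> \<bar>cl y - q y\<bar> < e / 2"
    using Stone_Weierstrass_real_polynomial_function[of "{- C..C}" cl "e/2"] e by auto
  have qT: "\<bar>cl (T0 x) - q (T0 x)\<bar> < e / 2" for x using q(2) C[of x] by (auto simp: abs_le_iff)
  show ?thesis
  proof
    show "(\<lambda>x. q (T0 x)) \<in> trig_sums" by (rule trig_sums_polynomial[OF q(1) T0(1)])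
    show "\<bar>f x - q (T0 x)\<bar> \<le> e" if "x \<in> S" for x
    proof -
      have "\<bar>f x - cl (T0 x)\<bar> \<le> \<bar>f x - T0 x\<bar>" using B[of x] unfolding cl_def by linarith
      then show ?thesis using T0(2)[OF that] qT[of x] by linarith
    qed
    show "\<bar>q (T0 x)\<bar> \<le> B + e" for x
    proof -
      have "\<bar>cl (T0 x)\<bar> \<le> B" using B0 unfolding cl_def by linarith
      then show ?thesis using qT[of x] e by linarith
    qed
  qed
qed

lemma (in prob_space) expectation_diff_le_on_likely_event:
  fixes Z :: "'a \<Rightarrow> 'b::real_inner"
  assumes [measurable]: "(\<lambda>\<omega>. f (Z \<omega>)) \<in> borel_measurable M" "(\<lambda>\<omega>. g (Z \<omega>)) \<in> borel_measurable M"
    and A: "A \<in> sets M" "1 - \<eta> \<le> prob A"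
    and f: "\<And>x. \<bar>f x\<bar> \<le> B" and g: "\<And>x. \<bar>g x :: real\<bar> \<le> C"
    and close: "\<And>\<omega>. \<omega> \<in> A \<Longrightarrow> \<bar>f (Z \<omega>) - g (Z \<omega>)\<bar> \<le> e" and e: "0 \<le> e"
  shows "\<bar>expectation (\<lambda>\<omega>. f (Z \<omega>)) - expectation (\<lambda>\<omega>. g (Z \<omega>))\<bar> \<le> e + (B + C) * \<eta>"
proof -
  have BC: "0 \<le> B + C" using f[of undefined] g[of undefined] by linarith
  have i: "integrable M (\<lambda>\<omega>. f (Z \<omega>))" "integrable M (\<lambda>\<omega>. g (Z \<omega>))"
    by (rule integrable_const_bound[where B = B], use f in auto)
       (rule integrable_const_bound[where B = C], use g in auto)
  have i2: "integrable M (\<lambda>\<omega>. e + (B + C) * indicator (space M - A) \<omega>)"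
    using A by (auto intro!: Bochner_Integration.integrable_add integrable_mult_right integrable_real_indicator simp: emeasure_eq_measure)
  have "\<bar>expectation (\<lambda>\<omega>. f (Z \<omega>)) - expectation (\<lambda>\<omega>. g (Z \<omega>))\<bar> = \<bar>expectation (\<lambda>\<omega>. f (Z \<omega>) - g (Z \<omega>))\<bar>"
    using i by simp
  also have "\<dots> \<le> expectation (\<lambda>\<omega>. \<bar>f (Z \<omega>) - g (Z \<omega>)\<bar>)" by (rule integral_abs_bound)
  also have "\<dots> \<le> expectation (\<lambda>\<omega>. e + (B + C) * indicator (space M - A) \<omega>)"
  proof (rule integral_mono)
    show "integrable M (\<lambda>\<omega>. \<bar>f (Z \<omega>) - g (Z \<omega>)\<bar>)" using i by auto
    fix \<omega> assume w: "\<omega> \<in> space M"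
    show "\<bar>f (Z \<omega>) - g (Z \<omega>)\<bar> \<le> e + (B + C) * indicator (space M - A) \<omega>"
    proof (cases "\<omega> \<in> A")
      case True then show ?thesis using close by simp
    next
      case False
      then show ?thesis using w f[of "Z \<omega>"] g[of "Z \<omega>"] e by simp
    qed
  qed (rule i2)
  also have "\<dots> = e + (B + C) * prob (space M - A)"
    using A by (subst Bochner_Integration.integral_add) (auto simp: emeasure_eq_measure prob_space)
  also have "\<dots> \<le> e + (B + C) * \<eta>"
    using A BC by (auto simp: prob_compl intro!: mult_left_mono)
  finally show ?thesis .
qed

lemma (in prob_space) expectation_wave:
  fixes Z :: "'a \<Rightarrow> 'b::euclidean_space"
  assumes [measurable]: "Z \<in> borel_measurable M"
  shows "expectation (\<lambda>\<omega>. c * cos (a \<bullet> Z \<omega> + d)) = c * Re (iexp d * (CLINT \<omega>|M. iexp (a \<bullet> Z \<omega>)))"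
proof -
  have i: "integrable M (\<lambda>\<omega>. iexp (a \<bullet> Z \<omega>))"
    by (intro integrable_const_bound[where B = 1]) auto
  have "c * cos (a \<bullet> x + d) = c * Re (iexp d * iexp (a \<bullet> x))" for x
    by (simp add: cis_conv_exp[symmetric] cos_add)
  then have "expectation (\<lambda>\<omega>. c * cos (a \<bullet> Z \<omega> + d)) = expectation (\<lambda>\<omega>. c * Re (iexp d * iexp (a \<bullet> Z \<omega>)))"
    by presburger
  also have "\<dots> = c * expectation (\<lambda>\<omega>. Re (iexp d * iexp (a \<bullet> Z \<omega>)))"
    by (rule integral_mult_right_zero)
  also have "expectation (\<lambda>\<omega>. Re (iexp d * iexp (a \<bullet> Z \<omega>))) = Re (CLINT \<omega>|M. iexp d * iexp (a \<bullet> Z \<omega>))"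
    by (rule integral_Re[OF integrable_mult_right[OF i]])
  also have "(CLINT \<omega>|M. iexp d * iexp (a \<bullet> Z \<omega>)) = iexp d * (CLINT \<omega>|M. iexp (a \<bullet> Z \<omega>))"
    by (rule integral_mult_right_zero)
  finally show ?thesis .
qed

lemma (in prob_space) norm_tight:
  fixes X :: "'a \<Rightarrow> 'b::euclidean_space"
  assumes [measurable]: "X \<in> borel_measurable M" and "0 < \<eta>"
  shows "\<exists>K. 1 - \<eta> \<le> prob {\<omega> \<in> space M. norm (X \<omega>) \<le> K}"
proof -
  have "(\<lambda>n. prob {\<omega> \<in> space M. norm (X \<omega>) \<le> real n}) \<longlonglongrightarrow> prob (\<Union>n. {\<omega> \<in> space M. norm (X \<omega>) \<le> real n})"
    by (intro finite_Lim_measure_incseq) (auto simp: incseq_def)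
  also have "(\<Union>n. {\<omega> \<in> space M. norm (X \<omega>) \<le> real n}) = space M"
    by (auto simp: real_arch_simple)
  finally have "\<forall>\<^sub>F n in sequentially. 1 - \<eta> < prob {\<omega> \<in> space M. norm (X \<omega>) \<le> real n}"
    using assms(2) by (intro order_tendstoD) (auto simp: prob_space)
  then show ?thesis by (auto simp: eventually_sequentially intro: less_imp_le)
qed

text \<open>Convergence of characteristic functions gives convergence of expectations of trigonometric sums. Outside a large
ball, which has small probability for both \<open>Z t\<close> and the limit by tightness, a bounded continuous function and its
approximating trigonometric sum differ by a bounded amount.\<close>

lemma (in prob_space) Cramer_Wold:
  fixes Z :: "nat \<Rightarrow> 'a \<Rightarrow> real^'n::finite"
  assumes Z [measurable]: "\<And>t. Z t \<in> borel_measurable M"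
    and N: "prob_space N" "sets N = sets borel"
    and bdd: "stochastically_bounded M Z"
    and conv: "\<And>a. (\<lambda>t. CLINT \<omega>|M. iexp (a \<bullet> Z t \<omega>)) \<longlonglongrightarrow> (CLINT x|N. iexp (a \<bullet> x))"
  shows "converges_in_distribution M Z N"
  unfolding converges_in_distribution_def
proof (intro conjI allI impI Z)
  fix f :: "real^'n \<Rightarrow> real"
  assume f: "continuous_on UNIV f" "bounded (range f)"
  interpret N: prob_space N by (rule N)
  note [measurable_cong] = N(2)
  obtain B where B: "\<And>x. \<bar>f x\<bar> \<le> B" using f(2) by (auto simp: bounded_iff)
  have B0: "0 \<le> B" using B[of undefined] by linarith
  have [measurable]: "f \<in> borel_measurable borel" using f(1) by (rule borel_measurable_continuous_onI)
  show "(\<lambda>t. \<integral>\<omega>. f (Z t \<omega>) \<partial>M) \<longlonglongrightarrow> (\<integral>x. f x \<partial>N)"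
  proof (rule LIMSEQ_I)
    fix r :: real assume r: "0 < r"
    define e where "e = min 1 (r / 16)"
    \<comment> \<open>with \<open>e\<close>, this bounds the error of one replacement by \<open>r / 8\<close>, see \<open>small\<close>\<close>
    define \<eta> where "\<eta> = r / (16 * (2 * B + 1))"
    have e: "0 < e" "e \<le> 1" "e \<le> r / 16" using r by (auto simp: e_def)
    have \<eta>: "0 < \<eta>" using r B0 by (auto simp: \<eta>_def)
    have small: "e + (B + (B + e)) * \<eta> \<le> r / 8"
    proof -
      have "(B + (B + e)) * \<eta> \<le> (2 * B + 1) * \<eta>" using e \<eta> by (intro mult_right_mono) auto
      also have "\<dots> = r / 16" using B0 by (simp add: \<eta>_def add_nonneg_eq_0_iff divide_simps)
      finally show ?thesis using e by linarith
    qed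
    obtain K where K: "likely M \<eta> (\<lambda>t \<omega>. norm (Z t \<omega>) \<le> K)"
      using bdd \<eta> unfolding stochastically_bounded_def by blast
    obtain K' where K': "1 - \<eta> \<le> N.prob {x \<in> space N. norm x \<le> K'}"
      using N.norm_tight[of "\<lambda>x. x" \<eta>] \<eta> by auto
    have spN: "space N = UNIV" using sets_eq_imp_space_eq[OF N(2)] by simp
    obtain T where T: "T \<in> trig_sums" "\<And>x. x \<in> cball 0 (max K K') \<Longrightarrow> \<bar>f x - T x\<bar> \<le> e"
        "\<And>x. \<bar>T x\<bar> \<le> B + e"
      using trig_sums_approximation[OF f(1) B compact_cball e(1)] by blast
    have Tm [measurable]: "T \<in> borel_measurable borel"
      using trig_sums_continuous[OF T(1)] by (rule borel_measurable_continuous_onI)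
    have "(\<lambda>t. expectation (\<lambda>\<omega>. T (Z t \<omega>))) \<longlonglongrightarrow> N.expectation T"
      using T(1)
    proof induction
      case (wave c a d)
      have id: "(\<lambda>x. x) \<in> borel_measurable N" by measurable
      show ?case
        unfolding expectation_wave[OF Z] N.expectation_wave[OF id]
        by (intro tendsto_intros conv)
    next
      case (add g h)
      have i: "integrable Q (\<lambda>x. g (Y x))" 
        if g: "g \<in> trig_sums" and Y: "Y \<in> borel_measurable Q" "prob_space Q"
        for g :: "real^'n \<Rightarrow> real" and Q :: "'z measure" and Y
      proof -
        interpret Q: prob_space Q by fact
        have gm: "g \<in> borel_measurable borel"
          using trig_sums_continuous[OF g] by (rule borel_measurable_continuous_onI)
        obtain C where "\<And>x. \<bar>g x\<bar> \<le> C" using trig_sums_bounded[OF g] by blast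
        then show ?thesis using gm Y(1) by (intro Q.integrable_const_bound[where B = C]) auto
      qed
      have im: "integrable M (\<lambda>\<omega>. g (Z t \<omega>))" "integrable M (\<lambda>\<omega>. h (Z t \<omega>))" for t
        using add.hyps by (auto intro!: i Z prob_space_axioms)
      have iN: "integrable N g" "integrable N h" 
        using i[OF add.hyps(1) _ N(1), of "\<lambda>x. x"] i[OF add.hyps(2) _ N(1), of "\<lambda>x. x"] by auto
      show ?case using tendsto_add[OF add.IH] im iN by simp
    qed
    then have 1: "\<forall>\<^sub>F t in sequentially. \<bar>expectation (\<lambda>\<omega>. T (Z t \<omega>)) - N.expectation T\<bar> < r / 2"
      using r by (auto dest!: tendstoD[where e = "r/2"] simp: dist_real_def)
    have 2: "\<bar>N.expectation f - N.expectation T\<bar> \<le> r / 8"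
    proof -
      have "\<bar>N.expectation (\<lambda>x. f x) - N.expectation (\<lambda>x. T x)\<bar> \<le> e + (B + (B + e)) * \<eta>"
      proof (rule N.expectation_diff_le_on_likely_event[where Z = "\<lambda>x. x", OF _ _ _ K' B T(3)])
        show "\<bar>f x - T x\<bar> \<le> e" if "x \<in> {x \<in> space N. norm x \<le> K'}" for x
          using that by (intro T(2)) auto
      qed (use e in auto)
      then show ?thesis using small by simp
    qed
    have 3: "\<forall>\<^sub>F t in sequentially. \<bar>expectation (\<lambda>\<omega>. f (Z t \<omega>)) - expectation (\<lambda>\<omega>. T (Z t \<omega>))\<bar> \<le> r / 8"
      using K[unfolded likely_def]
    proof eventually_elim
      case (elim t)
      then obtain A where A: "A \<in> sets M" "1 - \<eta> \<le> prob A" "\<And>\<omega>. \<omega> \<in> A \<Longrightarrow> norm (Z t \<omega>) \<le> K" by blast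
      have "\<bar>expectation (\<lambda>\<omega>. f (Z t \<omega>)) - expectation (\<lambda>\<omega>. T (Z t \<omega>))\<bar> \<le> e + (B + (B + e)) * \<eta>"
      proof (rule expectation_diff_le_on_likely_event[where Z = "Z t", OF _ _ A(1,2) B T(3)])
        show "\<bar>f (Z t x) - T (Z t x)\<bar> \<le> e" if "x \<in> A" for x
          using A(3)[OF that] by (intro T(2)) auto
      qed (use e in auto)
      then show ?case using small by simp
    qed
    from 1 3 have "\<forall>\<^sub>F t in sequentially. norm (expectation (\<lambda>\<omega>. f (Z t \<omega>)) - N.expectation f) < r"
    proof eventually_elim
      case (elim t)
      then show ?case using 2 r unfolding real_norm_def by linarith
    qed
    then show "\<exists>no. \<forall>n\<ge>no. norm (expectation (\<lambda>\<omega>. f (Z n \<omega>)) - N.expectation f) < r"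
      by (simp add: eventually_sequentially)
  qed
qed

section \<open>Normalised sums of bounded i.i.d. vectors\<close>

text \<open>Cross terms vanish by independence and centring.\<close>

lemma (in prob_space) iid_sum_second_moment:
  fixes k :: "'b \<Rightarrow> real"
  assumes indep: "indep_vars (\<lambda>_. S) X UNIV" and law: "\<And>\<tau>. distr M S (X \<tau>) = D"
    and k [measurable]: "k \<in> borel_measurable S" and bdd: "AE \<theta> in D. \<bar>k \<theta>\<bar> \<le> C"
    and mean: "(\<integral>\<theta>. k \<theta> \<partial>D) = 0"
  shows "integrable M (\<lambda>\<omega>. (\<Sum>\<tau><t. k (X \<tau> \<omega>))\<^sup>2)"
    and "expectation (\<lambda>\<omega>. (\<Sum>\<tau><t. k (X \<tau> \<omega>))\<^sup>2) = real t * (\<integral>\<theta>. (k \<theta>)\<^sup>2 \<partial>D)"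
proof -
  have X [measurable]: "X \<tau> \<in> measurable M S" for \<tau> using indep by (simp add: indep_vars_def2)
  define Y where "Y \<tau> \<omega> = k (X \<tau> \<omega>)" for \<tau> \<omega>
  have Y [measurable]: "Y \<tau> \<in> borel_measurable M" for \<tau> unfolding Y_def by measurable
  have bY: "AE \<omega> in M. \<bar>Y \<tau> \<omega>\<bar> \<le> C" for \<tau>
    using bdd unfolding law[of \<tau>, symmetric] Y_def by (rule AE_distrD[OF X])
  have iY: "integrable M (Y \<tau>)" for \<tau> using bY by (intro integrable_const_bound[where B = C]) auto
  have EY: "expectation (Y \<tau>) = 0" for \<tau>
    using mean unfolding law[of \<tau>, symmetric] Y_def by (subst (asm) integral_distr) auto
  have iYY: "integrable M (\<lambda>\<omega>. Y \<sigma> \<omega> * Y \<tau> \<omega>)" for \<sigma> \<tau>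
  proof (rule integrable_const_bound[where B = "C * C"])
    show "AE \<omega> in M. norm (Y \<sigma> \<omega> * Y \<tau> \<omega>) \<le> C * C"
      using bY[of \<sigma>] bY[of \<tau>]
    proof eventually_elim
      case (elim \<omega>)
      then show ?case unfolding real_norm_def abs_mult by (intro mult_mono) auto
    qed
  qed auto
  have EYY: "expectation (\<lambda>\<omega>. Y \<sigma> \<omega> * Y \<tau> \<omega>) = (if \<sigma> = \<tau> then (\<integral>\<theta>. (k \<theta>)\<^sup>2 \<partial>D) else 0)" for \<sigma> \<tau>
  proof (cases "\<sigma> = \<tau>")
    case True
    have "(\<integral>\<theta>. (k \<theta>)\<^sup>2 \<partial>D) = expectation (\<lambda>\<omega>. (k (X \<tau> \<omega>))\<^sup>2)"
      unfolding law[of \<tau>, symmetric] by (rule integral_distr) auto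
    then show ?thesis using True by (simp add: Y_def power2_eq_square)
  next
    case False
    have "indep_vars (\<lambda>_. borel) Y UNIV" unfolding Y_def
      by (rule indep_vars_compose2[OF indep]) simp
    then have "indep_vars (\<lambda>_. borel) Y {\<sigma>, \<tau>}" by (rule indep_vars_subset) simp
    then have "expectation (\<lambda>\<omega>. \<Prod>i\<in>{\<sigma>, \<tau>}. Y i \<omega>) = (\<Prod>i\<in>{\<sigma>, \<tau>}. expectation (Y i))"
      using iY by (intro indep_vars_lebesgue_integral) auto
    then show ?thesis using False EY by simp
  qed
  have sq: "(\<lambda>\<omega>. (\<Sum>\<tau><t. k (X \<tau> \<omega>))\<^sup>2) = (\<lambda>\<omega>. \<Sum>\<sigma><t. \<Sum>\<tau><t. Y \<sigma> \<omega> * Y \<tau> \<omega>)"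
    by (simp add: Y_def power2_eq_square sum_product)
  show "integrable M (\<lambda>\<omega>. (\<Sum>\<tau><t. k (X \<tau> \<omega>))\<^sup>2)"
    unfolding sq by (intro Bochner_Integration.integrable_sum iYY)
  have "expectation (\<lambda>\<omega>. (\<Sum>\<tau><t. k (X \<tau> \<omega>))\<^sup>2) = (\<Sum>\<sigma><t. \<Sum>\<tau><t. expectation (\<lambda>\<omega>. Y \<sigma> \<omega> * Y \<tau> \<omega>))"
    unfolding sq using iYY by (simp add: Bochner_Integration.integral_sum Bochner_Integration.integrable_sum)
  also have "\<dots> = real t * (\<integral>\<theta>. (k \<theta>)\<^sup>2 \<partial>D)" by (simp add: EYY)
  finally show "expectation (\<lambda>\<omega>. (\<Sum>\<tau><t. k (X \<tau> \<omega>))\<^sup>2) = real t * (\<integral>\<theta>. (k \<theta>)\<^sup>2 \<partial>D)" .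
qed

text \<open>Chebyshev's inequality, stated for fixed \<open>t\<close> so that the summand may itself depend on \<open>t\<close>.\<close>

lemma (in prob_space) iid_sum_concentration:
  fixes k :: "'b \<Rightarrow> real"
  assumes indep: "indep_vars (\<lambda>_. S) X UNIV" and law: "\<And>\<tau>. distr M S (X \<tau>) = D"
    and k [measurable]: "k \<in> borel_measurable S" and bdd: "AE \<theta> in D. \<bar>k \<theta>\<bar> \<le> C"
    and \<epsilon>: "0 < \<epsilon>" and small: "real t * (\<integral>\<theta>. (k \<theta>)\<^sup>2 \<partial>D) \<le> \<eta> * \<epsilon>\<^sup>2"
  shows "\<exists>A\<in>events. 1 - \<eta> \<le> prob A \<and>
           (\<forall>\<omega>\<in>A. \<bar>(\<Sum>\<tau><t. k (X \<tau> \<omega>)) - real t * (\<integral>\<theta>. k \<theta> \<partial>D)\<bar> \<le> \<epsilon>)"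
proof -
  have X [measurable]: "X \<tau> \<in> measurable M S" for \<tau> using indep by (simp add: indep_vars_def2)
  have D_sets [measurable_cong]: "sets D = sets S" using law[of 0] by (metis sets_distr)
  interpret D: prob_space D unfolding law[of 0, symmetric] by (rule prob_space_distr[OF X])
  define m where "m = (\<integral>\<theta>. k \<theta> \<partial>D)"
  define k' where "k' \<theta> = k \<theta> - m" for \<theta>
  have k' [measurable]: "k' \<in> borel_measurable S" unfolding k'_def by measurable
  have ik: "integrable D k" using bdd by (intro D.integrable_const_bound[where B = C]) auto
  have ik2: "integrable D (\<lambda>\<theta>. (k \<theta>)\<^sup>2)"
  proof (rule D.integrable_const_bound[where B = "C\<^sup>2"])
    show "AE \<theta> in D. norm ((k \<theta>)\<^sup>2) \<le> C\<^sup>2"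
      using bdd by eventually_elim (simp add: abs_le_square_iff[symmetric])
  qed auto
  have bdd': "AE \<theta> in D. \<bar>k' \<theta>\<bar> \<le> C + \<bar>m\<bar>" using bdd by eventually_elim (auto simp: k'_def)
  have mean': "(\<integral>\<theta>. k' \<theta> \<partial>D) = 0" using ik by (simp add: k'_def D.prob_space m_def)
  have "(\<integral>\<theta>. (k' \<theta>)\<^sup>2 \<partial>D) \<le> (\<integral>\<theta>. (k \<theta>)\<^sup>2 \<partial>D)"
    using D.variance_eq[OF ik ik2] by (simp add: k'_def m_def)
  then have "real t * (\<integral>\<theta>. (k' \<theta>)\<^sup>2 \<partial>D) \<le> real t * (\<integral>\<theta>. (k \<theta>)\<^sup>2 \<partial>D)"
    by (rule mult_left_mono) simp
  also note small
  finally have var: "real t * (\<integral>\<theta>. (k' \<theta>)\<^sup>2 \<partial>D) \<le> \<eta> * \<epsilon>\<^sup>2" .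
  define T where "T \<omega> = (\<Sum>\<tau><t. k' (X \<tau> \<omega>))" for \<omega>
  have T: "T \<omega> = (\<Sum>\<tau><t. k (X \<tau> \<omega>)) - real t * m" for \<omega>
    by (simp add: T_def k'_def sum_subtractf)
  have [measurable]: "T \<in> borel_measurable M" unfolding T_def by measurable
  note sm = iid_sum_second_moment[OF indep law k' bdd' mean', of t, folded T_def]
  have "prob {\<omega> \<in> space M. \<epsilon>\<^sup>2 \<le> (T \<omega>)\<^sup>2} \<le> expectation (\<lambda>\<omega>. (T \<omega>)\<^sup>2) / \<epsilon>\<^sup>2"
    using sm(1) \<epsilon> by (intro integral_Markov_inequality_measure[where A = "{}"]) auto
  also have "\<dots> \<le> \<eta>" using var \<epsilon> sm(2) by (simp add: field_simps)
  finally have "1 - \<eta> \<le> prob (space M - {\<omega> \<in> space M. \<epsilon>\<^sup>2 \<le> (T \<omega>)\<^sup>2})"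
    by (subst prob_compl) auto
  moreover have "\<bar>T \<omega>\<bar> \<le> \<epsilon>" if "\<omega> \<in> space M - {\<omega> \<in> space M. \<epsilon>\<^sup>2 \<le> (T \<omega>)\<^sup>2}" for \<omega>
  proof -
    have "(T \<omega>)\<^sup>2 \<le> \<epsilon>\<^sup>2" using that by auto
    then show ?thesis using \<epsilon> by (simp add: abs_le_square_iff[symmetric])
  qed
  ultimately show ?thesis
    by (intro bexI[of _ "space M - {\<omega> \<in> space M. \<epsilon>\<^sup>2 \<le> (T \<omega>)\<^sup>2}"]) (auto simp: T m_def)
qed

text \<open>The central limit theorem in terms of characteristic functions. In the degenerate case the sums are almost surely
zero; otherwise the result is the standard theorem evaluated at the standard deviation.\<close>

lemma (in prob_space) iid_sum_char_tendsto:
  fixes k :: "'b \<Rightarrow> real"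
  assumes indep: "indep_vars (\<lambda>_. S) X UNIV" and law: "\<And>\<tau>. distr M S (X \<tau>) = D"
    and k [measurable]: "k \<in> borel_measurable S" and bdd: "AE \<theta> in D. \<bar>k \<theta>\<bar> \<le> C"
    and mean: "(\<integral>\<theta>. k \<theta> \<partial>D) = 0"
  shows "(\<lambda>t. CLINT \<omega>|M. iexp ((\<Sum>\<tau><t. k (X \<tau> \<omega>)) / sqrt (real t)))
           \<longlonglongrightarrow> complex_of_real (exp (- (\<integral>\<theta>. (k \<theta>)\<^sup>2 \<partial>D) / 2))"
proof -
  have X [measurable]: "X \<tau> \<in> measurable M S" for \<tau> using indep by (simp add: indep_vars_def2)
  have D_sets [measurable_cong]: "sets D = sets S" using law[of 0] by (metis sets_distr)
  interpret D: prob_space D unfolding law[of 0, symmetric] by (rule prob_space_distr[OF X])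
  define Y where "Y \<tau> \<omega> = k (X \<tau> \<omega>)" for \<tau> \<omega>
  have Y [measurable]: "Y \<tau> \<in> borel_measurable M" for \<tau> unfolding Y_def by measurable
  have ik2: "integrable D (\<lambda>\<theta>. (k \<theta>)\<^sup>2)"
  proof (rule D.integrable_const_bound[where B = "C\<^sup>2"])
    show "AE \<theta> in D. norm ((k \<theta>)\<^sup>2) \<le> C\<^sup>2"
      using bdd by eventually_elim (simp add: abs_le_square_iff[symmetric])
  qed auto
  define V where "V = (\<integral>\<theta>. (k \<theta>)\<^sup>2 \<partial>D)"
  have V0: "0 \<le> V" by (simp add: V_def)
  show ?thesis
  proof (cases "V = 0")
    case True
    then have "AE \<theta> in D. (k \<theta>)\<^sup>2 = 0" using ik2 by (simp add: V_def integral_nonneg_eq_0_iff_AE)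
    then have k0: "AE \<omega> in M. Y \<tau> \<omega> = 0" for \<tau>
      unfolding law[of \<tau>, symmetric] Y_def by (auto dest!: AE_distrD[OF X])
    have "(CLINT \<omega>|M. iexp ((\<Sum>\<tau><t. k (X \<tau> \<omega>)) / sqrt (real t))) = 1" for t
    proof -
      have "AE \<omega> in M. \<forall>\<tau>\<in>{..<t}. Y \<tau> \<omega> = 0" using k0 by (intro AE_finite_allI) auto
      then have "(CLINT \<omega>|M. iexp ((\<Sum>\<tau><t. k (X \<tau> \<omega>)) / sqrt (real t))) = (CLINT \<omega>|M. 1)"
        by (intro integral_cong_AE) (auto simp: Y_def)
      then show ?thesis by (simp add: prob_space)
    qed
    then show ?thesis using True by (simp add: V_def)
  next
    case False
    then have Vp: "0 < V" using V0 by simp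
    have iY: "integrable M (\<lambda>x. (Y n x)\<^sup>2)" for n
      using ik2 unfolding law[of n, symmetric] Y_def by (subst (asm) integrable_distr_eq) auto
    have EY: "expectation (Y \<tau>) = 0" for \<tau>
      using mean unfolding law[of \<tau>, symmetric] Y_def by (subst (asm) integral_distr) auto
    have VY: "variance (Y n) = (sqrt V)\<^sup>2" for n
    proof -
      have "V = expectation (\<lambda>x. (Y n x)\<^sup>2)"
        unfolding V_def law[of n, symmetric] Y_def by (rule integral_distr) auto
      then show ?thesis using V0 by (simp add: EY)
    qed
    have dY: "distr M borel (Y n) = distr D borel k" for n
      unfolding law[of n, symmetric] by (subst distr_distr) (auto simp: comp_def Y_def[abs_def])
    have "indep_vars (\<lambda>_. borel) Y UNIV" unfolding Y_def
      by (rule indep_vars_compose2[OF indep]) simp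
    then have wc: "weak_conv_m (\<lambda>n. distr M borel (\<lambda>x. (\<Sum>i<n. Y i x) / sqrt (n * (sqrt V)\<^sup>2))) std_normal_distribution"
      using EY _ iY VY dY by (rule central_limit_theorem_zero_mean) (use Vp in simp)
    have "(\<lambda>n. char (distr M borel (\<lambda>x. (\<Sum>i<n. Y i x) / sqrt (n * (sqrt V)\<^sup>2))) (sqrt V))
        \<longlonglongrightarrow> char std_normal_distribution (sqrt V)"
      by (rule levy_continuity1[OF _ _ wc]) (auto intro: real_dist_normal_dist real_distribution_distr)
    moreover have "char (distr M borel (\<lambda>x. (\<Sum>i<n. Y i x) / sqrt (n * (sqrt V)\<^sup>2))) (sqrt V)
        = (CLINT \<omega>|M. iexp ((\<Sum>\<tau><n. k (X \<tau> \<omega>)) / sqrt (real n)))" for n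
    proof -
      have "sqrt V * (x / sqrt (n * (sqrt V)\<^sup>2)) = x / sqrt n" for x :: real
        using Vp by (simp add: real_sqrt_mult)
      then show ?thesis unfolding char_def by (subst integral_distr) (auto simp: Y_def)
    qed
    ultimately show ?thesis using V0 by (simp add: char_std_normal_distribution V_def)
  qed
qed

lemma norm_iexp_diff_le: "cmod (iexp x - iexp y) \<le> \<bar>x - y\<bar>"
proof -
  have "iexp x - iexp y = iexp y * (iexp (x - y) - 1)"
    by (simp add: right_diff_distrib exp_add[symmetric] distrib_left[symmetric])
  also have "cmod \<dots> = cmod (iexp (x - y) - 1)" by (simp add: norm_mult)
  also have "\<dots> \<le> \<bar>x - y\<bar>" using iexp_approx1[of "x - y" 0] by simp
  finally show ?thesis .
qed

text \<open>Slutsky's theorem for characteristic functions, from \<open>cmod (iexp x - iexp y) \<le> min \<bar>x - y\<bar> 2\<close>.\<close>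

lemma (in prob_space) char_tendsto_vanishing_difference:
  assumes [measurable]: "\<And>t. A t \<in> borel_measurable M" "\<And>t. B t \<in> borel_measurable M"
    and van: "vanishing M (\<lambda>t \<omega>. A t \<omega> - B t \<omega>)"
    and lim: "(\<lambda>t. CLINT \<omega>|M. iexp (B t \<omega>)) \<longlonglongrightarrow> c"
  shows "(\<lambda>t. CLINT \<omega>|M. iexp (A t \<omega>)) \<longlonglongrightarrow> c"
proof -
  have i: "integrable M (\<lambda>\<omega>. iexp (f \<omega>))" if "f \<in> borel_measurable M" for f
    using that by (intro integrable_const_bound[where B = 1]) auto
  have "(\<lambda>t. (CLINT \<omega>|M. iexp (A t \<omega>)) - (CLINT \<omega>|M. iexp (B t \<omega>))) \<longlonglongrightarrow> 0"
  proof (rule LIMSEQ_I)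
    fix r :: real assume r: "0 < r"
    have "likely M (r/8) (\<lambda>t \<omega>. norm (A t \<omega> - B t \<omega>) \<le> r / 4)"
      using van[unfolded vanishing_def, rule_format, of "r/4" "r/8"] r by simp
    then have "\<forall>\<^sub>F t in sequentially. norm ((CLINT \<omega>|M. iexp (A t \<omega>)) - (CLINT \<omega>|M. iexp (B t \<omega>))) < r"
      unfolding likely_def
    proof eventually_elim
      case (elim t)
      then obtain E where E: "E \<in> events" "1 - r/8 \<le> prob E" "\<And>\<omega>. \<omega> \<in> E \<Longrightarrow> \<bar>A t \<omega> - B t \<omega>\<bar> \<le> r/4"
        by auto
      have "norm ((CLINT \<omega>|M. iexp (A t \<omega>)) - (CLINT \<omega>|M. iexp (B t \<omega>)))
          = norm (CLINT \<omega>|M. iexp (A t \<omega>) - iexp (B t \<omega>))" by (simp add: i)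
      also have "\<dots> \<le> expectation (\<lambda>\<omega>. cmod (iexp (A t \<omega>) - iexp (B t \<omega>)))"
        by (rule integral_norm_bound)
      also have "\<dots> \<le> expectation (\<lambda>\<omega>. r/4 + 2 * indicator (space M - E) \<omega>)"
      proof (rule integral_mono)
        show "integrable M (\<lambda>\<omega>. cmod (iexp (A t \<omega>) - iexp (B t \<omega>)))"
          by (intro integrable_norm Bochner_Integration.integrable_diff i) auto
        show "integrable M (\<lambda>\<omega>. r/4 + 2 * indicator (space M - E) \<omega>)"
          using E by (auto intro!: Bochner_Integration.integrable_add integrable_mult_right integrable_real_indicator simp: emeasure_eq_measure)
        fix \<omega> assume w: "\<omega> \<in> space M"
        show "cmod (iexp (A t \<omega>) - iexp (B t \<omega>)) \<le> r/4 + 2 * indicator (space M - E) \<omega>"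
        proof (cases "\<omega> \<in> E")
          case True
          then show ?thesis using E(3)[OF True] norm_iexp_diff_le[of "A t \<omega>" "B t \<omega>"] by simp
        next
          case False
          have "cmod (iexp (A t \<omega>) - iexp (B t \<omega>)) \<le> 1 + 1"
            by (rule order_trans[OF norm_triangle_ineq4]) simp
          then show ?thesis using False w r by simp
        qed
      qed
      also have "\<dots> = r/4 + 2 * prob (space M - E)"
        using E by (subst Bochner_Integration.integral_add) (auto simp: emeasure_eq_measure prob_space)
      also have "\<dots> \<le> r / 2" using E by (simp add: prob_compl)
      also have "\<dots> < r" using r by simp
      finally show ?case .
    qed
    then show "\<exists>no. \<forall>n\<ge>no. norm ((CLINT \<omega>|M. iexp (A n \<omega>)) - (CLINT \<omega>|M. iexp (B n \<omega>)) - 0) < r"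
      by (simp add: eventually_sequentially)
  qed
  from tendsto_add[OF this lim] show ?thesis by simp
qed

lemma borel_measurable_component [measurable]:
  fixes f :: "'a \<Rightarrow> real^'n::finite"
  assumes "f \<in> borel_measurable M"
  shows "(\<lambda>x. f x $ i) \<in> borel_measurable M"
proof (rule measurable_compose[OF assms])
  show "(\<lambda>z::real^'n. z $ i) \<in> borel_measurable borel"
    by (rule borel_measurable_continuous_onI) (intro continuous_intros)
qed

lemma borel_measurable_vecI:
  fixes f :: "'a \<Rightarrow> real^'n::finite"
  assumes "\<And>i. (\<lambda>x. f x $ i) \<in> borel_measurable M"
  shows "f \<in> borel_measurable M"
  by (subst borel_measurable_euclidean_space) (use assms in \<open>auto simp: Basis_vec_def inner_axis\<close>)

locale centered_iid_sum = prob_space +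
  fixes S D :: "'b measure" and X :: "nat \<Rightarrow> 'a \<Rightarrow> 'b" and g :: "'b \<Rightarrow> real^'n::finite"
    and \<Omega> :: "real^'n^'n"
  assumes indep: "indep_vars (\<lambda>_. S) X UNIV" and law: "\<And>\<tau>. distr M S (X \<tau>) = D"
    and g [measurable]: "g \<in> borel_measurable S" and bdd: "\<exists>C. AE \<theta> in D. norm (g \<theta>) \<le> C"
    and mean: "\<And>i. (\<integral>\<theta>. g \<theta> $ i \<partial>D) = 0"
    and cov: "\<And>i j. (\<integral>\<theta>. g \<theta> $ i * g \<theta> $ j \<partial>D) = \<Omega> $ i $ j"
begin

definition W :: "nat \<Rightarrow> 'a \<Rightarrow> real^'n" where
  "W t \<omega> = (1 / sqrt (real t)) *\<^sub>R (\<Sum>\<tau><t. g (X \<tau> \<omega>))"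

definition C :: real where "C = (SOME C. AE \<theta> in D. norm (g \<theta>) \<le> C)"

lemma g_bounded: "AE \<theta> in D. norm (g \<theta>) \<le> C"
  unfolding C_def using bdd by (rule someI_ex)

lemma X_measurable [measurable]: "X \<tau> \<in> measurable M S"
  using indep by (simp add: indep_vars_def2)

lemma sets_D [measurable_cong]: "sets D = sets S"
  using law[of 0] by (metis sets_distr)

sublocale D: prob_space D
  unfolding law[of 0, symmetric] by (rule prob_space_distr[OF X_measurable])

lemma W_measurable [measurable]: "W t \<in> borel_measurable M"
proof -
  have "(\<lambda>\<omega>. (1 / sqrt (real t)) *\<^sub>R (\<Sum>\<tau><t. g (X \<tau> \<omega>))) \<in> borel_measurable M" by measurable
  then show ?thesis by (simp add: W_def[abs_def])
qed

lemma inner_bounded: "AE \<theta> in D. \<bar>a \<bullet> g \<theta>\<bar> \<le> norm a * C"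
  using g_bounded
proof eventually_elim
  case (elim \<theta>)
  then show ?case using Cauchy_Schwarz_ineq2[of a "g \<theta>"] by (meson mult_left_mono norm_ge_zero order_trans)
qed

lemma component_bounded: "AE \<theta> in D. \<bar>g \<theta> $ i\<bar> \<le> C"
proof -
  have "norm (axis i 1 :: real^'n) * C = C" "axis i 1 \<bullet> g \<theta> = g \<theta> $ i" for \<theta>
    by (simp_all add: inner_axis')
  then show ?thesis using inner_bounded[of "axis i 1"] by presburger
qed

lemma integrable_component: "integrable D (\<lambda>\<theta>. g \<theta> $ i)"
proof (rule D.integrable_const_bound[where B = C])
  show "AE \<theta> in D. norm (g \<theta> $ i) \<le> C" using component_bounded[of i] by simp
qed measurable

lemma integrable_product: "integrable D (\<lambda>\<theta>. g \<theta> $ i * g \<theta> $ j)"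
proof (rule D.integrable_const_bound[where B = "C * C"])
  show "AE \<theta> in D. norm (g \<theta> $ i * g \<theta> $ j) \<le> C * C"
    using component_bounded[of i] component_bounded[of j]
  proof eventually_elim
    case (elim \<omega>)
    then show ?case unfolding real_norm_def abs_mult by (intro mult_mono) auto
  qed
qed measurable

lemma inner_mean: "(\<integral>\<theta>. a \<bullet> g \<theta> \<partial>D) = 0"
proof -
  have "(\<integral>\<theta>. a \<bullet> g \<theta> \<partial>D) = (\<integral>\<theta>. (\<Sum>i\<in>UNIV. a $ i * g \<theta> $ i) \<partial>D)"
    by (simp add: inner_vec_def)
  also have "\<dots> = (\<Sum>i\<in>UNIV. \<integral>\<theta>. a $ i * g \<theta> $ i \<partial>D)"
    by (intro Bochner_Integration.integral_sum integrable_mult_right integrable_component)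
  finally show ?thesis by (simp add: mean)
qed

lemma inner_variance: "(\<integral>\<theta>. (a \<bullet> g \<theta>)\<^sup>2 \<partial>D) = a \<bullet> (\<Omega> *v a)"
proof -
  have "(\<integral>\<theta>. (a \<bullet> g \<theta>)\<^sup>2 \<partial>D) = (\<integral>\<theta>. (\<Sum>i\<in>UNIV. \<Sum>j\<in>UNIV. a $ i * a $ j * (g \<theta> $ i * g \<theta> $ j)) \<partial>D)"
    by (simp add: inner_vec_def power2_eq_square sum_product mult_ac)
  also have "\<dots> = (\<Sum>i\<in>UNIV. \<Sum>j\<in>UNIV. a $ i * a $ j * \<Omega> $ i $ j)"
    by (simp add: integrable_product cov)
  also have "\<dots> = a \<bullet> (\<Omega> *v a)"
    by (simp add: inner_vec_def matrix_vector_mult_def sum_distrib_left mult_ac)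
  finally show ?thesis .
qed

lemma W_stochastically_bounded: "stochastically_bounded M W"
proof (rule stochastically_bounded_componentwise)
  fix i
  define V where "V = (\<integral>\<theta>. (g \<theta> $ i)\<^sup>2 \<partial>D)"
  have V0: "0 \<le> V" by (simp add: V_def)
  show "stochastically_bounded M (\<lambda>t \<omega>. W t \<omega> $ i)"
    unfolding stochastically_bounded_def
  proof (intro allI impI)
    fix \<eta> :: real assume \<eta>: "0 < \<eta>"
    \<comment> \<open>then \<open>K\<^sup>2 \<ge> V / \<eta>\<close>, as required by Chebyshev with failure probability \<open>\<eta>\<close>\<close>
    define K where "K = V / \<eta> + 1"
    have K1: "1 \<le> K" using V0 \<eta> by (simp add: K_def)
    have "V \<le> \<eta> * K" using \<eta> by (simp add: K_def distrib_left)
    also have "\<dots> \<le> \<eta> * K\<^sup>2" using \<eta> K1 by (simp add: power2_eq_square)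
    finally have VK: "V \<le> \<eta> * K\<^sup>2" .
    have "likely M \<eta> (\<lambda>t \<omega>. norm (W t \<omega> $ i) \<le> K)"
      unfolding likely_def using eventually_gt_at_top[of 0]
    proof eventually_elim
      case (elim t)
      have gi: "(\<lambda>\<theta>. g \<theta> $ i) \<in> borel_measurable S" by simp
      have "real t * V \<le> \<eta> * (K * sqrt (real t))\<^sup>2"
        using mult_left_mono[OF VK, of "real t"] by (simp add: power_mult_distrib mult_ac)
      then have "\<exists>A\<in>events. 1 - \<eta> \<le> prob A \<and>
           (\<forall>\<omega>\<in>A. \<bar>(\<Sum>\<tau><t. g (X \<tau> \<omega>) $ i) - real t * (\<integral>\<theta>. g \<theta> $ i \<partial>D)\<bar> \<le> K * sqrt (real t))"
        using K1 elim by (intro iid_sum_concentration[OF indep law gi component_bounded]) (auto simp: V_def)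
      then obtain A where A: "A \<in> events" "1 - \<eta> \<le> prob A"
           "\<And>\<omega>. \<omega>\<in>A \<Longrightarrow> \<bar>\<Sum>\<tau><t. g (X \<tau> \<omega>) $ i\<bar> \<le> K * sqrt (real t)"
        by (auto simp: mean)
      have "norm (W t \<omega> $ i) \<le> K" if "\<omega> \<in> A" for \<omega>
        using A(3)[OF that] elim by (simp add: W_def field_simps)
      then show ?case using A by blast
    qed
    then show "\<exists>K. likely M \<eta> (\<lambda>t \<omega>. norm (W t \<omega> $ i) \<le> K)" by blast
  qed
qed

lemma W_char_tendsto:
  "(\<lambda>t. CLINT \<omega>|M. iexp (a \<bullet> W t \<omega>)) \<longlonglongrightarrow> complex_of_real (exp (- (a \<bullet> (\<Omega> *v a)) / 2))"
proof -
  have ag: "(\<lambda>\<theta>. a \<bullet> g \<theta>) \<in> borel_measurable S" by measurable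
  have "a \<bullet> W t \<omega> = (\<Sum>\<tau><t. a \<bullet> g (X \<tau> \<omega>)) / sqrt (real t)" for t \<omega>
    by (simp add: W_def inner_sum_right)
  then show ?thesis
    using iid_sum_char_tendsto[OF indep law ag inner_bounded inner_mean] by (simp add: inner_variance)
qed

text \<open>A projection of \<open>L *v W t\<close> along \<open>a\<close> is the projection of \<open>W t\<close> along \<open>a v* L\<close>, to which the one-dimensional
central limit theorem applies; \<open>Cramer_Wold\<close> combines the projections.\<close>

lemma asymp_normal_of_linear_expansion:
  fixes L :: "real^'n^'m::finite"
  assumes Z: "\<And>t. Z t \<in> borel_measurable M"
    and van: "vanishing M (\<lambda>t \<omega>. Z t \<omega> - L *v W t \<omega>)"
  shows "asymp_normal M Z (L ** \<Omega> ** transpose L)"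
proof -
  define \<Sigma> where "\<Sigma> = L ** \<Omega> ** transpose L"
  have \<Omega>sym: "transpose \<Omega> = \<Omega>" by (auto simp: transpose_def vec_eq_iff cov[symmetric] mult.commute)
  have quad: "a \<bullet> (\<Sigma> *v a) = (a v* L) \<bullet> (\<Omega> *v (a v* L))" for a
    by (simp add: \<Sigma>_def matrix_vector_mul_assoc[symmetric] dot_lmul_matrix)
  have \<Sigma>sym: "transpose \<Sigma> = \<Sigma>" by (simp add: \<Sigma>_def matrix_transpose_mul \<Omega>sym matrix_mul_assoc)
  have sym: "\<Sigma> $ i $ j = \<Sigma> $ j $ i" for i j
  proof -
    have "\<Sigma> $ i $ j = transpose \<Sigma> $ j $ i" by (simp add: transpose_def)
    then show ?thesis by (simp only: \<Sigma>sym)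
  qed
  have "0 \<le> a \<bullet> (\<Sigma> *v a)" for a
    unfolding quad inner_variance[symmetric] by simp
  then obtain l :: "'m \<Rightarrow> real^'m" where l: "\<And>i j. \<Sigma> $ i $ j = (\<Sum>k\<in>UNIV. l k $ i * l k $ j)"
    using psd_sum_rank_one[of \<Sigma>, OF sym] by blast
  obtain N where N: "multivariate_normal N 0 \<Sigma>"
      and proj: "\<And>a. 0 \<le> a \<bullet> (\<Sigma> *v a)" "\<And>a. distr N borel (\<lambda>x. a \<bullet> x) = normal_law 0 (a \<bullet> (\<Sigma> *v a))"
    using multivariate_normal_exists[OF l] by blast
  have Ns [measurable_cong]: "sets N = sets borel" and Np: "prob_space N"
    using N by (auto simp: multivariate_normal_def)
  have "converges_in_distribution M Z N"
  proof (rule Cramer_Wold[OF Z Np Ns])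
    have "stochastically_bounded M (\<lambda>t \<omega>. L *v W t \<omega>)"
    proof -
      obtain K where "\<And>z. norm (L *v z) \<le> norm z * K"
        using bounded_linear.bounded[OF matrix_vector_mul_bounded_linear[of L]] by blast
      then show ?thesis
        by (intro stochastically_bounded_dominated[OF W_stochastically_bounded, of _ K] whp_AE)
           (simp add: mult.commute)
    qed
    from stochastically_bounded_add_vanishing[OF this van]
    show "stochastically_bounded M Z" by simp
  next
    fix a :: "real^'m"
    have "(\<lambda>t. CLINT \<omega>|M. iexp (a \<bullet> Z t \<omega>)) \<longlonglongrightarrow> complex_of_real (exp (- ((a v* L) \<bullet> (\<Omega> *v (a v* L))) / 2))"
    proof (rule char_tendsto_vanishing_difference[OF _ _ _ W_char_tendsto])
      show "vanishing M (\<lambda>t \<omega>. a \<bullet> Z t \<omega> - (a v* L) \<bullet> W t \<omega>)"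
        using vanishing_bounded_linear[OF bounded_linear_inner_right van, of a]
        by (simp add: inner_diff_right dot_lmul_matrix)
    qed (use Z in measurable)
    moreover have "(CLINT x|N. iexp (a \<bullet> x)) = char (distr N borel (\<lambda>x. a \<bullet> x)) 1"
      unfolding char_def by (subst integral_distr) auto
    ultimately show "(\<lambda>t. CLINT \<omega>|M. iexp (a \<bullet> Z t \<omega>)) \<longlonglongrightarrow> (CLINT x|N. iexp (a \<bullet> x))"
      using proj(1)[of a] by (simp add: proj(2) char_normal_law quad)
  qed
  then show ?thesis using N unfolding asymp_normal_def \<Sigma>_def by blast
qed

lemma asymp_normal_real_of_linear_expansion:
  assumes Z: "\<And>t. Z t \<in> borel_measurable M"
    and van: "vanishing M (\<lambda>t \<omega>. Z t \<omega> - l \<bullet> W t \<omega>)"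
  shows "asymp_normal_real M Z (l \<bullet> (\<Omega> *v l))"
proof -
  have nn: "0 \<le> l \<bullet> (\<Omega> *v l)" unfolding inner_variance[symmetric] by simp
  have "weak_conv_m (\<lambda>t. distr M borel (Z t)) (normal_law 0 (l \<bullet> (\<Omega> *v l)))"
  proof (rule levy_continuity)
    fix s :: real
    have "(\<lambda>t. CLINT \<omega>|M. iexp (s * Z t \<omega>)) \<longlonglongrightarrow> complex_of_real (exp (- ((s *\<^sub>R l) \<bullet> (\<Omega> *v (s *\<^sub>R l))) / 2))"
    proof (rule char_tendsto_vanishing_difference[OF _ _ _ W_char_tendsto])
      show "vanishing M (\<lambda>t \<omega>. s * Z t \<omega> - (s *\<^sub>R l) \<bullet> W t \<omega>)"
        using vanishing_bounded_linear[OF bounded_linear_mult_right van, of s]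
        by (simp add: right_diff_distrib)
    qed (use Z in measurable)
    moreover have "char (distr M borel (Z t)) s = (CLINT \<omega>|M. iexp (s * Z t \<omega>))" for t
      unfolding char_def using Z by (subst integral_distr) auto
    ultimately show "(\<lambda>t. char (distr M borel (Z t)) s) \<longlonglongrightarrow> char (normal_law 0 (l \<bullet> (\<Omega> *v l))) s"
      by (simp add: char_normal_law nn matrix_vector_mult_scaleR power2_eq_square mult_ac)
  qed (use Z in \<open>auto intro: real_distribution_distr real_distribution_normal_law\<close>)
  then show ?thesis using nn Z by (simp add: asymp_normal_real_def)
qed

end

section \<open>Convex functions close to a quadratic form\<close>

text \<open>A convex function on a small cube is bounded above by its values at the vertices, and below, by reflection in the
centre, by twice its value at the centre minus the upper bound. Finitely many cubes cover the ball, so control at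
their vertices and centres suffices. Finiteness matters because convergence in probability holds pointwise only.\<close>

lemma convex_close_on_finite_set_imp_close_on_ball:
  fixes q :: "'a::euclidean_space \<Rightarrow> real"
  assumes q: "continuous_on UNIV q" and e: "0 < e"
  obtains F \<eta> where "finite F" "0 < \<eta>"
    "\<And>\<phi>. convex_on UNIV \<phi> \<Longrightarrow> \<forall>x\<in>F. \<bar>\<phi> x - q x\<bar> \<le> \<eta> \<Longrightarrow> \<forall>x\<in>cball 0 K. \<bar>\<phi> x - q x\<bar> \<le> e"
proof -
  define \<eta> where "\<eta> = e / 5"
  have \<eta>: "0 < \<eta>" using e by (simp add: \<eta>_def)
  have "uniformly_continuous_on (cball 0 (K + 1)) q"
    using q by (intro compact_uniformly_continuous) (auto intro: continuous_on_subset)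
  then obtain r where r: "0 < r" "\<And>x y. x \<in> cball 0 (K+1) \<Longrightarrow> y \<in> cball 0 (K+1) \<Longrightarrow> dist y x < r \<Longrightarrow> dist (q y) (q x) < \<eta>"
    unfolding uniformly_continuous_on_def using \<eta> by metis
  define n where "n = real (DIM('a))"
  have n: "1 \<le> n" using DIM_positive[where 'a='a] by (simp add: n_def Suc_le_eq)
  \<comment> \<open>the cube of half-width \<open>d\<close> then has radius below both \<open>r\<close> and \<open>1\<close>\<close>
  define d where "d = min (1/2) (r/2) / n"
  have d: "0 < d" using r n by (simp add: d_def)
  define Q where "Q c = cbox (c - (\<Sum>i\<in>Basis. d *\<^sub>R i)) (c + (\<Sum>i\<in>Basis. d *\<^sub>R i))" for c :: 'a
  have Qnear: "dist y c < r \<and> dist y c < 1" if "y \<in> Q c" for y c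
  proof -
    have "\<bar>(y - c) \<bullet> i\<bar> \<le> d" if "i \<in> Basis" for i
      using \<open>y \<in> Q c\<close> that unfolding Q_def mem_box by (force simp: inner_diff_left inner_add_left)
    then have "norm (y - c) \<le> (\<Sum>i\<in>(Basis::'a set). d)"
      by (intro order_trans[OF norm_le_l1] sum_mono) auto
    also have "\<dots> = min (1/2) (r/2)" using n by (simp add: d_def n_def)
    finally show ?thesis using r by (simp add: dist_norm)
  qed
  have "\<exists>S. finite S \<and> Q c = convex hull S" for c
    unfolding Q_def using cube_convex_hull[OF d, of c] by (metis)
  then obtain V where V: "\<And>c. finite (V c)" "\<And>c. Q c = convex hull (V c)" by metis
  have cI: "c \<in> interior (Q c)" for c
    using d by (simp add: Q_def interior_cbox mem_box inner_diff_left inner_add_left)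
  have "cball 0 K \<subseteq> (\<Union>c\<in>cball 0 K. interior (Q c))" using cI by blast
  then obtain T where T: "T \<subseteq> cball (0::'a) K" "finite T" "cball 0 K \<subseteq> (\<Union>c\<in>T. interior (Q c))"
    using compactE_image[OF compact_cball[of 0 K], of "cball 0 K" "\<lambda>c. interior (Q c)"] by auto
  \<comment> \<open>centres and vertices of the covering cubes\<close>
  define F where "F = T \<union> (\<Union>c\<in>T. V c)"
  have "\<forall>x\<in>cball 0 K. \<bar>\<phi> x - q x\<bar> \<le> e" if \<phi>: "convex_on UNIV \<phi>" and close: "\<forall>x\<in>F. \<bar>\<phi> x - q x\<bar> \<le> \<eta>" for \<phi>
  proof
    fix x assume "x \<in> cball (0::'a) K"
    then obtain c where c: "c \<in> T" "x \<in> Q c" using T(3) interior_subset by blast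
    have cK: "c \<in> cball 0 (K + 1)" using T(1) c(1) by auto
    have osc: "\<bar>q y - q c\<bar> < \<eta>" if "y \<in> Q c" for y
    proof -
      have "norm y \<le> norm c + dist y c" by (metis dist_0_norm dist_commute dist_triangle)
      then have "y \<in> cball 0 (K + 1)" using Qnear[OF that] T(1) c(1) by auto
      then show ?thesis using r(2)[OF cK] Qnear[OF that] by (simp add: dist_real_def)
    qed
    have upper: "\<phi> y \<le> q c + 2 * \<eta>" if y: "y \<in> Q c" for y
    proof -
      have "\<phi> y \<le> q c + 2 * \<eta>" if "y \<in> convex hull (V c)"
      proof (rule bspec[OF convex_on_convex_hull_bound that])
        show "convex_on (convex hull V c) \<phi>" using \<phi> by (rule convex_on_subset) auto
        show "\<forall>z\<in>V c. \<phi> z \<le> q c + 2 * \<eta>"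
        proof
          fix z assume z: "z \<in> V c"
          then have "z \<in> Q c" using V(2) hull_inc by metis
          moreover have "\<bar>\<phi> z - q z\<bar> \<le> \<eta>" using close z c(1) by (auto simp: F_def)
          ultimately show "\<phi> z \<le> q c + 2 * \<eta>" using osc[of z] by linarith
        qed
      qed
      then show ?thesis using y V(2) by simp
    qed
    have x': "2 *\<^sub>R c - x \<in> Q c"
      using c(2) unfolding Q_def mem_box by (force simp: inner_diff_left inner_add_left)
    have "\<phi> c = \<phi> ((1 - 1/2) *\<^sub>R x + (1/2) *\<^sub>R (2 *\<^sub>R c - x))"
      by (simp add: scaleR_diff_right)
    also have "\<dots> \<le> (1 - 1/2) * \<phi> x + (1/2) * \<phi> (2 *\<^sub>R c - x)"
      by (rule convex_onD[OF \<phi>]) auto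
    finally have "2 * \<phi> c - \<phi> (2 *\<^sub>R c - x) \<le> \<phi> x" by simp
    moreover have "\<bar>\<phi> c - q c\<bar> \<le> \<eta>" using close c(1) by (auto simp: F_def)
    ultimately have "q c - 4 * \<eta> \<le> \<phi> x" using upper[OF x'] by linarith
    then show "\<bar>\<phi> x - q x\<bar> \<le> e" using upper[OF c(2)] osc[OF c(2)]
      unfolding \<eta>_def abs_less_iff by (intro abs_leI) linarith+
  qed
  moreover have "finite F" using T(2) V(1) by (simp add: F_def)
  ultimately show ?thesis using that \<eta> by blast
qed

text \<open>Compare the subgradient inequality at \<open>h\<close> with the quadratic form on a step of length \<open>r\<close> in the direction in which
\<open>\<xi>\<close> and \<open>A *v h\<close> differ. The curvature costs \<open>r\<^sup>2\<close> and the approximation error is small compared with \<open>r\<close>, while the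
discrepancy contributes \<open>r * norm (\<xi> - A *v h)\<close>.\<close>

lemma convex_close_to_quadratic_imp_subgradient_close:
  fixes A :: "real^'n::finite^'n"
  assumes sym: "transpose A = A" and e: "0 < e"
  obtains F \<eta> where "finite F" "0 < \<eta>"
    "\<And>\<phi> h \<xi>. convex_on UNIV \<phi> \<Longrightarrow> \<forall>x\<in>F. \<bar>\<phi> x - x \<bullet> (A *v x) / 2\<bar> \<le> \<eta> \<Longrightarrow> norm h \<le> K \<Longrightarrow>
       (\<And>y. \<phi> h + \<xi> \<bullet> (y - h) \<le> \<phi> y) \<Longrightarrow> norm (\<xi> - A *v h) \<le> e"
proof -
  obtain B where B: "0 < B" "\<And>z. norm (A *v z) \<le> norm z * B"
    using bounded_linear.pos_bounded[OF matrix_vector_mul_bounded_linear[of A]] by blast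
  define r where "r = e / (2 * B)"
  have r: "0 < r" using e B by (simp add: r_def)
  define q where "q h = h \<bullet> (A *v h) / 2" for h
  have "continuous_on UNIV q" unfolding q_def divide_inverse
    by (intro continuous_intros matrix_vector_mult_linear_continuous_on)
  then obtain F \<eta> where F: "finite F" "0 < \<eta>"
    "\<And>\<phi>. convex_on UNIV \<phi> \<Longrightarrow> \<forall>x\<in>F. \<bar>\<phi> x - q x\<bar> \<le> \<eta> \<Longrightarrow> \<forall>x\<in>cball 0 (K + r). \<bar>\<phi> x - q x\<bar> \<le> r * e / 4"
    using convex_close_on_finite_set_imp_close_on_ball[of q "r * e / 4"] r e by (metis divide_pos_pos mult_pos_pos zero_less_numeral)
  have "norm (\<xi> - A *v h) \<le> e"
    if \<phi>: "convex_on UNIV \<phi>" and close: "\<forall>x\<in>F. \<bar>\<phi> x - q x\<bar> \<le> \<eta>" and h: "norm h \<le> K"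
      and sub: "\<And>y. \<phi> h + \<xi> \<bullet> (y - h) \<le> \<phi> y" for \<phi> h \<xi>
  proof (cases "\<xi> = A *v h")
    case False
    define u where "u = (1 / norm (\<xi> - A *v h)) *\<^sub>R (\<xi> - A *v h)"
    have u1: "norm u = 1" using False by (simp add: u_def)
    have u2: "u \<bullet> (\<xi> - A *v h) = norm (\<xi> - A *v h)"
      using False by (simp add: u_def dot_square_norm power2_eq_square)
    note uc = F(3)[OF \<phi> close]
    have nr: "norm (h + r *\<^sub>R u) \<le> K + r"
      using norm_triangle_ineq[of h "r *\<^sub>R u"] h r u1 by simp
    have "r * (\<xi> \<bullet> u) \<le> \<phi> (h + r *\<^sub>R u) - \<phi> h" using sub[of "h + r *\<^sub>R u"] by simp
    also have "\<dots> \<le> q (h + r *\<^sub>R u) - q h + r * e / 2"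
    proof -
      have "\<bar>\<phi> (h + r *\<^sub>R u) - q (h + r *\<^sub>R u)\<bar> \<le> r * e / 4" "\<bar>\<phi> h - q h\<bar> \<le> r * e / 4"
        using uc nr h r by auto
      then show ?thesis unfolding abs_le_iff by linarith
    qed
    also have "q (h + r *\<^sub>R u) - q h = r * (u \<bullet> (A *v h)) + r\<^sup>2 * (u \<bullet> (A *v u)) / 2"
    proof -
      have "h \<bullet> (A *v u) = u \<bullet> (A *v h)"
        by (metis dot_lmul_matrix inner_commute sym transpose_matrix_vector)
      then show ?thesis
        by (simp add: q_def matrix_vector_right_distrib matrix_vector_mult_scaleR inner_add_left inner_add_right
             power2_eq_square algebra_simps add_divide_distrib)
    qed
    finally have "r * norm (\<xi> - A *v h) \<le> r\<^sup>2 * (u \<bullet> (A *v u)) / 2 + r * e / 2"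
      by (simp add: u2[symmetric] inner_diff_right right_diff_distrib inner_commute)
    also have "u \<bullet> (A *v u) \<le> B"
      using Cauchy_Schwarz_ineq2[of u "A *v u"] B(2)[of u] u1 by simp
    then have "r\<^sup>2 * (u \<bullet> (A *v u)) / 2 \<le> r\<^sup>2 * B / 2" by (simp add: mult_left_mono)
    also have "r\<^sup>2 * B / 2 = r * e / 4" using B by (simp add: r_def power2_eq_square field_simps)
    finally have "r * norm (\<xi> - A *v h) \<le> r * e" using r e by simp
    then show ?thesis using r by simp
  qed (use e in simp)
  then show ?thesis using that F(1,2) unfolding q_def by blast
qed

text \<open>The convexity argument of M-estimation. Tightness places the random point \<open>H t\<close> in a fixed ball with probability
close to one, and closeness to the quadratic form at finitely many points then controls the subgradients on this ball.\<close>

lemma (in prob_space) vanishing_subgradient_of_convex_process: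
  fixes A :: "real^'n::finite^'n"
  assumes sym: "transpose A = A"
    and convex: "\<And>t \<omega>. convex_on UNIV (\<phi> t \<omega>)"
    and pointwise: "\<And>h. vanishing M (\<lambda>t \<omega>. \<phi> t \<omega> h - h \<bullet> (A *v h) / 2)"
    and bdd: "stochastically_bounded M H"
    and sub: "whp M (\<lambda>t \<omega>. \<forall>y. \<phi> t \<omega> (H t \<omega>) + \<xi> t \<omega> \<bullet> (y - H t \<omega>) \<le> \<phi> t \<omega> y)"
  shows "vanishing M (\<lambda>t \<omega>. \<xi> t \<omega> - A *v H t \<omega>)"
  unfolding vanishing_def
proof (intro allI impI)
  fix \<epsilon> \<eta> :: real assume \<epsilon>: "0 < \<epsilon>" and \<eta>: "0 < \<eta>"
  obtain K where K: "likely M (\<eta>/2) (\<lambda>t \<omega>. norm (H t \<omega>) \<le> K)"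
    using bdd \<eta> unfolding stochastically_bounded_def by (meson half_gt_zero)
  obtain F d where F: "finite F" "0 < d"
    "\<And>\<phi> h \<xi>. convex_on UNIV \<phi> \<Longrightarrow> \<forall>x\<in>F. \<bar>\<phi> x - x \<bullet> (A *v x) / 2\<bar> \<le> d \<Longrightarrow> norm h \<le> K \<Longrightarrow>
       (\<And>y. \<phi> h + \<xi> \<bullet> (y - h) \<le> \<phi> y) \<Longrightarrow> norm (\<xi> - A *v h) \<le> \<epsilon>"
    using convex_close_to_quadratic_imp_subgradient_close[OF sym \<epsilon>, of K] by metis
  have "whp M (\<lambda>t \<omega>. \<forall>x\<in>F. \<bar>\<phi> t \<omega> x - x \<bullet> (A *v x) / 2\<bar> \<le> d)"
    using pointwise F(1,2) by (intro whp_ball_finite) (auto simp: vanishing_iff_whp)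
  from whp_conj[OF this sub] have good: "likely M (\<eta>/2) (\<lambda>t \<omega>. (\<forall>x\<in>F. \<bar>\<phi> t \<omega> x - x \<bullet> (A *v x) / 2\<bar> \<le> d) \<and>
      (\<forall>y. \<phi> t \<omega> (H t \<omega>) + \<xi> t \<omega> \<bullet> (y - H t \<omega>) \<le> \<phi> t \<omega> y))"
    using \<eta> unfolding whp_def by simp
  have "likely M \<eta> (\<lambda>t \<omega>. norm (H t \<omega>) \<le> K \<and> (\<forall>x\<in>F. \<bar>\<phi> t \<omega> x - x \<bullet> (A *v x) / 2\<bar> \<le> d) \<and>
      (\<forall>y. \<phi> t \<omega> (H t \<omega>) + \<xi> t \<omega> \<bullet> (y - H t \<omega>) \<le> \<phi> t \<omega> y))"
    by (rule likely_conj[OF K good]) simp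
  then show "likely M \<eta> (\<lambda>t \<omega>. norm (\<xi> t \<omega> - A *v H t \<omega>) \<le> \<epsilon>)"
    by (rule likely_mono) (blast intro: always_eventually F(3)[OF convex])
qed

section \<open>Second-order calculus of the dual objective\<close>

lemma gradient_eqI:
  assumes "(f has_derivative (\<lambda>h. z \<bullet> h)) (at x)"
  shows "gradient f x = z"
  by (simp add: gradient_def vec_eq_iff frechet_derivative_at[OF assms, symmetric] inner_axis)

lemma differentiable_imp_has_gradient:
  fixes f :: "real^'n::finite \<Rightarrow> real"
  assumes "f differentiable (at x)"
  shows "(f has_derivative (\<lambda>h. gradient f x \<bullet> h)) (at x)"
proof -
  define f' where "f' = frechet_derivative f (at x)"
  have d: "(f has_derivative f') (at x)" using assms by (simp add: f'_def frechet_derivative_works)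
  then interpret f': bounded_linear f' by (rule has_derivative_bounded_linear)
  have "f' h = gradient f x \<bullet> h" for h
  proof -
    have "f' h = f' (\<Sum>i\<in>UNIV. h $ i *\<^sub>R axis i 1)"
      using basis_expansion[of h] by (simp add: scalar_mult_eq_scaleR)
    also have "\<dots> = (\<Sum>i\<in>UNIV. h $ i *\<^sub>R f' (axis i 1))"
      by (simp add: f'.sum f'.scaleR)
    finally show ?thesis by (simp add: gradient_def f'_def inner_vec_def mult.commute)
  qed
  then have "f' = (\<lambda>h. gradient f x \<bullet> h)" by auto
  then show ?thesis using d by simp
qed

lemma hessian_eqI:
  assumes "(gradient f has_derivative (\<lambda>h. A *v h)) (at x)"
  shows "hessian f x = A"
  by (simp add: hessian_def jacobian_def frechet_derivative_at[OF assms, symmetric])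

lemma C2_near_imp_second_derivative:
  fixes f :: "real^'n::finite \<Rightarrow> real"
  assumes "C2_near f x"
  obtains U where "open U" "x \<in> U" "\<And>y. y \<in> U \<Longrightarrow> (f has_derivative (\<lambda>h. gradient f y \<bullet> h)) (at y)"
    "(gradient f has_derivative (\<lambda>h. hessian f x *v h)) (at x)"
proof -
  obtain U where U: "open U" "x \<in> U" "f differentiable_on U" "gradient f differentiable_on U"
    using assms unfolding C2_near_def by blast
  have "gradient f differentiable (at x)"
    using U by (auto simp: differentiable_on_def at_within_open[of x U])
  then have "(gradient f has_derivative (\<lambda>h. hessian f x *v h)) (at x)"
    by (simp add: hessian_def jacobian_works)
  moreover have "(f has_derivative (\<lambda>h. gradient f y \<bullet> h)) (at y)" if "y \<in> U" for y
    using U that by (intro differentiable_imp_has_gradient) (auto simp: differentiable_on_def at_within_open[of y U])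
  ultimately show ?thesis using that U by blast
qed

lemma derivative_along_line:
  fixes f :: "'a::real_normed_vector \<Rightarrow> real"
  assumes "(f has_derivative f') (at (x + r *\<^sub>R k))"
  shows "((\<lambda>r. f (x + r *\<^sub>R k)) has_real_derivative f' k) (at r)"
proof -
  have "((\<lambda>r. f (x + r *\<^sub>R k)) has_derivative (\<lambda>d. f' (d *\<^sub>R k))) (at r)"
    by (rule has_derivative_compose[where f = "\<lambda>r. x + r *\<^sub>R k", OF _ assms]) (auto intro!: derivative_eq_intros)
  moreover have "f' (d *\<^sub>R k) = f' k * d" for d
    using linear_scale[OF has_derivative_linear[OF assms]] by simp
  ultimately show ?thesis by (simp add: has_field_derivative_def)
qed

context
  fixes f :: "real^'n::finite \<Rightarrow> real" and G :: "real^'n \<Rightarrow> real^'n" and A :: "real^'n^'n"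
    and U :: "(real^'n) set" and x :: "real^'n"
  assumes U: "open U" "x \<in> U"
    and f: "\<And>y. y \<in> U \<Longrightarrow> (f has_derivative (\<lambda>h. G y \<bullet> h)) (at y)"
    and G: "(G has_derivative (\<lambda>h. A *v h)) (at x)"
begin

lemma gradient_expansion:
  assumes "0 < e"
  obtains d where "0 < d" "\<And>k. norm k < d \<Longrightarrow> x + k \<in> U \<and> norm (G (x + k) - G x - A *v k) \<le> e * norm k"
proof -
  obtain d1 where d1: "0 < d1" "\<And>y. norm (y - x) < d1 \<Longrightarrow> norm (G y - G x - A *v (y - x)) \<le> e * norm (y - x)"
    using G assms unfolding has_derivative_at_alt by metis
  obtain d2 where d2: "0 < d2" "ball x d2 \<subseteq> U" using U by (meson open_contains_ball)
  show ?thesis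
  proof
    show "0 < min d1 d2" using d1 d2 by simp
    fix k :: "real^'n" assume k: "norm k < min d1 d2"
    have "dist x (x + k) = norm k" unfolding dist_norm by (metis add_diff_cancel_left' norm_minus_commute)
    with k have "x + k \<in> ball x d2" unfolding mem_ball by linarith
    then have "x + k \<in> U" using d2 by blast
    moreover have "norm (x + k - x) < d1" using k by simp
    from d1(2)[OF this] have "norm (G (x + k) - G x - A *v k) \<le> e * norm k" by simp
    ultimately show "x + k \<in> U \<and> norm (G (x + k) - G x - A *v k) \<le> e * norm k" by blast
  qed
qed

text \<open>The mean value theorem along the segment reduces the claim to the first-order expansion of the gradient at \<open>x\<close>.\<close>

lemma second_order_taylor:
  assumes e: "0 < e"
  obtains d where "0 < d"
    "\<And>k. norm k < d \<Longrightarrow> \<bar>f (x + k) - f x - G x \<bullet> k - k \<bullet> (A *v k) / 2\<bar> \<le> e * (norm k)\<^sup>2"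
proof -
  obtain d where d: "0 < d" "\<And>k. norm k < d \<Longrightarrow> x + k \<in> U \<and> norm (G (x + k) - G x - A *v k) \<le> e * norm k"
    using gradient_expansion[OF e] by blast
  have "\<bar>f (x + k) - f x - G x \<bullet> k - k \<bullet> (A *v k) / 2\<bar> \<le> e * (norm k)\<^sup>2" if k: "norm k < d" for k :: "real^'n"
  proof -
    define \<psi> where "\<psi> r = f (x + r *\<^sub>R k) - r * (G x \<bullet> k) - r\<^sup>2 * (k \<bullet> (A *v k)) / 2" for r
    have small: "norm (r *\<^sub>R k) < d" if "0 \<le> r" "r \<le> 1" for r
      using that k mult_left_le_one_le[of "norm k" r] by simp
    have "(\<psi> has_real_derivative (G (x + r *\<^sub>R k) - G x - r *\<^sub>R (A *v k)) \<bullet> k) (at r)"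
      if "0 \<le> r" "r \<le> 1" for r
    proof -
      have "((\<lambda>r. f (x + r *\<^sub>R k)) has_real_derivative G (x + r *\<^sub>R k) \<bullet> k) (at r)"
        by (intro derivative_along_line f) (use d(2)[OF small[OF that]] in blast)
      moreover have "((\<lambda>r. r * (G x \<bullet> k)) has_real_derivative G x \<bullet> k) (at r)"
        "((\<lambda>r. r\<^sup>2 * (k \<bullet> (A *v k)) / 2) has_real_derivative r * (k \<bullet> (A *v k))) (at r)"
        by (auto intro!: derivative_eq_intros)
      ultimately have "(\<psi> has_real_derivative G (x + r *\<^sub>R k) \<bullet> k - G x \<bullet> k - r * (k \<bullet> (A *v k))) (at r)"
        unfolding \<psi>_def by (intro DERIV_diff)
      then show ?thesis by (simp only: inner_diff_left inner_scaleR_left inner_commute[of "A *v k" k])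
    qed
    from MVT2[of 0 1 \<psi>, OF _ this] obtain r where r: "0 < r" "r < 1"
        "\<psi> 1 - \<psi> 0 = (G (x + r *\<^sub>R k) - G x - r *\<^sub>R (A *v k)) \<bullet> k" by auto
    have "\<bar>\<psi> 1 - \<psi> 0\<bar> \<le> norm (G (x + r *\<^sub>R k) - G x - A *v (r *\<^sub>R k)) * norm k"
      unfolding r(3) matrix_vector_mult_scaleR by (rule Cauchy_Schwarz_ineq2)
    also have "\<dots> \<le> e * norm (r *\<^sub>R k) * norm k"
      using r d(2)[OF small[of r]] by (intro mult_right_mono) auto
    also have "\<dots> \<le> e * norm k * norm k"
      using r e by (intro mult_right_mono mult_left_mono) (auto simp: mult_left_le_one_le)
    finally show ?thesis by (simp add: \<psi>_def power2_eq_square algebra_simps)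
  qed
  then show ?thesis using that d(1) by blast
qed

text \<open>The second difference \<open>\<Delta>\<close> is symmetric in its two increments, and the mean value theorem in the first increment shows
that it is approximated by \<open>s\<^sup>2 * ((A *v v) \<bullet> u)\<close> for increments of size \<open>s\<close>.\<close>

lemma second_derivative_symmetric: "transpose A = A"
proof -
  define \<Delta> where "\<Delta> u v = f (x + u + v) - f (x + u) - f (x + v) + f x" for u v
  have key: "\<bar>\<Delta> (s *\<^sub>R u) (s *\<^sub>R v) - s\<^sup>2 * ((A *v v) \<bullet> u)\<bar> \<le> s\<^sup>2 * e * (2 * (norm u + norm v)\<^sup>2)"
    if s: "0 < s" "s * (norm u + norm v) < d"
      and d: "\<And>k :: real^'n. norm k < d \<Longrightarrow> x + k \<in> U \<and> norm (G (x + k) - G x - A *v k) \<le> e * norm k"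
      and e: "0 < e" for s e d :: real and u v
  proof -
    define \<psi> where "\<psi> r = f ((x + s *\<^sub>R v) + r *\<^sub>R (s *\<^sub>R u)) - f (x + r *\<^sub>R (s *\<^sub>R u))" for r
    define n where "n = norm u + norm v"
    have n1: "norm (s *\<^sub>R v + r *\<^sub>R (s *\<^sub>R u)) \<le> s * n" and n2: "norm (r *\<^sub>R (s *\<^sub>R u)) \<le> s * n"
      if "0 \<le> r" "r \<le> 1" for r
    proof -
      have "r * (s * norm u) \<le> s * norm u" using that s by (simp add: mult_left_le_one_le)
      then show "norm (r *\<^sub>R (s *\<^sub>R u)) \<le> s * n" using that s by (simp add: n_def distrib_left add_increasing2)
      show "norm (s *\<^sub>R v + r *\<^sub>R (s *\<^sub>R u)) \<le> s * n"
        using \<open>r * (s * norm u) \<le> s * norm u\<close> that s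
        by (intro norm_triangle_le) (simp add: n_def distrib_left)
    qed
    have inU: "x + s *\<^sub>R v + r *\<^sub>R s *\<^sub>R u \<in> U" "x + r *\<^sub>R s *\<^sub>R u \<in> U" if "0 \<le> r" "r \<le> 1" for r
      using d[of "s *\<^sub>R v + r *\<^sub>R (s *\<^sub>R u)"] d[of "r *\<^sub>R (s *\<^sub>R u)"] n1[OF that] n2[OF that] s
      by (auto simp: n_def add.assoc)
    have "(\<psi> has_real_derivative (G (x + s *\<^sub>R v + r *\<^sub>R s *\<^sub>R u) - G (x + r *\<^sub>R s *\<^sub>R u)) \<bullet> (s *\<^sub>R u)) (at r)"
      if "0 \<le> r" "r \<le> 1" for r
      unfolding \<psi>_def inner_diff_left
      by (intro DERIV_diff derivative_along_line f inU that)
    from MVT2[of 0 1 \<psi>, OF _ this] obtain r where r: "0 < r" "r < 1"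
        "\<psi> 1 - \<psi> 0 = (G (x + s *\<^sub>R v + r *\<^sub>R s *\<^sub>R u) - G (x + r *\<^sub>R s *\<^sub>R u)) \<bullet> (s *\<^sub>R u)" by auto
    define k1 k2 where "k1 = s *\<^sub>R v + r *\<^sub>R (s *\<^sub>R u)" and "k2 = r *\<^sub>R (s *\<^sub>R u)"
    have \<Delta>: "\<Delta> (s *\<^sub>R u) (s *\<^sub>R v) = \<psi> 1 - \<psi> 0" by (simp add: \<Delta>_def \<psi>_def algebra_simps)
    have "\<Delta> (s *\<^sub>R u) (s *\<^sub>R v) - s\<^sup>2 * ((A *v v) \<bullet> u)
        = ((G (x + k1) - G x - A *v k1) - (G (x + k2) - G x - A *v k2)) \<bullet> (s *\<^sub>R u)"
      unfolding \<Delta> r(3)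
      by (simp add: k1_def k2_def matrix_vector_right_distrib matrix_vector_mult_scaleR power2_eq_square
            inner_diff_left algebra_simps)
    also have "\<bar>\<dots>\<bar> \<le> norm ((G (x + k1) - G x - A *v k1) - (G (x + k2) - G x - A *v k2)) * norm (s *\<^sub>R u)"
      by (rule Cauchy_Schwarz_ineq2)
    also have "\<dots> \<le> (e * (s * n) + e * (s * n)) * (s * n)"
    proof (rule mult_mono)
      have k: "norm k1 \<le> s * n" "norm k2 \<le> s * n"
        using n1[of r] n2[of r] r unfolding k1_def k2_def by simp_all
      then have "norm k1 < d" "norm k2 < d" using s(2) unfolding n_def by linarith+
      then have "norm (G (x + k1) - G x - A *v k1) \<le> e * norm k1" "norm (G (x + k2) - G x - A *v k2) \<le> e * norm k2"
        using d by blast+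
      moreover have "e * norm k1 \<le> e * (s * n)" "e * norm k2 \<le> e * (s * n)"
        using k e by (auto intro: mult_left_mono)
      ultimately show "norm ((G (x + k1) - G x - A *v k1) - (G (x + k2) - G x - A *v k2)) \<le> e * (s * n) + e * (s * n)"
        using norm_triangle_ineq4[of "G (x + k1) - G x - A *v k1" "G (x + k2) - G x - A *v k2"] by linarith
    qed (use s e in \<open>auto simp: n_def\<close>)
    also have "\<dots> = s\<^sup>2 * e * (2 * n\<^sup>2)" by (simp add: power2_eq_square)
    finally show ?thesis by (simp add: n_def)
  qed
  have "(A *v v) \<bullet> u = (A *v u) \<bullet> v" for u v
  proof (rule ccontr)
    assume ne: "(A *v v) \<bullet> u \<noteq> (A *v u) \<bullet> v"
    define n where "n = norm u + norm v"
    have n0: "0 < n" using ne by (cases "u = 0") (auto simp: n_def add_pos_nonneg)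
    \<comment> \<open>the two approximation errors then add up to half of the supposed difference\<close>
    define e where "e = \<bar>(A *v v) \<bullet> u - (A *v u) \<bullet> v\<bar> / (8 * n\<^sup>2)"
    have e: "0 < e" using ne n0 by (simp add: e_def)
    obtain d where d: "0 < d" "\<And>k. norm k < d \<Longrightarrow> x + k \<in> U \<and> norm (G (x + k) - G x - A *v k) \<le> e * norm k"
      using gradient_expansion[OF e] by metis
    define s where "s = d / (2 * n)"
    have s: "0 < s" "s * n < d" using d n0 by (simp_all add: s_def)
    have "\<Delta> (s *\<^sub>R v) (s *\<^sub>R u) = \<Delta> (s *\<^sub>R u) (s *\<^sub>R v)" by (simp add: \<Delta>_def add_ac)
    then have "\<bar>s\<^sup>2 * ((A *v v) \<bullet> u) - s\<^sup>2 * ((A *v u) \<bullet> v)\<bar> \<le> 2 * (s\<^sup>2 * e * (2 * n\<^sup>2))"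
    proof -
      have "norm v + norm u = n" by (simp add: n_def)
      then have "\<bar>\<Delta> (s *\<^sub>R u) (s *\<^sub>R v) - s\<^sup>2 * ((A *v v) \<bullet> u)\<bar> \<le> s\<^sup>2 * e * (2 * n\<^sup>2)"
         "\<bar>\<Delta> (s *\<^sub>R v) (s *\<^sub>R u) - s\<^sup>2 * ((A *v u) \<bullet> v)\<bar> \<le> s\<^sup>2 * e * (2 * n\<^sup>2)"
        using key[OF s(1) _ d(2) e, of u v] key[OF s(1) _ d(2) e, of v u] s(2) n_def by metis+
      then show ?thesis using \<open>\<Delta> (s *\<^sub>R v) (s *\<^sub>R u) = \<Delta> (s *\<^sub>R u) (s *\<^sub>R v)\<close> by linarith
    qed
    also have "\<bar>s\<^sup>2 * ((A *v v) \<bullet> u) - s\<^sup>2 * ((A *v u) \<bullet> v)\<bar> = s\<^sup>2 * \<bar>(A *v v) \<bullet> u - (A *v u) \<bullet> v\<bar>"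
      by (simp add: right_diff_distrib[symmetric] abs_mult)
    also have "2 * (s\<^sup>2 * e * (2 * n\<^sup>2)) = s\<^sup>2 * (\<bar>(A *v v) \<bullet> u - (A *v u) \<bullet> v\<bar> / 2)"
      using n0 by (simp add: e_def)
    finally show False using s ne by simp
  qed
  from this[of "axis i 1" "axis j 1" for i j] show ?thesis
    by (simp add: vec_eq_iff transpose_def matrix_vector_mult_basis column_def inner_axis)
qed

text \<open>The expected local objective: at scale \<open>1 / sqrt t\<close>, the first-order remainder times \<open>t\<close> tends to the quadratic
form of the Hessian.\<close>

lemma scaled_remainder_tendsto:
  "(\<lambda>t. real t * (f (x + (1 / sqrt (real t)) *\<^sub>R h) - f x - G x \<bullet> ((1 / sqrt (real t)) *\<^sub>R h)))
     \<longlonglongrightarrow> h \<bullet> (A *v h) / 2"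
proof (rule LIMSEQ_I)
  fix r :: real assume r: "0 < r"
  define e where "e = r / (2 * ((norm h)\<^sup>2 + 1))"
  have n1: "0 < (norm h)\<^sup>2 + 1" by (simp add: add_nonneg_pos)
  have e: "0 < e" using r n1 by (simp add: e_def)
  have eh: "e * (norm h)\<^sup>2 < r"
  proof -
    have "e * (norm h)\<^sup>2 \<le> e * ((norm h)\<^sup>2 + 1)" using e by simp
    also have "\<dots> = r / 2" using n1 unfolding e_def by (metis less_numeral_extra(3) mult.commute nonzero_mult_divide_mult_cancel_right2 times_divide_eq_left)
    finally show ?thesis using r by simp
  qed
  obtain d where d: "0 < d"
    "\<And>k. norm k < d \<Longrightarrow> \<bar>f (x + k) - f x - G x \<bullet> k - k \<bullet> (A *v k) / 2\<bar> \<le> e * (norm k)\<^sup>2"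
    using second_order_taylor[OF e] by metis
  have "(\<lambda>t. norm h / sqrt (real t)) \<longlonglongrightarrow> 0"
    using tendsto_mult_right_zero[OF inverse_sqrt_tendsto, of "norm h"] by simp
  then have "\<forall>\<^sub>F t in sequentially. norm h / sqrt (real t) < d" using d(1) by (rule order_tendstoD)
  then have "\<forall>\<^sub>F t in sequentially. norm (real t * (f (x + (1 / sqrt (real t)) *\<^sub>R h) - f x - G x \<bullet> ((1 / sqrt (real t)) *\<^sub>R h)) - h \<bullet> (A *v h) / 2) < r"
    using eventually_gt_at_top[of 0]
  proof eventually_elim
    case (elim t)
    define k where "k = (1 / sqrt (real t)) *\<^sub>R h"
    have kk: "k \<bullet> (A *v k) = h \<bullet> (A *v h) / real t" "(norm k)\<^sup>2 = (norm h)\<^sup>2 / real t"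
      using elim by (simp_all add: k_def matrix_vector_mult_scaleR power_divide)
    have "\<bar>f (x + k) - f x - G x \<bullet> k - k \<bullet> (A *v k) / 2\<bar> \<le> e * (norm k)\<^sup>2"
      using elim by (intro d(2)) (simp add: k_def)
    then have "real t * \<bar>f (x + k) - f x - G x \<bullet> k - k \<bullet> (A *v k) / 2\<bar> \<le> real t * (e * (norm k)\<^sup>2)"
      by (intro mult_left_mono) auto
    also have "\<dots> = e * (norm h)\<^sup>2" using elim by (simp add: kk)
    also have "real t * \<bar>f (x + k) - f x - G x \<bullet> k - k \<bullet> (A *v k) / 2\<bar>
        = \<bar>real t * (f (x + k) - f x - G x \<bullet> k - k \<bullet> (A *v k) / 2)\<bar>" by (simp add: abs_mult)
    also have "real t * (f (x + k) - f x - G x \<bullet> k - k \<bullet> (A *v k) / 2)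
        = real t * (f (x + k) - f x - G x \<bullet> k) - h \<bullet> (A *v h) / 2"
      using elim unfolding kk by (simp add: right_diff_distrib)
    finally show ?case using eh unfolding k_def real_norm_def by linarith
  qed
  then show "\<exists>no. \<forall>t\<ge>no. norm (real t * (f (x + (1 / sqrt (real t)) *\<^sub>R h) - f x - G x \<bullet> ((1 / sqrt (real t)) *\<^sub>R h)) - h \<bullet> (A *v h) / 2) < r"
    by (simp add: eventually_sequentially)
qed

lemma hessian_minus_log_barrier:
  assumes pos: "\<And>i. 0 < x $ i"
  shows "hessian (\<lambda>y. f y - (\<Sum>i\<in>UNIV. b $ i * ln (y $ i))) x = A + diag (\<lambda>i. b $ i / (x $ i)\<^sup>2)"
proof (rule hessian_eqI)
  let ?F = "\<lambda>y. f y - (\<Sum>i\<in>UNIV. b $ i * ln (y $ i))"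
  define V where "V = U \<inter> (\<Inter>i\<in>UNIV. {y. 0 < y $ i})"
  have oV: "open V" unfolding V_def using U by (intro open_Int open_INT) (auto intro!: open_Collect_less continuous_intros)
  have xV: "x \<in> V" using U pos by (auto simp: V_def)
  have grad: "gradient ?F y = G y - (\<chi> i. b $ i / y $ i)" if y: "y \<in> V" for y
  proof (rule gradient_eqI)
    have "(?F has_derivative (\<lambda>h. G y \<bullet> h - (\<Sum>i\<in>UNIV. b $ i * (h $ i * inverse (y $ i))))) (at y)"
      using y by (auto intro!: has_derivative_diff f has_derivative_sum has_derivative_mult_right has_derivative_ln
          bounded_linear.has_derivative[OF bounded_linear_vec_nth] simp: V_def)
    moreover have "G y \<bullet> h - (\<Sum>i\<in>UNIV. b $ i * (h $ i * inverse (y $ i))) = (G y - (\<chi> i. b $ i / y $ i)) \<bullet> h" for h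
      by (simp add: inner_diff_left) (simp add: inner_vec_def divide_inverse mult_ac)
    ultimately show "(?F has_derivative (\<lambda>h. (G y - (\<chi> i. b $ i / y $ i)) \<bullet> h)) (at y)"
      by simp
  qed
  have D: "((\<lambda>y. \<chi> i. b $ i / y $ i) has_derivative (\<lambda>h. - (diag (\<lambda>i. b $ i / (x $ i)\<^sup>2) *v h))) (at x)"
  proof (rule has_derivative_componentwise_within[THEN iffD2], rule ballI)
    fix e :: "real^'n" assume "e \<in> Basis"
    then obtain i where e: "e = axis i 1" unfolding Basis_vec_def Basis_real_def by blast
    have "((\<lambda>y. b $ i / y $ i) has_derivative (\<lambda>h. - (b $ i / (x $ i)\<^sup>2 * h $ i))) (at x)"
    proof -
      have "((\<lambda>z. b $ i / z) has_real_derivative - (b $ i / (x $ i)\<^sup>2)) (at (x $ i))"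
        using pos[of i] by (auto intro!: derivative_eq_intros simp: power2_eq_square)
      then have "((\<lambda>z. b $ i / z) has_derivative (\<lambda>d. - (b $ i / (x $ i)\<^sup>2) * d)) (at (x $ i))"
        by (simp only: has_field_derivative_def)
      from has_derivative_compose[OF bounded_linear.has_derivative[OF bounded_linear_vec_nth has_derivative_ident] this]
      show ?thesis by simp
    qed
    then show "((\<lambda>y. (\<chi> i. b $ i / y $ i) \<bullet> e) has_derivative (\<lambda>h. - (diag (\<lambda>i. b $ i / (x $ i)\<^sup>2) *v h) \<bullet> e)) (at x)"
      by (simp add: e inner_axis diag_vec)
  qed
  have "((\<lambda>y. G y - (\<chi> i. b $ i / y $ i)) has_derivative (\<lambda>h. (A + diag (\<lambda>i. b $ i / (x $ i)\<^sup>2)) *v h)) (at x)"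
    using has_derivative_diff[OF G D] by (simp add: matrix_vector_mult_add_rdistrib)
  then show "(gradient ?F has_derivative (\<lambda>h. (A + diag (\<lambda>i. b $ i / (x $ i)\<^sup>2)) *v h)) (at x)"
    by (rule has_derivative_transform_within_open[OF _ oV xV]) (simp add: grad)
qed

end

section \<open>Pacing equilibria as first-order conditions\<close>

lemma max_bid_ge: "\<beta> $ i * v i \<theta> \<le> max_bid v \<beta> \<theta>"
  unfolding max_bid_def by (rule Max_ge) auto

lemma max_bid_attained: "\<exists>i. max_bid v \<beta> \<theta> = \<beta> $ i * v i \<theta>"
proof -
  have "max_bid v \<beta> \<theta> \<in> range (\<lambda>i. \<beta> $ i * v i \<theta>)"
    unfolding max_bid_def by (rule Max_in) auto
  then show ?thesis by blast
qed

lemma borel_measurable_max_bid [measurable]: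
  assumes "\<And>i. v i \<in> borel_measurable M"
  shows "max_bid v \<beta> \<in> borel_measurable M"
  unfolding max_bid_def[abs_def] by (intro borel_measurable_Max borel_measurable_times assms) auto

lemma convex_max_bid:
  fixes v :: "'n::finite \<Rightarrow> 'b \<Rightarrow> real"
  shows "convex_on UNIV (\<lambda>\<beta>. max_bid v \<beta> \<theta>)"
proof (rule convex_onI)
  fix t :: real and \<beta> \<beta>' :: "real^'n"
  assume t: "0 < t" "t < 1"
  obtain i where i: "max_bid v ((1 - t) *\<^sub>R \<beta> + t *\<^sub>R \<beta>') \<theta> = ((1 - t) *\<^sub>R \<beta> + t *\<^sub>R \<beta>') $ i * v i \<theta>"
    using max_bid_attained[of v _ \<theta>] by blast
  also have "\<dots> = (1 - t) * (\<beta> $ i * v i \<theta>) + t * (\<beta>' $ i * v i \<theta>)" by (simp add: algebra_simps)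
  also have "\<dots> \<le> (1 - t) * max_bid v \<beta> \<theta> + t * max_bid v \<beta>' \<theta>"
    using t by (intro add_mono mult_left_mono max_bid_ge) auto
  finally show "max_bid v ((1 - t) *\<^sub>R \<beta> + t *\<^sub>R \<beta>') \<theta> \<le> (1 - t) * max_bid v \<beta> \<theta> + t * max_bid v \<beta>' \<theta>" .
qed auto

lemma max_bid_Lipschitz:
  assumes v: "\<And>i. \<bar>v i \<theta>\<bar> \<le> C"
  shows "\<bar>max_bid v \<beta>' \<theta> - max_bid v \<beta> \<theta>\<bar> \<le> C * (\<Sum>i\<in>UNIV. \<bar>\<beta>' $ i - \<beta> $ i\<bar>)"
proof -
  have "max_bid v \<beta>' \<theta> \<le> max_bid v \<beta> \<theta> + C * (\<Sum>i\<in>UNIV. \<bar>\<beta>' $ i - \<beta> $ i\<bar>)" for \<beta> \<beta>'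
  proof -
    obtain i where i: "max_bid v \<beta>' \<theta> = \<beta>' $ i * v i \<theta>" using max_bid_attained[of v \<beta>' \<theta>] by blast
    have "(\<beta>' $ i - \<beta> $ i) * v i \<theta> \<le> \<bar>\<beta>' $ i - \<beta> $ i\<bar> * \<bar>v i \<theta>\<bar>"
      by (metis abs_ge_self abs_mult)
    also have "\<dots> \<le> (\<Sum>i\<in>UNIV. \<bar>\<beta>' $ i - \<beta> $ i\<bar>) * C"
      by (intro mult_mono v member_le_sum sum_nonneg) auto
    finally show ?thesis using max_bid_ge[of \<beta> i v \<theta>] unfolding i by (simp add: algebra_simps)
  qed
  from this[of \<beta>' \<beta>] this[of \<beta> \<beta>'] show ?thesis by (simp add: abs_minus_commute abs_le_iff)
qed

text \<open>Only winning buyers receive a share of the item, and the shares sum to one when the price is positive, so the item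
values are a convex combination of gradients of maximisers. If the price is zero, all values are zero.\<close>

lemma max_bid_subgradient:
  fixes \<beta> \<beta>' :: "real^'n::finite"
  assumes \<beta>: "\<And>i. 0 < \<beta> $ i" and v: "\<And>i. 0 \<le> v i \<theta>" and x: "\<And>i. 0 \<le> x i"
    and win: "\<And>i. 0 < x i \<Longrightarrow> \<beta> $ i * v i \<theta> = max_bid v \<beta> \<theta>"
    and sold: "0 < max_bid v \<beta> \<theta> \<Longrightarrow> (\<Sum>i\<in>UNIV. x i) = 1"
  shows "max_bid v \<beta> \<theta> + (\<chi> i. x i * v i \<theta>) \<bullet> (\<beta>' - \<beta>) \<le> max_bid v \<beta>' \<theta>"
proof (cases "0 < max_bid v \<beta> \<theta>")
  case True
  have "(\<chi> i. x i * v i \<theta>) \<bullet> \<beta> = (\<Sum>i\<in>UNIV. x i * max_bid v \<beta> \<theta>)"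
    unfolding inner_vec_def
  proof (intro sum.cong refl)
    fix i show "(\<chi> i. x i * v i \<theta>) $ i \<bullet> \<beta> $ i = x i * max_bid v \<beta> \<theta>"
      using win[of i] x[of i] by (cases "x i = 0") (auto simp: mult_ac)
  qed
  also have "\<dots> = max_bid v \<beta> \<theta>" using sold[OF True] by (simp add: sum_distrib_right[symmetric])
  finally have 1: "(\<chi> i. x i * v i \<theta>) \<bullet> \<beta> = max_bid v \<beta> \<theta>" .
  have "(\<chi> i. x i * v i \<theta>) \<bullet> \<beta>' = (\<Sum>i\<in>UNIV. x i * (\<beta>' $ i * v i \<theta>))"
    by (simp add: inner_vec_def mult_ac)
  also have "\<dots> \<le> (\<Sum>i\<in>UNIV. x i * max_bid v \<beta>' \<theta>)"
    by (intro sum_mono mult_left_mono max_bid_ge x)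
  also have "\<dots> = max_bid v \<beta>' \<theta>" using sold[OF True] by (simp add: sum_distrib_right[symmetric])
  finally show ?thesis using 1 by (simp add: inner_diff_right)
next
  case False
  have v0: "v i \<theta> = 0" for i
  proof (rule ccontr)
    assume "v i \<theta> \<noteq> 0"
    then have "0 < \<beta> $ i * v i \<theta>" using \<beta>[of i] v[of i] by simp
    then show False using max_bid_ge[of \<beta> i v \<theta>] False by linarith
  qed
  then show ?thesis by (simp add: max_bid_def inner_vec_def)
qed

lemma pacing_utility_identity:
  fixes b \<beta> \<mu> \<delta> :: real
  assumes "0 < \<beta>" "\<delta> = b - \<beta> * \<mu>" "0 \<le> \<delta>" "0 < \<delta> \<Longrightarrow> \<beta> = 1"
  shows "\<mu> + \<delta> = b / \<beta>"
  using assms by (cases "\<delta> = 0") (auto simp: field_simps)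

text \<open>Here \<open>\<mu> = b / \<beta> - \<delta>\<close>. The barrier term \<open>b / \<beta>\<close> is strongly decreasing on \<open>(0,1]\<close>. The multipliers have the
favourable sign: a positive leftover budget forces its pacing multiplier to be \<open>1\<close>, the largest possible value.\<close>

lemma pacing_strongly_monotone:
  fixes b \<beta> \<beta>' \<mu> \<mu>' \<delta> \<delta>' :: real
  assumes b: "0 < b" and \<beta>: "0 < \<beta>" "\<beta> \<le> 1" and \<beta>': "0 < \<beta>'" "\<beta>' \<le> 1"
    and \<delta>: "\<delta> = b - \<beta> * \<mu>" "0 \<le> \<delta>" "0 < \<delta> \<Longrightarrow> \<beta> = 1"
    and \<delta>': "\<delta>' = b - \<beta>' * \<mu>'" "0 \<le> \<delta>'" "0 < \<delta>' \<Longrightarrow> \<beta>' = 1"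
  shows "(\<mu>' - \<mu>) * (\<beta>' - \<beta>) \<le> - b * (\<beta>' - \<beta>)\<^sup>2"
proof -
  have \<mu>: "\<mu> = b / \<beta> - \<delta>" "\<mu>' = b / \<beta>' - \<delta>'"
    using pacing_utility_identity[OF \<beta>(1) \<delta>] pacing_utility_identity[OF \<beta>'(1) \<delta>'] by linarith+
  have 1: "\<delta> * (\<beta>' - \<beta>) \<le> 0" using \<delta>(2,3) \<beta>' by (cases "\<delta> = 0") (auto simp: mult_nonneg_nonpos)
  have 2: "0 \<le> \<delta>' * (\<beta>' - \<beta>)" using \<delta>'(2,3) \<beta> by (cases "\<delta>' = 0") auto
  have "(b / \<beta>' - b / \<beta>) * (\<beta>' - \<beta>) = - (b * (\<beta>' - \<beta>)\<^sup>2) / (\<beta> * \<beta>')"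
    using \<beta> \<beta>' by (simp add: power2_eq_square field_simps)
  also have "\<dots> \<le> - (b * (\<beta>' - \<beta>)\<^sup>2)"
  proof -
    have "\<beta> * \<beta>' \<le> 1" "0 < \<beta> * \<beta>'" using \<beta> \<beta>' by (auto intro: mult_le_one)
    then have "b * (\<beta>' - \<beta>)\<^sup>2 * (\<beta> * \<beta>') \<le> b * (\<beta>' - \<beta>)\<^sup>2"
      using b by (simp add: mult_left_le)
    then show ?thesis using \<open>0 < \<beta> * \<beta>'\<close> by (simp add: pos_le_divide_eq)
  qed
  finally show ?thesis using 1 2 unfolding \<mu> by (simp add: algebra_simps)
qed

lemma AE_density_of_AE:
  assumes "f \<in> borel_measurable M" "AE \<theta> in M. Q \<theta>"
  shows "AE \<theta> in density M f. Q \<theta>"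
  using assms(2) by (subst AE_density[OF assms(1)]) auto

text \<open>In this locale \<open>D\<close> is the law of a sampled item, \<open>\<mu>\<close> and \<open>\<delta>\<close> are the item utilities and leftover budgets of the
limit equilibrium, and \<open>F\<close> is the expected maximal bid.\<close>

locale limit_equilibrium =
  fixes M :: "'b measure" and b :: "real^'n::finite" and v :: "'n \<Rightarrow> 'b \<Rightarrow> real" and s :: "'b \<Rightarrow> real"
    and \<beta> :: "real^'n" and p :: "'b \<Rightarrow> real" and x :: "'n \<Rightarrow> 'b \<Rightarrow> real"
  assumes market: "market M b v s" and limit: "is_FPPE M b v s \<beta> p x"
begin

definition D :: "'b measure" where "D = density M (\<lambda>\<theta>. ennreal (s \<theta>))"

definition \<mu> :: "real^'n" where "\<mu> = (\<chi> i. \<integral>\<theta>. item_values v x \<theta> $ i \<partial>D)"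

definition \<delta> :: "real^'n" where "\<delta> = leftover M b s p x"

abbreviation F :: "real^'n \<Rightarrow> real" where "F \<equiv> \<lambda>\<beta>'. expec M s (max_bid v \<beta>')"

lemma b_pos: "0 < b $ i" using market by (simp add: market_def)

lemma v_measurable [measurable]: "v i \<in> borel_measurable M"
  using market by (auto simp: market_def L1_plus_def)

lemma s_measurable [measurable]: "s \<in> borel_measurable M"
  using market by (simp add: market_def Linf_plus_def)

lemma s_nonneg: "AE \<theta> in M. 0 \<le> s \<theta>"
  using market by (simp add: market_def Linf_plus_def)

lemma x_measurable [measurable]: "x i \<in> borel_measurable M"
  using limit by (simp add: is_FPPE_def Linf_plus_def)

lemma p_measurable [measurable]: "p \<in> borel_measurable M"
  using limit by (auto simp: is_FPPE_def L1_plus_def)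

lemma sets_D [measurable_cong]: "sets D = sets M" by (simp add: D_def)

lemma item_values_measurable [measurable]: "item_values v x \<in> borel_measurable M"
proof -
  have "(\<lambda>\<theta>. x i \<theta> * v i \<theta>) \<in> borel_measurable M" for i by measurable
  then show ?thesis
    by (intro borel_measurable_vecI) (simp add: item_values_def)
qed

lemma D_AE: "(AE \<theta> in M. Q \<theta>) \<Longrightarrow> AE \<theta> in D. Q \<theta>"
  unfolding D_def by (rule AE_density_of_AE) auto

lemma integral_D: "f \<in> borel_measurable M \<Longrightarrow> (\<integral>\<theta>. f \<theta> \<partial>D) = (\<integral>\<theta>. s \<theta> * f \<theta> \<partial>M)"
  unfolding D_def by (subst integral_density) (auto simp: s_nonneg)

lemma expec_eq_integral: "f \<in> borel_measurable M \<Longrightarrow> expec M s f = (\<integral>\<theta>. f \<theta> \<partial>D)"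
  by (simp add: expec_def integral_D mult.commute)

lemma \<beta>_le_1: "\<beta> $ i \<le> 1" and \<beta>_nonneg: "0 \<le> \<beta> $ i"
  using limit by (auto simp: is_FPPE_def)

lemma payment_eq: "(\<integral>\<theta>. x i \<theta> * p \<theta> * s \<theta> \<partial>M) = \<beta> $ i * \<mu> $ i"
proof -
  have "AE \<theta> in M. p \<theta> = max_bid v \<beta> \<theta>" "AE \<theta> in M. 0 < x i \<theta> \<longrightarrow> \<beta> $ i * v i \<theta> = max_bid v \<beta> \<theta>"
    "AE \<theta> in M. 0 \<le> x i \<theta>" using limit by (auto simp: is_FPPE_def Linf_plus_def)
  then have "AE \<theta> in M. x i \<theta> * p \<theta> * s \<theta> = \<beta> $ i * (s \<theta> * (x i \<theta> * v i \<theta>))"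
  proof eventually_elim
    case (elim \<theta>)
    then show ?case by (cases "x i \<theta> = 0") (auto simp: mult_ac)
  qed
  then have "(\<integral>\<theta>. x i \<theta> * p \<theta> * s \<theta> \<partial>M) = (\<integral>\<theta>. \<beta> $ i * (s \<theta> * (x i \<theta> * v i \<theta>)) \<partial>M)"
    by (intro integral_cong_AE) auto
  also have "\<dots> = \<beta> $ i * \<mu> $ i" by (simp add: \<mu>_def item_values_def integral_D)
  finally show ?thesis .
qed

lemma \<delta>_eq: "\<delta> $ i = b $ i - \<beta> $ i * \<mu> $ i"
  unfolding payment_eq[symmetric] by (simp add: \<delta>_def leftover_def mult_ac)

lemma \<delta>_nonneg: "0 \<le> \<delta> $ i" and \<delta>_pos_imp: "0 < \<delta> $ i \<Longrightarrow> \<beta> $ i = 1"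
  using limit by (auto simp: is_FPPE_def \<delta>_eq payment_eq)

text \<open>A buyer with zero multiplier pays nothing, hence has budget left, hence has multiplier \<open>1\<close>.\<close>

lemma \<beta>_pos: "0 < \<beta> $ i"
  using \<beta>_nonneg[of i] \<delta>_pos_imp[of i] b_pos[of i] by (cases "\<beta> $ i = 0") (auto simp: \<delta>_eq)

lemma item_utility_eq: "item_utility M v s x = \<mu>"
  by (simp add: item_utility_def \<mu>_def item_values_def integral_D mult_ac)

lemma utility_eq: "utility M b v s p x $ i = b $ i / \<beta> $ i"
  using pacing_utility_identity[OF \<beta>_pos \<delta>_eq \<delta>_nonneg \<delta>_pos_imp]
  by (simp add: utility_def item_utility_eq \<delta>_def)

lemma values_bounded:
  obtains C where "0 \<le> C" "\<And>i. AE \<theta> in M. 0 \<le> v i \<theta> \<and> v i \<theta> \<le> C"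
proof -
  obtain C where C: "\<And>i. AE \<theta> in M. v i \<theta> \<le> C" using market by (auto simp: market_def)
  have v0: "AE \<theta> in M. 0 \<le> v i \<theta>" for i using market by (auto simp: market_def L1_plus_def)
  have "AE \<theta> in M. 0 \<le> v i \<theta> \<and> v i \<theta> \<le> \<bar>C\<bar>" for i
    using C[of i] v0[of i] by eventually_elim auto
  then show ?thesis using that[of "\<bar>C\<bar>"] by simp
qed

text \<open>The item values of the limit allocation are a measurable selection of subgradients of the maximal bid at \<open>\<beta>\<close>. This
selection is the influence function of the sample.\<close>

lemma item_values_subgradient:
  "AE \<theta> in M. \<forall>\<beta>'. max_bid v \<beta> \<theta> + item_values v x \<theta> \<bullet> (\<beta>' - \<beta>) \<le> max_bid v \<beta>' \<theta>"
proof -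
  have "AE \<theta> in M. \<forall>i\<in>UNIV. 0 \<le> v i \<theta>"
    using market by (intro AE_finite_allI) (auto simp: market_def L1_plus_def)
  moreover have "AE \<theta> in M. \<forall>i\<in>UNIV. 0 \<le> x i \<theta>"
    using limit by (intro AE_finite_allI) (auto simp: is_FPPE_def Linf_plus_def)
  moreover have "AE \<theta> in M. \<forall>i\<in>UNIV. 0 < x i \<theta> \<longrightarrow> \<beta> $ i * v i \<theta> = max_bid v \<beta> \<theta>"
    using limit by (intro AE_finite_allI) (simp_all add: is_FPPE_def)
  moreover have "AE \<theta> in M. p \<theta> = max_bid v \<beta> \<theta>" "AE \<theta> in M. 0 < p \<theta> \<longrightarrow> (\<Sum>i\<in>UNIV. x i \<theta>) = 1"
    using limit by (auto simp: is_FPPE_def)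
  ultimately show ?thesis
  proof eventually_elim
    case (elim \<theta>)
    then show ?case unfolding item_values_def by (intro allI max_bid_subgradient \<beta>_pos) auto
  qed
qed

lemma item_values_bounded:
  obtains C where "0 \<le> C" "AE \<theta> in M. (\<forall>i. \<bar>v i \<theta>\<bar> \<le> C) \<and> (\<forall>i. \<bar>item_values v x \<theta> $ i\<bar> \<le> C)"
proof -
  obtain C where C: "0 \<le> C" "\<And>i. AE \<theta> in M. 0 \<le> v i \<theta> \<and> v i \<theta> \<le> C" using values_bounded by blast
  have "AE \<theta> in M. \<forall>i\<in>UNIV. 0 \<le> v i \<theta> \<and> v i \<theta> \<le> C"
    by (intro AE_finite_allI C(2)) auto
  moreover have "AE \<theta> in M. \<forall>i\<in>UNIV. 0 \<le> x i \<theta>"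
    using limit by (intro AE_finite_allI) (auto simp: is_FPPE_def Linf_plus_def)
  moreover have "AE \<theta> in M. (\<Sum>i\<in>UNIV. x i \<theta>) \<le> 1" using limit by (simp add: is_FPPE_def)
  ultimately have "AE \<theta> in M. (\<forall>i. \<bar>v i \<theta>\<bar> \<le> C) \<and> (\<forall>i. \<bar>item_values v x \<theta> $ i\<bar> \<le> C)"
  proof eventually_elim
    case (elim \<theta>)
    have "x i \<theta> \<le> 1" for i
      using member_le_sum[of i UNIV "\<lambda>i. x i \<theta>"] elim by auto
    then have "x i \<theta> * v i \<theta> \<le> 1 * C" for i using elim by (intro mult_mono) auto
    then show ?case using elim by (auto simp: item_values_def)
  qed
  then show ?thesis using that C(1) by blast
qed

end

text \<open>The optimality conditions with multiplier \<open>\<delta>h\<close>; positivity holds as for the limit equilibrium.\<close>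

lemma observed_pacing_conditions:
  fixes b \<beta>h :: "real^'n::finite"
  assumes eq: "is_observed_FPPE b v (1 / real t) t \<gamma> \<beta>h ph xh" and b: "\<And>i. 0 < b $ i"
  defines "\<mu>h \<equiv> observed_item_utility v t \<gamma> xh" and "\<delta>h \<equiv> observed_leftover b t ph xh"
  shows "\<beta>h $ i \<le> 1" "\<delta>h $ i = b $ i - \<beta>h $ i * \<mu>h $ i" "0 \<le> \<delta>h $ i" "0 < \<delta>h $ i \<Longrightarrow> \<beta>h $ i = 1" "0 < \<beta>h $ i"
proof -
  have "(\<Sum>\<tau><t. xh i \<tau> * ph \<tau>) = (\<Sum>\<tau><t. \<beta>h $ i * (v i (\<gamma> \<tau>) * xh i \<tau>))"
  proof (intro sum.cong refl)
    fix \<tau> assume "\<tau> \<in> {..<t}"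
    then show "xh i \<tau> * ph \<tau> = \<beta>h $ i * (v i (\<gamma> \<tau>) * xh i \<tau>)"
      using eq unfolding is_observed_FPPE_def by (cases "xh i \<tau> = 0") (auto simp: mult_ac less_le)
  qed
  then show eq1: "\<delta>h $ i = b $ i - \<beta>h $ i * \<mu>h $ i"
    by (simp add: \<delta>h_def \<mu>h_def observed_leftover_def observed_item_utility_def sum_distrib_left[symmetric] mult_ac)
  have \<delta>: "\<delta>h $ i = b $ i - 1 / real t * (\<Sum>\<tau><t. xh i \<tau> * ph \<tau>)"
    by (simp add: \<delta>h_def observed_leftover_def mult_ac)
  have budget: "1 / real t * (\<Sum>\<tau><t. xh i \<tau> * ph \<tau>) \<le> b $ i"
      "1 / real t * (\<Sum>\<tau><t. xh i \<tau> * ph \<tau>) < b $ i \<Longrightarrow> \<beta>h $ i = 1"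
    using eq unfolding is_observed_FPPE_def by blast+
  show "\<beta>h $ i \<le> 1" using eq by (simp add: is_observed_FPPE_def)
  show "0 \<le> \<delta>h $ i" unfolding \<delta> using budget(1) by linarith
  show imp: "0 < \<delta>h $ i \<Longrightarrow> \<beta>h $ i = 1" unfolding \<delta> using budget(2) by linarith
  have "0 \<le> \<beta>h $ i" using eq by (simp add: is_observed_FPPE_def)
  then show "0 < \<beta>h $ i" using imp b[of i] unfolding eq1 by (cases "\<beta>h $ i = 0") auto
qed

lemma observed_subgradient:
  fixes b \<beta>h :: "real^'n::finite"
  assumes eq: "is_observed_FPPE b v (1 / real t) t \<gamma> \<beta>h ph xh" and b: "\<And>i. 0 < b $ i"
    and v: "\<And>i. 0 \<le> v i (\<gamma> \<tau>)" and \<tau>: "\<tau> < t"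
  shows "max_bid v \<beta>h (\<gamma> \<tau>) + (\<chi> i. xh i \<tau> * v i (\<gamma> \<tau>)) \<bullet> (\<beta>' - \<beta>h) \<le> max_bid v \<beta>' (\<gamma> \<tau>)"
  using eq \<tau> observed_pacing_conditions(5)[OF eq b]
  by (intro max_bid_subgradient v) (auto simp: is_observed_FPPE_def)

section \<open>The sampled equilibrium\<close>

locale sampled_equilibrium = prob_space P + limit_equilibrium M b v s \<beta> p x
  for P :: "'w measure" and M :: "'b measure" and b :: "real^'n::finite" and v s \<beta> p x +
  fixes X :: "nat \<Rightarrow> 'w \<Rightarrow> 'b" and \<beta>g :: "nat \<Rightarrow> 'w \<Rightarrow> real^'n"
    and pg :: "nat \<Rightarrow> 'w \<Rightarrow> nat \<Rightarrow> real" and xg :: "nat \<Rightarrow> 'w \<Rightarrow> 'n \<Rightarrow> nat \<Rightarrow> real"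
  assumes sample_indep: "indep_vars (\<lambda>_. M) X UNIV"
    and sample_law: "\<And>\<tau>. distr P M (X \<tau>) = D"
    and observed: "\<And>t. 0 < t \<Longrightarrow> AE \<omega> in P.
          is_observed_FPPE b v (1 / real t) t (\<lambda>\<tau>. X \<tau> \<omega>) (\<beta>g t \<omega>) (pg t \<omega>) (xg t \<omega>)"
    and SMO: "SMO M v s \<beta>" and SCS: "SCS M b s \<beta> p x"
begin

lemma sample_measurable [measurable]: "X \<tau> \<in> measurable P M"
  using sample_indep by (simp add: indep_vars_def2)

sublocale D: prob_space D
  unfolding sample_law[of 0, symmetric] by (rule prob_space_distr[OF sample_measurable])

lemma sample_AE: "(AE \<theta> in M. Q \<theta>) \<Longrightarrow> AE \<omega> in P. Q (X \<tau> \<omega>)"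
  using D_AE[of Q] unfolding sample_law[of \<tau>, symmetric] by (rule AE_distrD[OF sample_measurable])

lemma item_values_integrable: "integrable D (\<lambda>\<theta>. item_values v x \<theta> $ i)"
proof -
  obtain C where C: "AE \<theta> in M. (\<forall>i. \<bar>v i \<theta>\<bar> \<le> C) \<and> (\<forall>i. \<bar>item_values v x \<theta> $ i\<bar> \<le> C)"
    using item_values_bounded by blast
  then have "AE \<theta> in D. norm (item_values v x \<theta> $ i) \<le> C" by (intro D_AE) auto
  then show ?thesis by (rule D.integrable_const_bound) measurable
qed

sublocale W: centered_iid_sum P M D X "\<lambda>\<theta>. item_values v x \<theta> - \<mu>" "covar M s (item_values v x)"
proof
  show "indep_vars (\<lambda>_. M) X UNIV" by (rule sample_indep)
  show "distr P M (X \<tau>) = D" for \<tau> by (rule sample_law)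
  show "(\<lambda>\<theta>. item_values v x \<theta> - \<mu>) \<in> borel_measurable M" by measurable
  obtain C where C: "AE \<theta> in M. (\<forall>i. \<bar>v i \<theta>\<bar> \<le> C) \<and> (\<forall>i. \<bar>item_values v x \<theta> $ i\<bar> \<le> C)"
    using item_values_bounded by blast
  from D_AE[OF this] have "AE \<theta> in D. norm (item_values v x \<theta> - \<mu>) \<le> (\<Sum>i\<in>(UNIV::'n set). C) + norm \<mu>"
  proof eventually_elim
    case (elim \<theta>)
    have "norm (item_values v x \<theta>) \<le> (\<Sum>i\<in>UNIV. \<bar>item_values v x \<theta> $ i\<bar>)" by (rule norm_le_l1_cart)
    also have "\<dots> \<le> (\<Sum>i\<in>(UNIV::'n set). C)" using elim by (intro sum_mono) blast
    finally show ?case using norm_triangle_ineq4[of "item_values v x \<theta>" \<mu>] by linarith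
  qed
  then show "\<exists>C. AE \<theta> in D. norm (item_values v x \<theta> - \<mu>) \<le> C" by blast
  show "(\<integral>\<theta>. (item_values v x \<theta> - \<mu>) $ i \<partial>D) = 0" for i
    using item_values_integrable[of i] by (simp add: D.prob_space \<mu>_def)
  have m: "expec M s (\<lambda>\<theta>. item_values v x \<theta> $ i) = \<mu> $ i" for i
    by (subst expec_eq_integral) (auto simp: \<mu>_def)
  show "(\<integral>\<theta>. (item_values v x \<theta> - \<mu>) $ i * (item_values v x \<theta> - \<mu>) $ j \<partial>D) = covar M s (item_values v x) $ i $ j" for i j
    unfolding covar_def m by (simp add: expec_eq_integral)
qed

abbreviation W :: "nat \<Rightarrow> 'w \<Rightarrow> real^'n" where "W \<equiv> W.W"

definition A :: "real^'n^'n" where "A = hessian F \<beta>"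

definition H :: "real^'n^'n" where "H = A + diag (\<lambda>i. b $ i / (\<beta> $ i)\<^sup>2)"

lemma max_bid_integrable: "integrable D (max_bid v \<beta>')"
proof -
  obtain C where C: "AE \<theta> in M. (\<forall>i. \<bar>v i \<theta>\<bar> \<le> C) \<and> (\<forall>i. \<bar>item_values v x \<theta> $ i\<bar> \<le> C)"
    using item_values_bounded by blast
  from D_AE[OF this] have "AE \<theta> in D. norm (max_bid v \<beta>' \<theta>) \<le> C * (\<Sum>i\<in>UNIV. \<bar>\<beta>' $ i\<bar>)"
  proof eventually_elim
    case (elim \<theta>)
    then show ?case using max_bid_Lipschitz[of v \<theta> C \<beta>' 0] by (simp add: max_bid_def)
  qed
  then show ?thesis by (rule D.integrable_const_bound) measurable
qed

lemma F_eq: "F \<beta>' = (\<integral>\<theta>. max_bid v \<beta>' \<theta> \<partial>D)"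
  by (rule expec_eq_integral) measurable

lemma item_values_inner_integral: "integrable D (\<lambda>\<theta>. item_values v x \<theta> \<bullet> h)" "(\<integral>\<theta>. item_values v x \<theta> \<bullet> h \<partial>D) = \<mu> \<bullet> h"
proof -
  have i: "integrable D (\<lambda>\<theta>. item_values v x \<theta> $ i * h $ i)" for i
    using item_values_integrable[of i] by simp
  show "integrable D (\<lambda>\<theta>. item_values v x \<theta> \<bullet> h)" unfolding inner_vec_def inner_real_def
    by (intro Bochner_Integration.integrable_sum i)
  have "(\<integral>\<theta>. item_values v x \<theta> \<bullet> h \<partial>D) = (\<Sum>i\<in>UNIV. \<integral>\<theta>. item_values v x \<theta> $ i * h $ i \<partial>D)"
    unfolding inner_vec_def inner_real_def by (intro Bochner_Integration.integral_sum i)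
  then show "(\<integral>\<theta>. item_values v x \<theta> \<bullet> h \<partial>D) = \<mu> \<bullet> h"
    by (simp add: \<mu>_def inner_vec_def)
qed

lemma F_subgradient: "F \<beta> + \<mu> \<bullet> (\<beta>' - \<beta>) \<le> F \<beta>'"
proof -
  have "(\<integral>\<theta>. max_bid v \<beta> \<theta> + item_values v x \<theta> \<bullet> (\<beta>' - \<beta>) \<partial>D) \<le> (\<integral>\<theta>. max_bid v \<beta>' \<theta> \<partial>D)"
  proof (rule integral_mono_AE)
    show "AE \<theta> in D. max_bid v \<beta> \<theta> + item_values v x \<theta> \<bullet> (\<beta>' - \<beta>) \<le> max_bid v \<beta>' \<theta>"
      using D_AE[OF item_values_subgradient] by eventually_elim blast
  qed (intro Bochner_Integration.integrable_add max_bid_integrable item_values_inner_integral)+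
  then show ?thesis by (simp add: F_eq max_bid_integrable item_values_inner_integral)
qed

lemma smooth_neighbourhood:
  obtains U where "open U" "\<beta> \<in> U" "\<And>y. y \<in> U \<Longrightarrow> (F has_derivative (\<lambda>h. gradient F y \<bullet> h)) (at y)"
    "(gradient F has_derivative (\<lambda>h. A *v h)) (at \<beta>)"
  by (rule C2_near_imp_second_derivative[OF SMO[unfolded SMO_def], folded A_def]) (rule that)

text \<open>The mean of the subgradients is a subgradient of the mean. As the mean is differentiable at \<open>\<beta>\<close>, it is the gradient.\<close>

lemma gradient_F: "gradient F \<beta> = \<mu>"
proof -
  obtain U where U: "open U" "\<beta> \<in> U" "\<And>y. y \<in> U \<Longrightarrow> (F has_derivative (\<lambda>h. gradient F y \<bullet> h)) (at y)"
    "(gradient F has_derivative (\<lambda>h. A *v h)) (at \<beta>)"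
    using smooth_neighbourhood by blast
  have "((\<lambda>y. F y - \<mu> \<bullet> (y - \<beta>)) has_derivative (\<lambda>h. gradient F \<beta> \<bullet> h - \<mu> \<bullet> h)) (at \<beta>)"
  proof (rule has_derivative_diff[OF U(3)[OF U(2)]])
    have "((\<lambda>y. y - \<beta>) has_derivative (\<lambda>h. h)) (at \<beta>)"
      using has_derivative_diff[OF has_derivative_ident has_derivative_const, of \<beta>] by simp
    then show "((\<lambda>y. \<mu> \<bullet> (y - \<beta>)) has_derivative (\<lambda>h. \<mu> \<bullet> h)) (at \<beta>)"
      by (rule bounded_linear.has_derivative[OF bounded_linear_inner_right])
  qed
  moreover have "\<forall>\<^sub>F y in at \<beta>. F \<beta> - \<mu> \<bullet> (\<beta> - \<beta>) \<le> F y - \<mu> \<bullet> (y - \<beta>)"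
    using F_subgradient by (intro always_eventually) (simp add: algebra_simps)
  ultimately have "(\<lambda>h. gradient F \<beta> \<bullet> h - \<mu> \<bullet> h) = (\<lambda>h. 0)" by (rule has_derivative_local_min)
  from fun_cong[OF this] have "(gradient F \<beta> - \<mu>) \<bullet> (gradient F \<beta> - \<mu>) = 0" by (simp only: inner_diff_left)
  then show ?thesis by simp
qed

lemma A_symmetric: "transpose A = A"
proof -
  obtain U where U: "open U" "\<beta> \<in> U" "\<And>y. y \<in> U \<Longrightarrow> (F has_derivative (\<lambda>h. gradient F y \<bullet> h)) (at y)"
    "(gradient F has_derivative (\<lambda>h. A *v h)) (at \<beta>)"
    using smooth_neighbourhood by blast
  show ?thesis by (rule second_derivative_symmetric[OF U])
qed

lemma H_eq_hessian: "hessian (dual_obj M b v s) \<beta> = H"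
proof -
  obtain U where U: "open U" "\<beta> \<in> U" "\<And>y. y \<in> U \<Longrightarrow> (F has_derivative (\<lambda>h. gradient F y \<bullet> h)) (at y)"
    "(gradient F has_derivative (\<lambda>h. A *v h)) (at \<beta>)"
    using smooth_neighbourhood by blast
  show ?thesis using hessian_minus_log_barrier[OF U \<beta>_pos] by (simp add: dual_obj_def[abs_def] H_def)
qed

text \<open>The summands of the local objective \<open>\<phi>\<close>, in the coordinate \<open>h = sqrt t *\<^sub>R (\<beta>' - \<beta>)\<close>.\<close>

definition remainder :: "nat \<Rightarrow> real^'n \<Rightarrow> 'b \<Rightarrow> real" where
  "remainder t h \<theta> = max_bid v (\<beta> + (1 / sqrt (real t)) *\<^sub>R h) \<theta> - max_bid v \<beta> \<theta>
     - item_values v x \<theta> \<bullet> ((1 / sqrt (real t)) *\<^sub>R h)"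

lemma remainder_measurable [measurable]: "remainder t h \<in> borel_measurable M"
  unfolding remainder_def by measurable

lemma remainder_nonneg: "AE \<theta> in M. \<forall>t h. 0 \<le> remainder t h \<theta>"
  using item_values_subgradient
proof eventually_elim
  case (elim \<theta>)
  show ?case
  proof (intro allI)
    fix t h
    show "0 \<le> remainder t h \<theta>"
      using elim[rule_format, of "\<beta> + (1 / sqrt (real t)) *\<^sub>R h"] by (simp add: remainder_def)
  qed
qed

lemma remainder_le:
  obtains c where "0 \<le> c" "\<And>t. AE \<theta> in D. remainder t h \<theta> \<le> c / sqrt (real t)"
proof -
  obtain C where C0: "0 \<le> C" and C: "AE \<theta> in M. (\<forall>i. \<bar>v i \<theta>\<bar> \<le> C) \<and> (\<forall>i. \<bar>item_values v x \<theta> $ i\<bar> \<le> C)"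
    using item_values_bounded by blast
  define l where "l = (\<Sum>i\<in>UNIV. \<bar>h $ i\<bar>)"
  have "AE \<theta> in D. remainder t h \<theta> \<le> (2 * C * l) / sqrt (real t)" for t
    using D_AE[OF C]
  proof eventually_elim
    case (elim \<theta>)
    define k where "k = (1 / sqrt (real t)) *\<^sub>R h"
    have kl: "(\<Sum>i\<in>UNIV. \<bar>k $ i\<bar>) = l / sqrt (real t)"
      by (simp add: k_def l_def sum_divide_distrib abs_mult)
    have "\<bar>max_bid v (\<beta> + k) \<theta> - max_bid v \<beta> \<theta>\<bar> \<le> C * (\<Sum>i\<in>UNIV. \<bar>k $ i\<bar>)"
      using max_bid_Lipschitz[of v \<theta> C "\<beta> + k" \<beta>] elim by simp
    moreover have "\<bar>item_values v x \<theta> \<bullet> k\<bar> \<le> (\<Sum>i\<in>UNIV. \<bar>item_values v x \<theta> $ i * k $ i\<bar>)"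
      unfolding inner_vec_def by simp
    moreover have "\<dots> \<le> (\<Sum>i\<in>UNIV. C * \<bar>k $ i\<bar>)"
      using elim unfolding abs_mult by (intro sum_mono mult_right_mono) auto
    ultimately show ?case unfolding remainder_def k_def[symmetric]
      by (simp add: sum_distrib_left[symmetric] kl)
  qed
  moreover have "0 \<le> 2 * C * l" using C0 by (simp add: l_def sum_nonneg)
  ultimately show ?thesis using that by blast
qed

lemma remainder_integrable: "integrable D (remainder t h)"
  unfolding remainder_def
  by (intro Bochner_Integration.integrable_diff max_bid_integrable item_values_inner_integral)

lemma remainder_mean_tendsto: "(\<lambda>t. real t * (\<integral>\<theta>. remainder t h \<theta> \<partial>D)) \<longlonglongrightarrow> h \<bullet> (A *v h) / 2"
proof -
  obtain U where U: "open U" "\<beta> \<in> U" "\<And>y. y \<in> U \<Longrightarrow> (F has_derivative (\<lambda>h. gradient F y \<bullet> h)) (at y)"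
    "(gradient F has_derivative (\<lambda>h. A *v h)) (at \<beta>)"
    using smooth_neighbourhood by blast
  have "(\<integral>\<theta>. remainder t h \<theta> \<partial>D) = F (\<beta> + (1 / sqrt (real t)) *\<^sub>R h) - F \<beta> - gradient F \<beta> \<bullet> ((1 / sqrt (real t)) *\<^sub>R h)" for t
  proof -
    define k where "k = (1 / sqrt (real t)) *\<^sub>R h"
    have "(\<integral>\<theta>. remainder t h \<theta> \<partial>D) = (\<integral>\<theta>. max_bid v (\<beta> + k) \<theta> - max_bid v \<beta> \<theta> \<partial>D) - (\<integral>\<theta>. item_values v x \<theta> \<bullet> k \<partial>D)"
      unfolding remainder_def k_def[symmetric]
      by (intro Bochner_Integration.integral_diff Bochner_Integration.integrable_diff max_bid_integrable item_values_inner_integral)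
    also have "(\<integral>\<theta>. max_bid v (\<beta> + k) \<theta> - max_bid v \<beta> \<theta> \<partial>D) = F (\<beta> + k) - F \<beta>"
      unfolding F_eq by (intro Bochner_Integration.integral_diff max_bid_integrable)
    finally show ?thesis unfolding item_values_inner_integral gradient_F k_def .
  qed
  then show ?thesis using scaled_remainder_tendsto[OF U, of h] by presburger
qed

text \<open>The quadratic form is a limit of means of nonnegative remainders.\<close>

lemma A_psd: "0 \<le> h \<bullet> (A *v h)"
proof -
  have "0 \<le> h \<bullet> (A *v h) / 2"
  proof (rule LIMSEQ_le_const[OF remainder_mean_tendsto], intro exI allI impI)
    fix t
    have "AE \<theta> in D. 0 \<le> remainder t h \<theta>" using D_AE[OF remainder_nonneg] by eventually_elim blast
    then show "0 \<le> real t * (\<integral>\<theta>. remainder t h \<theta> \<partial>D)" by (simp add: integral_nonneg_AE)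
  qed
  then show ?thesis by simp
qed

lemma H_symmetric: "transpose H = H"
  using A_symmetric diag_symmetric by (simp add: H_def transpose_def vec_eq_iff)

text \<open>The barrier contributes the positive diagonal matrix \<open>b\<^sub>i / \<beta>\<^sub>i\<^sup>2\<close>, and \<open>A\<close> is semidefinite.\<close>

lemma H_positive_definite:
  assumes "a \<noteq> 0" shows "0 < a \<bullet> (H *v a)"
proof -
  obtain j where j: "a $ j \<noteq> 0" using assms by (auto simp: vec_eq_iff)
  have "0 < b $ j / (\<beta> $ j)\<^sup>2 * (a $ j)\<^sup>2" using j b_pos[of j] \<beta>_pos[of j] by simp
  also have "\<dots> \<le> (\<Sum>i\<in>UNIV. b $ i / (\<beta> $ i)\<^sup>2 * (a $ i)\<^sup>2)"
    using b_pos by (intro member_le_sum[of j]) (auto simp: less_imp_le)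
  also have "\<dots> = a \<bullet> (diag (\<lambda>i. b $ i / (\<beta> $ i)\<^sup>2) *v a)"
    by (simp add: inner_vec_def diag_vec power2_eq_square mult_ac)
  finally show ?thesis using A_psd[of a]
    by (simp add: H_def matrix_vector_mult_add_rdistrib inner_add_right)
qed

definition \<phi> :: "nat \<Rightarrow> 'w \<Rightarrow> real^'n \<Rightarrow> real" where
  "\<phi> t \<omega> h = (\<Sum>\<tau><t. remainder t h (X \<tau> \<omega>))"

text \<open>The remainder is nonnegative and bounded by \<open>c / sqrt t\<close>, so its second moment is at most \<open>c / sqrt t\<close> times its
mean, and \<open>t\<close> times the mean converges.\<close>

lemma remainder_second_moment_tendsto: "(\<lambda>t. real t * (\<integral>\<theta>. (remainder t h \<theta>)\<^sup>2 \<partial>D)) \<longlonglongrightarrow> 0"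
proof -
  obtain c where c: "0 \<le> c" "\<And>t. AE \<theta> in D. remainder t h \<theta> \<le> c / sqrt (real t)"
    using remainder_le by blast
  have nn: "AE \<theta> in D. 0 \<le> remainder t h \<theta>" for t using D_AE[OF remainder_nonneg] by eventually_elim blast
  have le: "(\<integral>\<theta>. (remainder t h \<theta>)\<^sup>2 \<partial>D) \<le> (\<integral>\<theta>. c / sqrt (real t) * remainder t h \<theta> \<partial>D)" for t
  proof (rule integral_mono_AE')
    show "integrable D (\<lambda>\<theta>. c / sqrt (real t) * remainder t h \<theta>)"
      by (intro integrable_mult_right remainder_integrable)
    show "AE \<theta> in D. (remainder t h \<theta>)\<^sup>2 \<le> c / sqrt (real t) * remainder t h \<theta>"
      using nn c(2)[of t] by eventually_elim (unfold power2_eq_square, rule mult_right_mono)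
    show "AE \<theta> in D. 0 \<le> c / sqrt (real t) * remainder t h \<theta>"
      using nn[of t] by eventually_elim (use c(1) in simp)
  qed
  have lim: "(\<lambda>t. c / sqrt (real t) * (real t * (\<integral>\<theta>. remainder t h \<theta> \<partial>D))) \<longlonglongrightarrow> 0"
    using tendsto_mult[OF tendsto_mult_right_zero[OF inverse_sqrt_tendsto, of c] remainder_mean_tendsto]
    by (simp only: mult_zero_left times_divide_eq_right mult_1_right div_0)
  show ?thesis
  proof (rule tendsto_sandwich[OF _ _ tendsto_const lim])
    show "\<forall>\<^sub>F t in sequentially. real t * (\<integral>\<theta>. (remainder t h \<theta>)\<^sup>2 \<partial>D) \<le> c / sqrt (real t) * (real t * (\<integral>\<theta>. remainder t h \<theta> \<partial>D))"
    proof (intro always_eventually allI)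
      fix t
      have "real t * (\<integral>\<theta>. (remainder t h \<theta>)\<^sup>2 \<partial>D) \<le> real t * (c / sqrt (real t) * (\<integral>\<theta>. remainder t h \<theta> \<partial>D))"
        using le[of t] unfolding integral_mult_right_zero by (rule mult_left_mono) simp
      then show "real t * (\<integral>\<theta>. (remainder t h \<theta>)\<^sup>2 \<partial>D) \<le> c / sqrt (real t) * (real t * (\<integral>\<theta>. remainder t h \<theta> \<partial>D))"
        unfolding mult.left_commute[of "real t"] .
    qed
  qed simp
qed

lemma \<phi>_vanishing: "vanishing P (\<lambda>t \<omega>. \<phi> t \<omega> h - h \<bullet> (A *v h) / 2)"
  unfolding vanishing_def likely_def
proof (intro allI impI)
  fix \<epsilon> \<eta> :: real assume \<epsilon>: "0 < \<epsilon>" and \<eta>: "0 < \<eta>"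
  obtain c where c: "0 \<le> c" "\<And>t. AE \<theta> in D. remainder t h \<theta> \<le> c / sqrt (real t)"
    using remainder_le by blast
  have bdd: "AE \<theta> in D. \<bar>remainder t h \<theta>\<bar> \<le> c / sqrt (real t)" for t
    using D_AE[OF remainder_nonneg] c(2)[of t] by eventually_elim auto
  have "\<forall>\<^sub>F t in sequentially. real t * (\<integral>\<theta>. (remainder t h \<theta>)\<^sup>2 \<partial>D) < \<eta> * (\<epsilon> / 2)\<^sup>2"
    using \<epsilon> \<eta> by (intro order_tendstoD(2)[OF remainder_second_moment_tendsto]) simp
  moreover have "\<forall>\<^sub>F t in sequentially. \<bar>real t * (\<integral>\<theta>. remainder t h \<theta> \<partial>D) - h \<bullet> (A *v h) / 2\<bar> < \<epsilon> / 2"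
    using tendstoD[OF remainder_mean_tendsto, of "\<epsilon> / 2"] \<epsilon> by (simp add: dist_real_def)
  ultimately show "\<forall>\<^sub>F t in sequentially. \<exists>E\<in>events. 1 - \<eta> \<le> prob E \<and>
      (\<forall>\<omega>\<in>E. norm (\<phi> t \<omega> h - h \<bullet> (A *v h) / 2) \<le> \<epsilon>)"
  proof eventually_elim
    case (elim t)
    have "\<exists>E\<in>events. 1 - \<eta> \<le> prob E \<and>
        (\<forall>\<omega>\<in>E. \<bar>(\<Sum>\<tau><t. remainder t h (X \<tau> \<omega>)) - real t * (\<integral>\<theta>. remainder t h \<theta> \<partial>D)\<bar> \<le> \<epsilon> / 2)"
      by (rule iid_sum_concentration[OF sample_indep sample_law remainder_measurable bdd])
         (use elim(1) \<epsilon> in linarith)+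
    then obtain E where E: "E \<in> events" "1 - \<eta> \<le> prob E"
        "\<forall>\<omega>\<in>E. \<bar>(\<Sum>\<tau><t. remainder t h (X \<tau> \<omega>)) - real t * (\<integral>\<theta>. remainder t h \<theta> \<partial>D)\<bar> \<le> \<epsilon> / 2"
      by blast
    have "norm (\<phi> t \<omega> h - h \<bullet> (A *v h) / 2) \<le> \<epsilon>" if "\<omega> \<in> E" for \<omega>
      using bspec[OF E(3) that] elim(2) unfolding \<phi>_def real_norm_def by linarith
    then show ?case using E by blast
  qed
qed

lemma \<phi>_convex: "convex_on UNIV (\<phi> t \<omega>)"
proof (rule convex_onI)
  fix r :: real and h k :: "real^'n"
  assume r: "0 < r" "r < 1"
  have "remainder t ((1 - r) *\<^sub>R h + r *\<^sub>R k) \<theta> \<le> (1 - r) * remainder t h \<theta> + r * remainder t k \<theta>" for \<theta>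
  proof -
    define c where "c = 1 / sqrt (real t)"
    have "\<beta> + c *\<^sub>R ((1 - r) *\<^sub>R h + r *\<^sub>R k) = (1 - r) *\<^sub>R (\<beta> + c *\<^sub>R h) + r *\<^sub>R (\<beta> + c *\<^sub>R k)"
      by (simp add: algebra_simps)
    moreover have "max_bid v ((1 - r) *\<^sub>R (\<beta> + c *\<^sub>R h) + r *\<^sub>R (\<beta> + c *\<^sub>R k)) \<theta>
        \<le> (1 - r) * max_bid v (\<beta> + c *\<^sub>R h) \<theta> + r * max_bid v (\<beta> + c *\<^sub>R k) \<theta>"
      using r by (intro convex_onD[OF convex_max_bid]) auto
    ultimately show ?thesis unfolding remainder_def c_def[symmetric]
      by (simp add: inner_add_right algebra_simps)
  qed
  then have "\<phi> t \<omega> ((1 - r) *\<^sub>R h + r *\<^sub>R k) \<le> (\<Sum>\<tau><t. (1 - r) * remainder t h (X \<tau> \<omega>) + r * remainder t k (X \<tau> \<omega>))"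
    unfolding \<phi>_def by (intro sum_mono)
  then show "\<phi> t \<omega> ((1 - r) *\<^sub>R h + r *\<^sub>R k) \<le> (1 - r) * \<phi> t \<omega> h + r * \<phi> t \<omega> k"
    by (simp add: \<phi>_def sum.distrib sum_distrib_left)
qed auto

text \<open>The suffix \<open>h\<close>, for hat, marks quantities of the observed equilibrium.\<close>

definition \<mu>h :: "nat \<Rightarrow> 'w \<Rightarrow> real^'n" where
  "\<mu>h t \<omega> = observed_item_utility v t (\<lambda>\<tau>. X \<tau> \<omega>) (xg t \<omega>)"

definition \<delta>h :: "nat \<Rightarrow> 'w \<Rightarrow> real^'n" where
  "\<delta>h t \<omega> = observed_leftover b t (pg t \<omega>) (xg t \<omega>)"

text \<open>The local coordinate of the observed pacing vector, at which the subgradients of \<open>\<phi>\<close> are evaluated.\<close>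

definition dev :: "nat \<Rightarrow> 'w \<Rightarrow> real^'n" where
  "dev t \<omega> = sqrt (real t) *\<^sub>R (\<beta>g t \<omega> - \<beta>)"

text \<open>This is a subgradient of \<open>\<phi> t \<omega>\<close> at \<open>dev t \<omega>\<close>; see \<open>regular_subgradient\<close>.\<close>

definition \<xi> :: "nat \<Rightarrow> 'w \<Rightarrow> real^'n" where
  "\<xi> t \<omega> = sqrt (real t) *\<^sub>R (\<mu>h t \<omega> - \<mu>) - W t \<omega>"

text \<open>The almost sure event on which all deterministic arguments are carried out. The last condition says that the limit
item values are subgradients at every sampled item.\<close>

definition regular :: "nat \<Rightarrow> 'w \<Rightarrow> bool" where
  "regular t \<omega> \<longleftrightarrow> 0 < t \<and>
     is_observed_FPPE b v (1 / real t) t (\<lambda>\<tau>. X \<tau> \<omega>) (\<beta>g t \<omega>) (pg t \<omega>) (xg t \<omega>) \<and>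
     (\<forall>\<tau><t. (\<forall>i. 0 \<le> v i (X \<tau> \<omega>)) \<and> (\<forall>h. 0 \<le> remainder t h (X \<tau> \<omega>)))"

lemma whp_regular: "whp P regular"
proof (rule whp_AE)
  fix t :: nat assume t: "0 < t"
  have "AE \<theta> in M. \<forall>i\<in>UNIV. 0 \<le> v i \<theta>"
    using market by (intro AE_finite_allI) (auto simp: market_def L1_plus_def)
  then have "AE \<theta> in M. (\<forall>i. 0 \<le> v i \<theta>) \<and> (\<forall>h. 0 \<le> remainder t h \<theta>)"
    using remainder_nonneg by eventually_elim auto
  then have "AE \<omega> in P. \<forall>\<tau>\<in>{..<t}. (\<forall>i. 0 \<le> v i (X \<tau> \<omega>)) \<and> (\<forall>h. 0 \<le> remainder t h (X \<tau> \<omega>))"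
    by (intro AE_finite_allI sample_AE) auto
  then show "AE \<omega> in P. regular t \<omega>"
    using observed[OF t] by eventually_elim (use t in \<open>auto simp: regular_def\<close>)
qed

lemma regular_conditions:
  assumes "regular t \<omega>"
  shows "\<beta>g t \<omega> $ i \<le> 1" "\<delta>h t \<omega> $ i = b $ i - \<beta>g t \<omega> $ i * \<mu>h t \<omega> $ i" "0 \<le> \<delta>h t \<omega> $ i"
    "0 < \<delta>h t \<omega> $ i \<Longrightarrow> \<beta>g t \<omega> $ i = 1" "0 < \<beta>g t \<omega> $ i"
proof -
  have eq: "is_observed_FPPE b v (1 / real t) t (\<lambda>\<tau>. X \<tau> \<omega>) (\<beta>g t \<omega>) (pg t \<omega>) (xg t \<omega>)"
    using assms by (simp add: regular_def)
  note c = observed_pacing_conditions[OF eq b_pos, folded \<mu>h_def \<delta>h_def]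
  show "\<beta>g t \<omega> $ i \<le> 1" "\<delta>h t \<omega> $ i = b $ i - \<beta>g t \<omega> $ i * \<mu>h t \<omega> $ i" "0 \<le> \<delta>h t \<omega> $ i"
    "0 < \<delta>h t \<omega> $ i \<Longrightarrow> \<beta>g t \<omega> $ i = 1" "0 < \<beta>g t \<omega> $ i"
    by (rule c, assumption?)+
qed

text \<open>Observed item values are subgradients of the sampled maximal bids at the observed pacing vector. Subtracting the
linear part of the remainders leaves \<open>\<xi>\<close>.\<close>

lemma regular_subgradient:
  assumes reg: "regular t \<omega>"
  shows "\<phi> t \<omega> (dev t \<omega>) + \<xi> t \<omega> \<bullet> (y - dev t \<omega>) \<le> \<phi> t \<omega> y"
proof -
  define c where "c = 1 / sqrt (real t)"
  have t: "0 < t" using reg by (simp add: regular_def)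
  define z where "z \<tau> = (\<chi> i. xg t \<omega> i \<tau> * v i (X \<tau> \<omega>))" for \<tau>
  have dev: "\<beta> + c *\<^sub>R dev t \<omega> = \<beta>g t \<omega>" using t by (simp add: c_def dev_def)
  have "remainder t (dev t \<omega>) (X \<tau> \<omega>) + c * ((z \<tau> - item_values v x (X \<tau> \<omega>)) \<bullet> (y - dev t \<omega>)) \<le> remainder t y (X \<tau> \<omega>)"
    if "\<tau> < t" for \<tau>
  proof -
    have "max_bid v (\<beta>g t \<omega>) (X \<tau> \<omega>) + z \<tau> \<bullet> ((\<beta> + c *\<^sub>R y) - \<beta>g t \<omega>) \<le> max_bid v (\<beta> + c *\<^sub>R y) (X \<tau> \<omega>)"
      unfolding z_def using reg that
      by (intro observed_subgradient[where b = b and \<gamma> = "\<lambda>\<tau>. X \<tau> \<omega>" and t = t and ph = "pg t \<omega>"] b_pos) (auto simp: regular_def)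
    then show ?thesis unfolding remainder_def c_def[symmetric] dev
      by (simp add: dev[symmetric] inner_diff_left inner_diff_right inner_add_right algebra_simps)
  qed
  then have "(\<Sum>\<tau><t. remainder t (dev t \<omega>) (X \<tau> \<omega>) + c * ((z \<tau> - item_values v x (X \<tau> \<omega>)) \<bullet> (y - dev t \<omega>))) \<le> \<phi> t \<omega> y"
    unfolding \<phi>_def by (intro sum_mono) auto
  moreover have "\<xi> t \<omega> = c *\<^sub>R (\<Sum>\<tau><t. z \<tau> - item_values v x (X \<tau> \<omega>))"
  proof -
    have "\<mu>h t \<omega> = (1 / real t) *\<^sub>R (\<Sum>\<tau><t. z \<tau>)"
      by (simp add: \<mu>h_def observed_item_utility_def z_def vec_eq_iff mult.commute)
    moreover have "sqrt (real t) *\<^sub>R ((1 / real t) *\<^sub>R y) = c *\<^sub>R y" "c *\<^sub>R (real t *\<^sub>R y) = sqrt (real t) *\<^sub>R y"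
      for y :: "real^'n" using t by (simp_all add: c_def real_div_sqrt field_simps)
    moreover have "W t \<omega> = c *\<^sub>R (\<Sum>\<tau><t. item_values v x (X \<tau> \<omega>)) - c *\<^sub>R (real t *\<^sub>R \<mu>)"
      by (simp only: W.W_def c_def sum_subtractf sum_constant_scaleR card_lessThan scaleR_diff_right)
    ultimately show ?thesis
      by (simp only: \<xi>_def sum_subtractf scaleR_diff_right) simp
  qed
  ultimately show ?thesis
    by (simp add: \<phi>_def sum.distrib sum_distrib_left[symmetric] inner_sum_left)
qed

definition b_min :: real where "b_min = Min (range (\<lambda>i. b $ i))"

lemma b_min: "0 < b_min" "b_min \<le> b $ i"
  unfolding b_min_def by (auto simp: b_pos)

text \<open>Since \<open>\<phi> t \<omega>\<close> is nonnegative and vanishes at \<open>0\<close>, the subgradient inequality gives \<open>0 \<le> \<xi> \<bullet> dev\<close>, that is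
\<open>W \<bullet> dev \<le> sqrt t *\<^sub>R (\<mu>h - \<mu>) \<bullet> dev\<close>. By strong monotonicity the right-hand side is at most
\<open>- b_min * (norm dev)\<^sup>2\<close>.\<close>

lemma regular_dev_bound:
  assumes reg: "regular t \<omega>"
  shows "norm (dev t \<omega>) \<le> (1 / b_min) * norm (W t \<omega>)"
proof -
  have "0 \<le> \<phi> t \<omega> (dev t \<omega>)" unfolding \<phi>_def using reg by (intro sum_nonneg) (auto simp: regular_def)
  moreover have "\<phi> t \<omega> 0 = 0" by (simp add: \<phi>_def remainder_def)
  ultimately have "0 \<le> \<xi> t \<omega> \<bullet> dev t \<omega>" using regular_subgradient[OF reg, of 0] by simp
  then have 1: "W t \<omega> \<bullet> dev t \<omega> \<le> (sqrt (real t) *\<^sub>R (\<mu>h t \<omega> - \<mu>)) \<bullet> dev t \<omega>"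
    by (simp add: \<xi>_def inner_diff_left)
  have "(sqrt (real t) *\<^sub>R (\<mu>h t \<omega> - \<mu>)) \<bullet> dev t \<omega> = real t * (\<Sum>i\<in>UNIV. (\<mu>h t \<omega> $ i - \<mu> $ i) * (\<beta>g t \<omega> $ i - \<beta> $ i))"
  proof -
    have "sqrt (real t) * sqrt (real t) = real t" by simp
    then have "(sqrt (real t) * y) * (sqrt (real t) * z) = real t * (y * z)" for y z
      by (metis mult.assoc mult.left_commute)
    then show ?thesis by (simp only: dev_def inner_vec_def inner_real_def vector_scaleR_component vector_minus_component sum_distrib_left real_scaleR_def)
  qed
  also have "\<dots> \<le> real t * (\<Sum>i\<in>UNIV. - b_min * (\<beta>g t \<omega> $ i - \<beta> $ i)\<^sup>2)"
  proof (intro mult_left_mono sum_mono)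
    fix i
    have "(\<mu>h t \<omega> $ i - \<mu> $ i) * (\<beta>g t \<omega> $ i - \<beta> $ i) \<le> - b $ i * (\<beta>g t \<omega> $ i - \<beta> $ i)\<^sup>2"
      by (rule pacing_strongly_monotone[OF b_pos \<beta>_pos \<beta>_le_1 _ _ \<delta>_eq \<delta>_nonneg \<delta>_pos_imp, where \<delta>' = "\<delta>h t \<omega> $ i"])
         (use regular_conditions[OF reg, of i] in auto)
    also have "\<dots> \<le> - b_min * (\<beta>g t \<omega> $ i - \<beta> $ i)\<^sup>2" using b_min(2) by (intro mult_right_mono) auto
    finally show "(\<mu>h t \<omega> $ i - \<mu> $ i) * (\<beta>g t \<omega> $ i - \<beta> $ i) \<le> - b_min * (\<beta>g t \<omega> $ i - \<beta> $ i)\<^sup>2" .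
  qed simp
  also have "\<dots> = - b_min * (dev t \<omega> \<bullet> dev t \<omega>)"
  proof -
    have "dev t \<omega> \<bullet> dev t \<omega> = (\<Sum>i\<in>UNIV. (sqrt (real t))\<^sup>2 * (\<beta>g t \<omega> $ i - \<beta> $ i)\<^sup>2)"
      unfolding inner_vec_def dev_def inner_real_def vector_scaleR_component vector_minus_component real_scaleR_def
      by (intro sum.cong refl) (simp only: power2_eq_square mult_ac)
    then show ?thesis by (simp add: sum_distrib_left[symmetric] sum_negf)
  qed
  finally have "b_min * (norm (dev t \<omega>))\<^sup>2 \<le> - (W t \<omega> \<bullet> dev t \<omega>)" using 1 by (simp add: power2_norm_eq_inner)
  also have "\<dots> \<le> norm (W t \<omega>) * norm (dev t \<omega>)"
    using Cauchy_Schwarz_ineq2[of "W t \<omega>" "dev t \<omega>"] by linarith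
  finally have "(b_min * norm (dev t \<omega>)) * norm (dev t \<omega>) \<le> norm (W t \<omega>) * norm (dev t \<omega>)"
    by (simp add: power2_eq_square mult_ac)
  then have "b_min * norm (dev t \<omega>) \<le> norm (W t \<omega>)"
    by (cases "dev t \<omega> = 0") auto
  then show ?thesis using b_min by (simp add: field_simps)
qed

lemma dev_stochastically_bounded: "stochastically_bounded P dev"
  by (rule stochastically_bounded_dominated[OF W.W_stochastically_bounded, of _ "1 / b_min"])
     (rule whp_mono[OF whp_regular regular_dev_bound])

lemma subgradient_vanishing: "vanishing P (\<lambda>t \<omega>. \<xi> t \<omega> - A *v dev t \<omega>)"
  by (rule vanishing_subgradient_of_convex_process[OF A_symmetric \<phi>_convex \<phi>_vanishing dev_stochastically_bounded])
     (rule whp_mono[OF whp_regular], use regular_subgradient in blast)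

lemma vanishing_over_sqrt:
  assumes "stochastically_bounded P Z"
  shows "vanishing P (\<lambda>t \<omega>. (1 / sqrt (real t)) *\<^sub>R Z t \<omega>)"
  by (rule vanishing_of_rate[OF assms inverse_sqrt_tendsto, of "\<lambda>r. \<bar>r\<bar>"])
     (auto intro!: whp_AE mono_onI)

lemma \<beta>g_near:
  assumes "0 < e"
  shows "whp P (\<lambda>t \<omega>. regular t \<omega> \<and> (\<forall>i\<in>UNIV. \<bar>\<beta>g t \<omega> $ i - \<beta> $ i\<bar> \<le> e))"
proof -
  have "whp P (\<lambda>t \<omega>. regular t \<omega> \<and> norm ((1 / sqrt (real t)) *\<^sub>R dev t \<omega>) \<le> e)"
    using vanishing_over_sqrt[OF dev_stochastically_bounded] assms
    by (intro whp_conj whp_regular) (auto simp: vanishing_iff_whp)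
  then show ?thesis
  proof (rule whp_mono, intro conjI ballI)
    fix t \<omega> i assume *: "regular t \<omega> \<and> norm ((1 / sqrt (real t)) *\<^sub>R dev t \<omega>) \<le> e"
    then have "(1 / sqrt (real t)) *\<^sub>R dev t \<omega> = \<beta>g t \<omega> - \<beta>" by (simp add: dev_def regular_def)
    then have "norm (\<beta>g t \<omega> - \<beta>) \<le> e" using * by metis
    then show "\<bar>\<beta>g t \<omega> $ i - \<beta> $ i\<bar> \<le> e" using component_le_norm_cart[of "\<beta>g t \<omega> - \<beta>" i] by simp
  qed auto
qed

definition \<beta>_min :: real where "\<beta>_min = Min (range (\<lambda>i. \<beta> $ i))"

lemma \<beta>_min: "0 < \<beta>_min" "\<beta>_min \<le> \<beta> $ i"
  unfolding \<beta>_min_def by (auto simp: \<beta>_pos)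

text \<open>The second-order Taylor error of the utilities \<open>b\<^sub>i / \<beta>\<^sub>i\<close>, scaled by \<open>sqrt t\<close>.\<close>

definition utility_error :: "nat \<Rightarrow> 'w \<Rightarrow> real^'n" where
  "utility_error t \<omega> = (\<chi> i. sqrt (real t) * (b $ i / \<beta>g t \<omega> $ i - b $ i / \<beta> $ i) + b $ i / (\<beta> $ i)\<^sup>2 * dev t \<omega> $ i)"

text \<open>With \<open>\<Delta>\<close> the deviation of one multiplier, the error equals \<open>sqrt t * b \<Delta>\<^sup>2 / (\<beta>\<^sup>2 \<beta>g)\<close>, where \<open>\<beta>g \<ge> \<beta> / 2\<close> with high
probability, and \<open>sqrt t * \<Delta>\<^sup>2 = (sqrt t * \<Delta>)\<^sup>2 / sqrt t\<close>.\<close>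

lemma utility_error_vanishing: "vanishing P utility_error"
proof (rule vanishing_componentwise)
  fix i
  define c where "c = 2 * b $ i / (\<beta> $ i)^3"
  have c0: "0 \<le> c" using b_pos[of i] \<beta>_pos[of i] by (simp add: c_def)
  show "vanishing P (\<lambda>t \<omega>. utility_error t \<omega> $ i)"
  proof (rule vanishing_of_rate[OF dev_stochastically_bounded inverse_sqrt_tendsto, of "\<lambda>r. c * r\<^sup>2"])
    show "mono_on {0..} (\<lambda>r. c * r\<^sup>2)" using c0 by (auto intro!: mono_onI mult_left_mono power_mono)
    have "whp P (\<lambda>t \<omega>. regular t \<omega> \<and> (\<forall>i\<in>UNIV. \<bar>\<beta>g t \<omega> $ i - \<beta> $ i\<bar> \<le> \<beta>_min / 2))"
      using \<beta>_min by (intro \<beta>g_near) simp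
    then show "whp P (\<lambda>t \<omega>. norm (utility_error t \<omega> $ i) \<le> 1 / sqrt (real t) * (c * (norm (dev t \<omega>))\<^sup>2))"
    proof (rule whp_mono)
      fix t \<omega> assume *: "regular t \<omega> \<and> (\<forall>i\<in>UNIV. \<bar>\<beta>g t \<omega> $ i - \<beta> $ i\<bar> \<le> \<beta>_min / 2)"
      then have t: "0 < t" by (simp add: regular_def)
      define \<Delta> where "\<Delta> = \<beta>g t \<omega> $ i - \<beta> $ i"
      have "\<beta>_min \<le> \<beta> $ i" by (rule \<beta>_min)
      moreover have "\<bar>\<Delta>\<bar> \<le> \<beta>_min / 2" using * by (simp add: \<Delta>_def)
      ultimately have \<beta>g: "\<beta> $ i / 2 \<le> \<beta>g t \<omega> $ i" unfolding \<Delta>_def by linarith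
      then have \<beta>g0: "0 < \<beta>g t \<omega> $ i" using \<beta>_pos[of i] by linarith
      have dev: "dev t \<omega> $ i = sqrt (real t) * \<Delta>" by (simp add: dev_def \<Delta>_def)
      have "b $ i / \<beta>g t \<omega> $ i - b $ i / \<beta> $ i + b $ i / (\<beta> $ i)\<^sup>2 * \<Delta> = b $ i * \<Delta>\<^sup>2 / ((\<beta> $ i)\<^sup>2 * \<beta>g t \<omega> $ i)"
        using \<beta>g0 \<beta>_pos[of i] by (simp add: \<Delta>_def power2_eq_square field_simps)
      moreover have "utility_error t \<omega> $ i = sqrt (real t) * (b $ i / \<beta>g t \<omega> $ i - b $ i / \<beta> $ i + b $ i / (\<beta> $ i)\<^sup>2 * \<Delta>)"
        by (simp only: utility_error_def vec_lambda_beta dev distrib_left mult.left_commute)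
      ultimately have err: "utility_error t \<omega> $ i = sqrt (real t) * (b $ i * \<Delta>\<^sup>2 / ((\<beta> $ i)\<^sup>2 * \<beta>g t \<omega> $ i))"
        by (simp only:)
      have "\<bar>utility_error t \<omega> $ i\<bar> = sqrt (real t) * (b $ i * \<Delta>\<^sup>2 / ((\<beta> $ i)\<^sup>2 * \<beta>g t \<omega> $ i))"
        unfolding err using b_pos[of i] \<beta>g0 by (simp add: abs_mult)
      also have "\<dots> \<le> sqrt (real t) * (b $ i * \<Delta>\<^sup>2 / ((\<beta> $ i)\<^sup>2 * (\<beta> $ i / 2)))"
        using b_pos[of i] \<beta>_pos[of i] \<beta>g by (intro mult_left_mono divide_left_mono) auto
      also have "\<dots> = 1 / sqrt (real t) * (c * (dev t \<omega> $ i)\<^sup>2)"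
      proof -
        have "r * (B * y\<^sup>2 / (z\<^sup>2 * (z / 2))) = 1 / r * (2 * B / z ^ 3 * (r * y)\<^sup>2)" if "r \<noteq> 0" "z \<noteq> 0" for r B y z :: real
          using that by (simp add: power2_eq_square power3_eq_cube field_simps)
        then show ?thesis using t \<beta>_pos[of i] unfolding c_def dev by simp
      qed
      also have "\<dots> \<le> 1 / sqrt (real t) * (c * (norm (dev t \<omega>))\<^sup>2)"
      proof -
        have "(dev t \<omega> $ i)\<^sup>2 \<le> (norm (dev t \<omega>))\<^sup>2"
          using component_le_norm_cart[of "dev t \<omega>" i] by (simp add: abs_le_square_iff[symmetric])
        then show ?thesis using c0 by (intro mult_left_mono) auto
      qed
      finally show "norm (utility_error t \<omega> $ i) \<le> 1 / sqrt (real t) * (c * (norm (dev t \<omega>))\<^sup>2)"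
        unfolding real_norm_def .
    qed
  qed (use c0 in auto)
qed

definition total_error :: "nat \<Rightarrow> 'w \<Rightarrow> real^'n" where
  "total_error t \<omega> = utility_error t \<omega> - (\<xi> t \<omega> - A *v dev t \<omega>)"

lemma total_error_vanishing: "vanishing P total_error"
  unfolding total_error_def by (intro vanishing_diff utility_error_vanishing subgradient_vanishing)

text \<open>An exact identity. Both leftover budgets have the form \<open>b / \<beta> - \<mu>\<close>, and the two error terms measure the deviation of
\<open>b / \<beta>\<close> and of \<open>\<mu>\<close> from their linearisations.\<close>

lemma leftover_expansion:
  assumes reg: "regular t \<omega>"
  shows "sqrt (real t) *\<^sub>R (\<delta>h t \<omega> - \<delta>) = total_error t \<omega> - (H *v dev t \<omega> + W t \<omega>)"
proof -
  have eqs: "\<delta>h t \<omega> $ i = b $ i / \<beta>g t \<omega> $ i - \<mu>h t \<omega> $ i" "\<delta> $ i = b $ i / \<beta> $ i - \<mu> $ i" for i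
  proof -
    have "\<mu>h t \<omega> $ i + \<delta>h t \<omega> $ i = b $ i / \<beta>g t \<omega> $ i"
      by (intro pacing_utility_identity regular_conditions[OF reg])
    moreover have "\<mu> $ i + \<delta> $ i = b $ i / \<beta> $ i"
      by (intro pacing_utility_identity \<beta>_pos \<delta>_eq \<delta>_nonneg \<delta>_pos_imp)
    ultimately show "\<delta>h t \<omega> $ i = b $ i / \<beta>g t \<omega> $ i - \<mu>h t \<omega> $ i" "\<delta> $ i = b $ i / \<beta> $ i - \<mu> $ i"
      by linarith+
  qed
  have "(sqrt (real t) *\<^sub>R (\<delta>h t \<omega> - \<delta>)) $ i = (total_error t \<omega> - (H *v dev t \<omega> + W t \<omega>)) $ i" for i
  proof -
    have "(sqrt (real t) *\<^sub>R (\<delta>h t \<omega> - \<delta>)) $ i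
        = sqrt (real t) * ((b $ i / \<beta>g t \<omega> $ i - \<mu>h t \<omega> $ i) - (b $ i / \<beta> $ i - \<mu> $ i))"
      by (simp only: vector_scaleR_component vector_minus_component eqs real_scaleR_def)
    also have "\<dots> = (total_error t \<omega> - (H *v dev t \<omega> + W t \<omega>)) $ i"
      by (simp add: total_error_def utility_error_def \<xi>_def H_def matrix_vector_mult_add_rdistrib diag_vec
          right_diff_distrib)
    finally show ?thesis .
  qed
  then show ?thesis by (subst vec_eq_iff) blast
qed

lemma observed_leftover_consistent: "vanishing P (\<lambda>t \<omega>. \<delta>h t \<omega> - \<delta>)"
proof -
  have "vanishing P (\<lambda>t \<omega>. (1 / sqrt (real t)) *\<^sub>R (total_error t \<omega> - (H *v dev t \<omega> + W t \<omega>)))"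
  proof (rule vanishing_over_sqrt)
    obtain K where "\<And>z. norm (H *v z) \<le> norm z * K"
      using bounded_linear.bounded[OF matrix_vector_mul_bounded_linear[of H]] by blast
    then have "stochastically_bounded P (\<lambda>t \<omega>. H *v dev t \<omega>)"
      by (intro stochastically_bounded_dominated[OF dev_stochastically_bounded, of _ K] whp_AE) (simp add: mult.commute)
    from stochastically_bounded_add[OF this W.W_stochastically_bounded]
    have "stochastically_bounded P (\<lambda>t \<omega>. - (H *v dev t \<omega> + W t \<omega>))"
      unfolding stochastically_bounded_def by (simp only: norm_minus_cancel)
    from stochastically_bounded_add_vanishing[OF this total_error_vanishing]
    show "stochastically_bounded P (\<lambda>t \<omega>. total_error t \<omega> - (H *v dev t \<omega> + W t \<omega>))"
      unfolding uminus_add_conv_diff .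
  qed
  then show ?thesis
  proof (rule vanishing_cong)
    show "whp P (\<lambda>t \<omega>. \<delta>h t \<omega> - \<delta> = (1 / sqrt (real t)) *\<^sub>R (total_error t \<omega> - (H *v dev t \<omega> + W t \<omega>)))"
    proof (rule whp_mono[OF whp_regular])
      fix t \<omega> assume reg: "regular t \<omega>"
      then show "\<delta>h t \<omega> - \<delta> = (1 / sqrt (real t)) *\<^sub>R (total_error t \<omega> - (H *v dev t \<omega> + W t \<omega>))"
        unfolding leftover_expansion[OF reg, symmetric] by (simp add: regular_def)
    qed
  qed
qed

text \<open>If \<open>\<beta>\<^sub>i < 1\<close>, then the observed multiplier is below \<open>1\<close> with high probability, so that no budget is left over. Otherwise strict
complementary slackness makes the limit leftover positive, hence the observed one too, and the observed multiplier
equals \<open>1\<close>.\<close>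

lemma active_set_identified:
  "whp P (\<lambda>t \<omega>. regular t \<omega> \<and> (\<forall>i\<in>UNIV. if \<beta> $ i < 1 then \<delta>h t \<omega> $ i - \<delta> $ i = 0 else dev t \<omega> $ i = 0))"
proof (intro whp_conj whp_regular whp_ball_finite)
  fix i :: 'n
  show "whp P (\<lambda>t \<omega>. if \<beta> $ i < 1 then \<delta>h t \<omega> $ i - \<delta> $ i = 0 else dev t \<omega> $ i = 0)"
  proof (cases "\<beta> $ i < 1")
    case True
    then have "whp P (\<lambda>t \<omega>. regular t \<omega> \<and> (\<forall>i'\<in>UNIV. \<bar>\<beta>g t \<omega> $ i' - \<beta> $ i'\<bar> \<le> (1 - \<beta> $ i) / 2))"
      by (intro \<beta>g_near) simp
    then show ?thesis
    proof (rule whp_mono)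
      fix t \<omega> assume *: "regular t \<omega> \<and> (\<forall>i'\<in>UNIV. \<bar>\<beta>g t \<omega> $ i' - \<beta> $ i'\<bar> \<le> (1 - \<beta> $ i) / 2)"
      then have "\<bar>\<beta>g t \<omega> $ i - \<beta> $ i\<bar> \<le> (1 - \<beta> $ i) / 2" by blast
      then have "\<beta>g t \<omega> $ i - \<beta> $ i \<le> (1 - \<beta> $ i) / 2" by (rule abs_le_D1)
      then have "\<beta>g t \<omega> $ i < 1" using True by (simp add: field_simps)
      then have "\<delta>h t \<omega> $ i = 0" using * regular_conditions(3,4)[of t \<omega> i] by fastforce
      moreover have "\<delta> $ i = 0" using \<delta>_nonneg[of i] \<delta>_pos_imp[of i] True by fastforce
      ultimately show "if \<beta> $ i < 1 then \<delta>h t \<omega> $ i - \<delta> $ i = 0 else dev t \<omega> $ i = 0" using True by simp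
    qed
  next
    case False
    then have \<beta>1: "\<beta> $ i = 1" using \<beta>_le_1[of i] by simp
    then have pos: "0 < \<delta> $ i" using SCS by (simp add: SCS_def \<delta>_def)
    have "whp P (\<lambda>t \<omega>. regular t \<omega> \<and> norm (\<delta>h t \<omega> - \<delta>) \<le> \<delta> $ i / 2)"
      using observed_leftover_consistent[unfolded vanishing_iff_whp, rule_format, of "\<delta> $ i / 2"] pos
      by (intro whp_conj whp_regular) simp
    then show ?thesis
    proof (rule whp_mono)
      fix t \<omega> assume *: "regular t \<omega> \<and> norm (\<delta>h t \<omega> - \<delta>) \<le> \<delta> $ i / 2"
      have "\<bar>(\<delta>h t \<omega> - \<delta>) $ i\<bar> \<le> \<delta> $ i / 2" using component_le_norm_cart[of "\<delta>h t \<omega> - \<delta>" i] * by linarith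
      then have "0 < \<delta>h t \<omega> $ i" using pos unfolding vector_minus_component abs_le_iff by linarith
      then have "\<beta>g t \<omega> $ i = 1" using * regular_conditions(4) by blast
      then show "if \<beta> $ i < 1 then \<delta>h t \<omega> $ i - \<delta> $ i = 0 else dev t \<omega> $ i = 0" using \<beta>1 by (simp add: dev_def)
    qed
  qed
qed simp

definition Pr :: "real^'n^'n" where "Pr = diag (\<lambda>i. if \<beta> $ i < 1 then 1 else 0)"

definition HB :: "real^'n^'n" where "HB = Pr ** H ** Pr"

lemma pinv_HB: "pinv HB ** HB = Pr" "pinv HB ** Pr = pinv HB" "transpose (pinv HB) = pinv HB"
  using pinv_compressed_positive_definite[OF H_symmetric H_positive_definite, of Pr "{i. \<beta> $ i < 1}" HB]
  by (simp_all add: Pr_def HB_def)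

text \<open>On the event of \<open>active_set_identified\<close>, applying \<open>Pr\<close> to \<open>leftover_expansion\<close> gives
\<open>HB *v dev = Pr *v (total_error - W)\<close>, because \<open>dev = Pr *v dev\<close>; the pseudo-inverse solves this equation.\<close>

lemma dev_linear: "vanishing P (\<lambda>t \<omega>. dev t \<omega> + pinv HB *v W t \<omega>)"
proof (rule vanishing_cong)
  show "vanishing P (\<lambda>t \<omega>. pinv HB *v total_error t \<omega>)"
    by (rule vanishing_bounded_linear[OF matrix_vector_mul_bounded_linear total_error_vanishing])
  show "whp P (\<lambda>t \<omega>. dev t \<omega> + pinv HB *v W t \<omega> = pinv HB *v total_error t \<omega>)"
  proof (rule whp_mono[OF active_set_identified])
    fix t \<omega> assume *: "regular t \<omega> \<and> (\<forall>i\<in>UNIV. if \<beta> $ i < 1 then \<delta>h t \<omega> $ i - \<delta> $ i = 0 else dev t \<omega> $ i = 0)"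
    have Pd: "Pr *v dev t \<omega> = dev t \<omega>" using * by (auto simp: vec_eq_iff Pr_def diag_vec)
    have "\<delta>h t \<omega> $ i = \<delta> $ i" if "\<beta> $ i < 1" for i
      using bspec[OF conjunct2[OF *] UNIV_I, of i] that by simp
    then have "Pr *v (sqrt (real t) *\<^sub>R (\<delta>h t \<omega> - \<delta>)) = 0" by (auto simp: vec_eq_iff Pr_def diag_vec)
    then have "pinv HB *v (Pr *v (sqrt (real t) *\<^sub>R (\<delta>h t \<omega> - \<delta>))) = 0" by simp
    then have 0: "pinv HB *v (total_error t \<omega> - (H *v dev t \<omega> + W t \<omega>)) = 0"
      unfolding matrix_vector_mul_assoc pinv_HB leftover_expansion[OF conjunct1[OF *]] .
    have "pinv HB *v (H *v dev t \<omega>) = (pinv HB ** Pr) *v (H *v (Pr *v dev t \<omega>))" by (simp add: pinv_HB Pd)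
    also have "\<dots> = (pinv HB ** HB) *v dev t \<omega>" by (simp add: HB_def matrix_vector_mul_assoc matrix_mul_assoc)
    also have "\<dots> = dev t \<omega>" by (simp add: pinv_HB Pd)
    finally show "dev t \<omega> + pinv HB *v W t \<omega> = pinv HB *v total_error t \<omega>"
      using 0 by (simp add: matrix_vector_mult_diff_distrib matrix_vector_right_distrib)
  qed
qed

lemma leftover_linear:
  "vanishing P (\<lambda>t \<omega>. sqrt (real t) *\<^sub>R (\<delta>h t \<omega> - \<delta>) - (- (mat 1 - H ** pinv HB)) *v W t \<omega>)"
proof (rule vanishing_cong)
  show "vanishing P (\<lambda>t \<omega>. total_error t \<omega> - H *v (dev t \<omega> + pinv HB *v W t \<omega>))"
    by (intro vanishing_diff total_error_vanishing
          vanishing_bounded_linear[OF matrix_vector_mul_bounded_linear dev_linear])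
  show "whp P (\<lambda>t \<omega>. sqrt (real t) *\<^sub>R (\<delta>h t \<omega> - \<delta>) - (- (mat 1 - H ** pinv HB)) *v W t \<omega>
      = total_error t \<omega> - H *v (dev t \<omega> + pinv HB *v W t \<omega>))"
  proof (rule whp_mono[OF whp_regular])
    fix t \<omega> assume reg: "regular t \<omega>"
    show "sqrt (real t) *\<^sub>R (\<delta>h t \<omega> - \<delta>) - (- (mat 1 - H ** pinv HB)) *v W t \<omega>
      = total_error t \<omega> - H *v (dev t \<omega> + pinv HB *v W t \<omega>)"
      unfolding leftover_expansion[OF reg] minus_diff_eq matrix_vector_mult_diff_rdistrib
        matrix_vector_mul_assoc[symmetric] matrix_vector_mul_lid matrix_vector_right_distrib
      by simp
  qed
qed

definition uh :: "nat \<Rightarrow> 'w \<Rightarrow> real^'n" where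
  "uh t \<omega> = observed_utility b v t (\<lambda>\<tau>. X \<tau> \<omega>) (pg t \<omega>) (xg t \<omega>)"

lemma regular_utility:
  assumes "regular t \<omega>" shows "uh t \<omega> $ i = b $ i / \<beta>g t \<omega> $ i"
  using pacing_utility_identity[OF regular_conditions(5)[OF assms] regular_conditions(2)[OF assms]
      regular_conditions(3)[OF assms] regular_conditions(4)[OF assms], of i]
  by (simp add: uh_def observed_utility_def \<mu>h_def \<delta>h_def)

lemma utility_linear:
  "vanishing P (\<lambda>t \<omega>. sqrt (real t) *\<^sub>R (uh t \<omega> - utility M b v s p x)
     - (diag (\<lambda>i. b $ i / (\<beta> $ i)\<^sup>2) ** pinv HB) *v W t \<omega>)"
proof (rule vanishing_cong)
  let ?D = "diag (\<lambda>i. b $ i / (\<beta> $ i)\<^sup>2)"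
  show "vanishing P (\<lambda>t \<omega>. utility_error t \<omega> - ?D *v (dev t \<omega> + pinv HB *v W t \<omega>))"
    by (intro vanishing_diff utility_error_vanishing
          vanishing_bounded_linear[OF matrix_vector_mul_bounded_linear dev_linear])
  show "whp P (\<lambda>t \<omega>. sqrt (real t) *\<^sub>R (uh t \<omega> - utility M b v s p x) - (?D ** pinv HB) *v W t \<omega>
      = utility_error t \<omega> - ?D *v (dev t \<omega> + pinv HB *v W t \<omega>))"
  proof (rule whp_mono[OF whp_regular])
    fix t \<omega> assume reg: "regular t \<omega>"
    have "sqrt (real t) *\<^sub>R (uh t \<omega> - utility M b v s p x) = utility_error t \<omega> - ?D *v dev t \<omega>"
      by (simp add: vec_eq_iff regular_utility[OF reg] utility_eq utility_error_def diag_vec)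
    then show "sqrt (real t) *\<^sub>R (uh t \<omega> - utility M b v s p x) - (?D ** pinv HB) *v W t \<omega>
      = utility_error t \<omega> - ?D *v (dev t \<omega> + pinv HB *v W t \<omega>)"
      by (simp add: matrix_vector_mul_assoc[symmetric] matrix_vector_right_distrib)
  qed
qed

text \<open>Welfare is \<open>\<Sum>\<^sub>i b\<^sub>i ln (b\<^sub>i / \<beta>\<^sub>i)\<close>, whose gradient in \<open>\<beta>\<close> is \<open>- w\<close>; the logarithm is expanded to second order.\<close>

lemma NSW_linear:
  defines "w \<equiv> (\<chi> i. b $ i / \<beta> $ i)"
  shows "vanishing P (\<lambda>t \<omega>. sqrt (real t) * (NSW b (uh t \<omega>) - NSW b (utility M b v s p x)) - (pinv HB *v w) \<bullet> W t \<omega>)"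
proof -
  define err where "err t \<omega> = sqrt (real t) * (NSW b (uh t \<omega>) - NSW b (utility M b v s p x)) + w \<bullet> dev t \<omega>" for t \<omega>
  define c where "c = (\<Sum>i\<in>UNIV. 2 * b $ i / (\<beta> $ i)\<^sup>2)"
  have c0: "0 \<le> c" unfolding c_def using b_pos by (intro sum_nonneg) (simp add: less_imp_le)
  have "vanishing P err"
  proof (rule vanishing_of_rate[OF dev_stochastically_bounded inverse_sqrt_tendsto, of "\<lambda>r. c * r\<^sup>2"])
    show "mono_on {0..} (\<lambda>r. c * r\<^sup>2)" using c0 by (auto intro!: mono_onI mult_left_mono power_mono)
    have "whp P (\<lambda>t \<omega>. regular t \<omega> \<and> (\<forall>i\<in>UNIV. \<bar>\<beta>g t \<omega> $ i - \<beta> $ i\<bar> \<le> \<beta>_min / 2))"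
      using \<beta>_min by (intro \<beta>g_near) simp
    then show "whp P (\<lambda>t \<omega>. norm (err t \<omega>) \<le> 1 / sqrt (real t) * (c * (norm (dev t \<omega>))\<^sup>2))"
    proof (rule whp_mono)
      fix t \<omega> assume *: "regular t \<omega> \<and> (\<forall>i\<in>UNIV. \<bar>\<beta>g t \<omega> $ i - \<beta> $ i\<bar> \<le> \<beta>_min / 2)"
      then have reg: "regular t \<omega>" and t: "0 < t" by (auto simp: regular_def)
      define y where "y i = (\<beta>g t \<omega> $ i - \<beta> $ i) / \<beta> $ i" for i
      have y: "\<bar>y i\<bar> \<le> 1 / 2" for i
      proof -
        have "\<bar>\<beta>g t \<omega> $ i - \<beta> $ i\<bar> \<le> \<beta> $ i / 2" using * \<beta>_min(2)[of i] by (meson UNIV_I divide_right_mono order_trans zero_le_numeral)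
        then show ?thesis using \<beta>_pos[of i] by (simp add: y_def field_simps)
      qed
      have dev: "dev t \<omega> $ i = sqrt (real t) * (\<beta> $ i * y i)" for i
        using \<beta>_pos[of i] by (simp add: dev_def y_def)
      have ln: "ln (uh t \<omega> $ i) - ln (utility M b v s p x $ i) = - ln (1 + y i)" for i
      proof -
        have "1 + y i = \<beta>g t \<omega> $ i / \<beta> $ i" using \<beta>_pos[of i] by (simp add: y_def field_simps)
        then show ?thesis using \<beta>_pos[of i] b_pos[of i] regular_conditions(5)[OF reg, of i]
          by (simp add: regular_utility[OF reg] utility_eq ln_div)
      qed
      have "NSW b (uh t \<omega>) - NSW b (utility M b v s p x) = (\<Sum>i\<in>UNIV. - b $ i * ln (1 + y i))"
        by (simp add: NSW_def sum_subtractf[symmetric] right_diff_distrib[symmetric] ln)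
      moreover have "w \<bullet> dev t \<omega> = sqrt (real t) * (\<Sum>i\<in>UNIV. b $ i * y i)"
      proof -
        have "w $ i * dev t \<omega> $ i = sqrt (real t) * (b $ i * y i)" for i
          using \<beta>_pos[of i] by (simp add: w_def dev)
        then show ?thesis by (simp add: inner_vec_def sum_distrib_left)
      qed
      ultimately have err: "err t \<omega> = sqrt (real t) * (\<Sum>i\<in>UNIV. b $ i * - (ln (1 + y i) - y i))"
        by (simp add: err_def distrib_left[symmetric] sum.distrib[symmetric] sum_subtractf[symmetric] algebra_simps)
      have "norm (err t \<omega>) \<le> sqrt (real t) * (\<Sum>i\<in>UNIV. \<bar>b $ i * - (ln (1 + y i) - y i)\<bar>)"
      proof -
        have "norm (err t \<omega>) = sqrt (real t) * \<bar>\<Sum>i\<in>UNIV. b $ i * - (ln (1 + y i) - y i)\<bar>"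
          unfolding err real_norm_def abs_mult[of "sqrt (real t)"] by simp
        then show ?thesis by (simp only:) (rule mult_left_mono[OF sum_abs], simp)
      qed
      also have "\<dots> \<le> sqrt (real t) * (\<Sum>i\<in>UNIV. b $ i * (2 * (y i)\<^sup>2))"
        using abs_ln_one_plus_x_minus_x_bound[OF y] b_pos
        by (intro mult_left_mono sum_mono) (auto simp: abs_mult less_imp_le abs_minus_commute)
      also have "\<dots> = 1 / sqrt (real t) * (\<Sum>i\<in>UNIV. 2 * b $ i / (\<beta> $ i)\<^sup>2 * (dev t \<omega> $ i)\<^sup>2)"
      proof -
        have "sqrt (real t) * (b $ i * (2 * (y i)\<^sup>2)) = 1 / sqrt (real t) * (2 * b $ i / (\<beta> $ i)\<^sup>2 * (dev t \<omega> $ i)\<^sup>2)" for i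
        proof -
          have "r * (B * (2 * y\<^sup>2)) = 1 / r * (2 * B / z\<^sup>2 * (r * (z * y))\<^sup>2)" if "r \<noteq> 0" "z \<noteq> 0" for r B y z :: real
            using that by (simp add: power2_eq_square field_simps)
          then show ?thesis using t \<beta>_pos[of i] unfolding dev by simp
        qed
        then show ?thesis unfolding sum_distrib_left by simp
      qed
      also have "\<dots> \<le> 1 / sqrt (real t) * (\<Sum>i\<in>UNIV. 2 * b $ i / (\<beta> $ i)\<^sup>2 * (norm (dev t \<omega>))\<^sup>2)"
      proof (intro mult_left_mono sum_mono)
        show "(dev t \<omega> $ i)\<^sup>2 \<le> (norm (dev t \<omega>))\<^sup>2" for i
          using component_le_norm_cart[of "dev t \<omega>" i] by (simp add: abs_le_square_iff[symmetric])
      qed (use b_pos in \<open>auto simp: less_imp_le\<close>)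
      finally show "norm (err t \<omega>) \<le> 1 / sqrt (real t) * (c * (norm (dev t \<omega>))\<^sup>2)"
        by (simp only: c_def sum_distrib_right)
    qed
  qed (use c0 in auto)
  from vanishing_diff[OF this vanishing_bounded_linear[OF bounded_linear_inner_right dev_linear, of w]]
  have "vanishing P (\<lambda>t \<omega>. err t \<omega> - w \<bullet> (dev t \<omega> + pinv HB *v W t \<omega>))" .
  moreover have "w \<bullet> (pinv HB *v z) = (pinv HB *v w) \<bullet> z" for z
    using pinv_HB(3) by (metis dot_lmul_matrix transpose_matrix_vector)
  ultimately show ?thesis by (simp add: err_def inner_add_right algebra_simps)
qed

text \<open>The three linear expansions in \<open>W\<close> give the limit laws. As \<open>pinv HB\<close> is symmetric, the covariances \<open>L ** \<Omega> ** transpose L\<close>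
take the stated form; the sign in the expansion of the leftover budgets cancels.\<close>

lemma asymptotic_laws:
  fixes \<H> \<P> \<H>B \<Omega> \<Sigma>\<beta> \<Sigma>u \<Sigma>\<delta> :: "real^'n^'n" and w :: "real^'n"
  assumes pg_meas: "\<And>t \<tau>. \<tau> < t \<Longrightarrow> (\<lambda>\<omega>. pg t \<omega> \<tau>) \<in> borel_measurable P"
    and xg_meas: "\<And>t i \<tau>. \<tau> < t \<Longrightarrow> (\<lambda>\<omega>. xg t \<omega> i \<tau>) \<in> borel_measurable P"
    and \<H>: "\<H> = hessian (dual_obj M b v s) \<beta>"
    and \<P>: "\<P> = diag (\<lambda>i. if \<beta> $ i < 1 then 1 else 0)"
    and \<H>B: "\<H>B = \<P> ** \<H> ** \<P>"
    and \<Omega>: "\<Omega> = covar M s (item_values v x)"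
    and \<Sigma>\<beta>: "\<Sigma>\<beta> = pinv \<H>B ** \<Omega> ** pinv \<H>B"
    and \<Sigma>u: "\<Sigma>u = diag (\<lambda>i. b $ i / (\<beta> $ i)\<^sup>2) ** \<Sigma>\<beta> ** diag (\<lambda>i. b $ i / (\<beta> $ i)\<^sup>2)"
    and \<Sigma>\<delta>: "\<Sigma>\<delta> = (mat 1 - \<H> ** pinv \<H>B) ** \<Omega> ** transpose (mat 1 - \<H> ** pinv \<H>B)"
    and w: "w = (\<chi> i. b $ i / \<beta> $ i)"
  shows "asymp_normal P
           (\<lambda>t \<omega>. sqrt (real t) *\<^sub>R
              (observed_utility b v t (\<lambda>\<tau>. X \<tau> \<omega>) (pg t \<omega>) (xg t \<omega>) - utility M b v s p x))
           \<Sigma>u \<and>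
         asymp_normal P
           (\<lambda>t \<omega>. sqrt (real t) *\<^sub>R
              (observed_leftover b t (pg t \<omega>) (xg t \<omega>) - leftover M b s p x))
           \<Sigma>\<delta> \<and>
         asymp_normal_real P
           (\<lambda>t \<omega>. sqrt (real t) *
              (NSW b (observed_utility b v t (\<lambda>\<tau>. X \<tau> \<omega>) (pg t \<omega>) (xg t \<omega>))
                - NSW b (utility M b v s p x)))
           (w \<bullet> (\<Sigma>\<beta> *v w))"
proof -
  have \<H>': "\<H> = H" by (simp add: \<H> H_eq_hessian)
  have \<P>': "\<P> = Pr" by (simp add: \<P> Pr_def)
  have \<H>B': "\<H>B = HB" by (simp add: \<H>B \<H>' \<P>' HB_def)
  note T = pinv_HB(3)
  let ?D = "diag (\<lambda>i. b $ i / (\<beta> $ i)\<^sup>2)"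
  have vX: "(\<lambda>\<omega>. v i (X \<tau> \<omega>)) \<in> borel_measurable P" for i \<tau> by measurable
  have left: "(\<lambda>\<omega>. observed_leftover b t (pg t \<omega>) (xg t \<omega>)) \<in> borel_measurable P" for t
    unfolding observed_leftover_def
    by (rule borel_measurable_vecI, unfold vec_lambda_beta)
       (intro borel_measurable_diff borel_measurable_times borel_measurable_sum borel_measurable_const pg_meas xg_meas, auto)
  have item: "(\<lambda>\<omega>. observed_item_utility v t (\<lambda>\<tau>. X \<tau> \<omega>) (xg t \<omega>)) \<in> borel_measurable P" for t
    unfolding observed_item_utility_def
    by (rule borel_measurable_vecI, unfold vec_lambda_beta)
       (intro borel_measurable_times borel_measurable_sum borel_measurable_const vX xg_meas, auto)
  have util: "(\<lambda>\<omega>. observed_utility b v t (\<lambda>\<tau>. X \<tau> \<omega>) (pg t \<omega>) (xg t \<omega>)) \<in> borel_measurable P" for t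
    unfolding observed_utility_def by (intro borel_measurable_add left item)
  have nsw: "(\<lambda>\<omega>. NSW b (observed_utility b v t (\<lambda>\<tau>. X \<tau> \<omega>) (pg t \<omega>) (xg t \<omega>))) \<in> borel_measurable P" for t
    unfolding NSW_def using util[of t] by measurable
  have "\<Sigma>u = (?D ** pinv HB) ** \<Omega> ** transpose (?D ** pinv HB)"
    by (simp add: \<Sigma>u \<Sigma>\<beta> \<H>B' matrix_transpose_mul T diag_symmetric matrix_mul_assoc)
  moreover have "asymp_normal P (\<lambda>t \<omega>. sqrt (real t) *\<^sub>R
              (observed_utility b v t (\<lambda>\<tau>. X \<tau> \<omega>) (pg t \<omega>) (xg t \<omega>) - utility M b v s p x))
        ((?D ** pinv HB) ** \<Omega> ** transpose (?D ** pinv HB))"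
    unfolding \<Omega> using utility_linear[unfolded uh_def]
    by (intro W.asymp_normal_of_linear_expansion borel_measurable_scaleR borel_measurable_diff borel_measurable_const util)
  moreover have "\<Sigma>\<delta> = (- (mat 1 - H ** pinv HB)) ** \<Omega> ** transpose (- (mat 1 - H ** pinv HB))"
  proof -
    have "(- Y) ** Z = - (Y ** Z)" "Z ** (- Y) = - (Z ** Y)" "transpose (- Y) = - transpose Y" for Y Z :: "real^'n^'n"
      by (simp_all add: matrix_matrix_mult_def vec_eq_iff transpose_def sum_negf)
    then show ?thesis unfolding \<Sigma>\<delta> \<H>' \<H>B' by (simp only: minus_minus)
  qed
  moreover have "asymp_normal P (\<lambda>t \<omega>. sqrt (real t) *\<^sub>R
              (observed_leftover b t (pg t \<omega>) (xg t \<omega>) - leftover M b s p x))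
        ((- (mat 1 - H ** pinv HB)) ** \<Omega> ** transpose (- (mat 1 - H ** pinv HB)))"
    unfolding \<Omega> using leftover_linear[unfolded \<delta>h_def \<delta>_def]
    by (intro W.asymp_normal_of_linear_expansion borel_measurable_scaleR borel_measurable_diff borel_measurable_const left)
  moreover have "w \<bullet> (\<Sigma>\<beta> *v w) = (pinv HB *v w) \<bullet> (\<Omega> *v (pinv HB *v w))"
    unfolding \<Sigma>\<beta> \<H>B' using T
    by (metis dot_lmul_matrix matrix_vector_mul_assoc transpose_matrix_vector)
  moreover have "asymp_normal_real P (\<lambda>t \<omega>. sqrt (real t) *
              (NSW b (observed_utility b v t (\<lambda>\<tau>. X \<tau> \<omega>) (pg t \<omega>) (xg t \<omega>))
                - NSW b (utility M b v s p x)))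
        ((pinv HB *v w) \<bullet> (\<Omega> *v (pinv HB *v w)))"
    unfolding \<Omega> w using NSW_linear[unfolded uh_def]
    by (intro W.asymp_normal_real_of_linear_expansion borel_measurable_times borel_measurable_diff borel_measurable_const nsw)
  ultimately show ?thesis by metis
qed

end

theorem corollary1:
  fixes M :: "'a measure"
    and b :: "real^'n"
    and v :: "'n::finite \<Rightarrow> 'a \<Rightarrow> real"
    and s :: "'a \<Rightarrow> real"
    and \<beta> :: "real^'n" and p :: "'a \<Rightarrow> real" and x :: "'n \<Rightarrow> 'a \<Rightarrow> real"
    and P :: "'w measure"
    and X :: "nat \<Rightarrow> 'w \<Rightarrow> 'a"
    and \<beta>g :: "nat \<Rightarrow> 'w \<Rightarrow> real^'n"
    and pg :: "nat \<Rightarrow> 'w \<Rightarrow> nat \<Rightarrow> real"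
    and xg :: "nat \<Rightarrow> 'w \<Rightarrow> 'n \<Rightarrow> nat \<Rightarrow> real"
    and \<H> \<P> \<H>B \<Omega> \<Sigma>\<beta> \<Sigma>u \<Sigma>\<delta> :: "real^'n^'n"
    and w :: "real^'n"
  assumes market: "market M b v s"
    and limit: "is_FPPE M b v s \<beta> p x"
    and prob: "prob_space P"
    and indep: "prob_space.indep_vars P (\<lambda>_. M) X UNIV"
    and ident: "\<And>\<tau>. distributed P M (X \<tau>) (\<lambda>\<theta>. ennreal (s \<theta>))"
    and observed: "\<And>t. 0 < t \<Longrightarrow> AE \<omega> in P.
          is_observed_FPPE b v (1 / real t) t (\<lambda>\<tau>. X \<tau> \<omega>) (\<beta>g t \<omega>) (pg t \<omega>) (xg t \<omega>)"
    and pg_meas: "\<And>t \<tau>. \<tau> < t \<Longrightarrow> (\<lambda>\<omega>. pg t \<omega> \<tau>) \<in> borel_measurable P"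
    and xg_meas: "\<And>t i \<tau>. \<tau> < t \<Longrightarrow> (\<lambda>\<omega>. xg t \<omega> i \<tau>) \<in> borel_measurable P"
    and SMO: "SMO M v s \<beta>"
    and SCS: "SCS M b s \<beta> p x"
    and \<H>: "\<H> = hessian (dual_obj M b v s) \<beta>"
    and \<P>: "\<P> = diag (\<lambda>i. if \<beta> $ i < 1 then 1 else 0)"
    and \<H>B: "\<H>B = \<P> ** \<H> ** \<P>"
    and \<Omega>: "\<Omega> = covar M s (item_values v x)"
    and \<Sigma>\<beta>: "\<Sigma>\<beta> = pinv \<H>B ** \<Omega> ** pinv \<H>B"
    and \<Sigma>u: "\<Sigma>u = diag (\<lambda>i. b $ i / (\<beta> $ i)\<^sup>2) ** \<Sigma>\<beta> ** diag (\<lambda>i. b $ i / (\<beta> $ i)\<^sup>2)"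
    and \<Sigma>\<delta>: "\<Sigma>\<delta> = (mat 1 - \<H> ** pinv \<H>B) ** \<Omega> ** transpose (mat 1 - \<H> ** pinv \<H>B)"
    and w: "w = (\<chi> i. b $ i / \<beta> $ i)"
  shows "asymp_normal P
           (\<lambda>t \<omega>. sqrt (real t) *\<^sub>R
              (observed_utility b v t (\<lambda>\<tau>. X \<tau> \<omega>) (pg t \<omega>) (xg t \<omega>) - utility M b v s p x))
           \<Sigma>u \<and>
         asymp_normal P
           (\<lambda>t \<omega>. sqrt (real t) *\<^sub>R
              (observed_leftover b t (pg t \<omega>) (xg t \<omega>) - leftover M b s p x))
           \<Sigma>\<delta> \<and>
         asymp_normal_real P
           (\<lambda>t \<omega>. sqrt (real t) *
              (NSW b (observed_utility b v t (\<lambda>\<tau>. X \<tau> \<omega>) (pg t \<omega>) (xg t \<omega>))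
                - NSW b (utility M b v s p x)))
           (w \<bullet> (\<Sigma>\<beta> *v w))"
proof -
  have lim: "limit_equilibrium M b v s \<beta> p x" by (rule limit_equilibrium.intro[OF market limit])
  have law: "distr P M (X \<tau>) = limit_equilibrium.D M s" for \<tau>
    using ident[of \<tau>] by (simp add: distributed_distr_eq_density limit_equilibrium.D_def[OF lim])
  have "sampled_equilibrium P M b v s \<beta> p x X \<beta>g pg xg"
    by (intro sampled_equilibrium.intro sampled_equilibrium_axioms.intro prob lim
          indep law observed SMO SCS)
  from sampled_equilibrium.asymptotic_laws[OF this pg_meas xg_meas \<H> \<P> \<H>B \<Omega> \<Sigma>\<beta> \<Sigma>u \<Sigma>\<delta> w]
  show ?thesis .
qed

end
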